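(* Let $C\subset\mathbb{R}^n$ be an irreducible variety of dimension in $\{1,\ldots,n-1\}$. Let $\mathcal{G}\subset\mathbb{R}^{n\times n}$ be a finite nontrivial group of orthogonal matrices, $|\mathcal{G}|>1$, acting by linear transformations $\mathbf{x}\mapsto A\mathbf{x}$, $A\in\mathcal{G}$. Assume that: 1. $\mathbf{U}\subset\mathbb{C}^n$ and $\mathbf{U}_{\mathbb{R}}\subset\mathbb{R}^n$ are the subspaces of all complex, respectively real, fixed points of $\mathcal{G}$, of complex, respectively real, dimension $\ell\in\{1,\ldots,n-1\}$; 2. $C$ is fixed by $\mathcal{G}$ (i.e., $A C=C$ for all $A\in\mathcal{G}$); 3. $\mathbf{U}_{\mathbb{R}}\cap C$ is a strict subset of $\mathbf{U}_{\mathbb{R}}$ and of $C$. Then there exists a semi-algebraic open set $O\subset\mathbb{R}^n$ containing all smooth points of $C$ lying in $C\cap\mathbf{U}_{\mathbb{R}}$ such that for each $\mathbf{x}\in O$ a best $C$-approximation of $\mathbf{x}$ is unique. Furthermore, for each $\mathbf{x}\in O\cap\mathbf{U}_{\mathbb{R}}$ the best $C$-approximation lies in $C\cap\mathbf{U}_{\mathbb{R}}$.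
   Context: A best $C$-approximation of $\mathbf{x}\in\mathbb{R}^n$ is a point $\mathbf{y}^\star\in C$ with $\|\mathbf{x}-\mathbf{y}^\star\|=\min\{\|\mathbf{x}-\mathbf{y}\|:\mathbf{y}\in C\}$, $\|\cdot\|$ Euclidean. A variety $C\subset\mathbb{R}^n$ is a common zero set $\bigcap_{i=1}^mZ(p_i)$ of real polynomials; it is irreducible if it is not the union of two strict subvarieties; the $p_i$ are chosen to generate the ideal of polynomials vanishing on $C$. A point $\mathbf{y}\in C$ is smooth if the Jacobian matrix $[\partial p_i/\partial x_j(\mathbf{y})]$ has rank $n-\dim C$. A set is semi-algebraic if it is a finite union of sets each given by finitely many polynomial equalities and strict polynomial inequalities. *)

theory Defs
  imports "HOL-Analysis.Analysis"
begin

text \<open>Real polynomials are represented by \<^const>\<open>real_polynomial_function\<close>: over the infinite field of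
  reals a polynomial is determined by the function it induces.\<close>

definition real_variety :: "'a::euclidean_space set \<Rightarrow> bool" where
  "real_variety C \<longleftrightarrow>
    (\<exists>P. finite P \<and> (\<forall>p\<in>P. real_polynomial_function p) \<and> C = {x. \<forall>p\<in>P. p x = 0})"

text \<open>The empty set is excluded, as usual; otherwise it would lengthen every chain in the definition
  of the dimension by one.\<close>

definition irreducible_variety :: "'a::euclidean_space set \<Rightarrow> bool" where
  "irreducible_variety C \<longleftrightarrow> real_variety C \<and> C \<noteq> {} \<and>
    \<not> (\<exists>V W. real_variety V \<and> real_variety W \<and> V \<subset> C \<and> W \<subset> C \<and> C = V \<union> W)"

text \<open>Krull dimension: the supremum of the lengths \<open>k\<close> of strictly increasing chains
  \<open>V 0 \<subset> V 1 \<subset> \<dots> \<subset> V k\<close> of irreducible varieties contained in \<open>C\<close>. It takes values in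
  \<^typ>\<open>enat\<close> so that the supremum is meaningful without a prior proof that it is finite.\<close>

definition variety_dim :: "'a::euclidean_space set \<Rightarrow> enat" where
  "variety_dim C =
    (SUP k \<in> {k. \<exists>V :: nat \<Rightarrow> 'a set.
        (\<forall>i\<le>k. irreducible_variety (V i) \<and> V i \<subseteq> C) \<and> (\<forall>i<k. V i \<subset> V (Suc i))}. enat k)"

definition generates_vanishing_ideal ::
  "('m::finite \<Rightarrow> 'a::euclidean_space \<Rightarrow> real) \<Rightarrow> 'a set \<Rightarrow> bool" where
  "generates_vanishing_ideal p C \<longleftrightarrow>
    (\<forall>i. real_polynomial_function (p i)) \<and>
    {q. real_polynomial_function q \<and> (\<forall>x\<in>C. q x = 0)} =
    {q. \<exists>r. (\<forall>i. real_polynomial_function (r i)) \<and> q = (\<lambda>x. \<Sum>i\<in>UNIV. r i x * p i x)}"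

text \<open>The notion is meant for \<open>p\<close> generating the vanishing ideal of \<open>C\<close>.\<close>

definition smooth_point ::
  "('m::finite \<Rightarrow> real^'n \<Rightarrow> real) \<Rightarrow> (real^'n) set \<Rightarrow> real^'n \<Rightarrow> bool" where
  "smooth_point p C y \<longleftrightarrow> y \<in> C \<and>
    enat (rank (jacobian (\<lambda>x. \<chi> i. p i x) (at y) :: real^'n^'m)) = enat CARD('n) - variety_dim C"

definition basic_semialgebraic :: "'a::euclidean_space set \<Rightarrow> bool" where
  "basic_semialgebraic S \<longleftrightarrow>
    (\<exists>P Q. finite P \<and> finite Q \<and>
      (\<forall>p\<in>P. real_polynomial_function p) \<and> (\<forall>q\<in>Q. real_polynomial_function q) \<and>
      S = {x. (\<forall>p\<in>P. p x = 0) \<and> (\<forall>q\<in>Q. q x > 0)})"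

definition semialgebraic :: "'a::euclidean_space set \<Rightarrow> bool" where
  "semialgebraic S \<longleftrightarrow> (\<exists>F. finite F \<and> (\<forall>B\<in>F. basic_semialgebraic B) \<and> S = \<Union>F)"

definition best_approximation :: "'a::euclidean_space set \<Rightarrow> 'a \<Rightarrow> 'a \<Rightarrow> bool" where
  "best_approximation C x y \<longleftrightarrow> y \<in> C \<and> (\<forall>z\<in>C. norm (x - y) \<le> norm (x - z))"

definition orthogonal_group :: "(real^'n^'n) set \<Rightarrow> bool" where
  "orthogonal_group G \<longleftrightarrow> (\<forall>A\<in>G. orthogonal_matrix A) \<and> mat 1 \<in> G \<and>
    (\<forall>A\<in>G. \<forall>B\<in>G. A ** B \<in> G) \<and> (\<forall>A\<in>G. matrix_inv A \<in> G)"

definition fixed_points :: "('a::semiring_1^'n^'n) set \<Rightarrow> ('a^'n) set" where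
  "fixed_points G = {x. \<forall>A\<in>G. A *v x = x}"

end

theory Submission
  imports Defs
begin

text \<open>The set of points with a unique best approximation is definable over the reals, so by quantifier
  elimination (Tarski--Seidenberg, by Hoermander's induction on sign patterns) its interior \<open>N\<close> is
  semialgebraic. It remains to see that \<open>N\<close> contains the smooth points; the statement on \<open>UR\<close> follows
  since the orthogonal group permutes the best approximations of a fixed point.

  Let \<open>y\<close> be smooth, so that \<open>n - d\<close> of the generators have independent gradients at \<open>y\<close>. No point of \<open>C\<close>
  admits more independent gradients of polynomials vanishing on \<open>C\<close>: the ideal of \<open>C\<close>, localized at
  itself, is generated by some \<open>e\<close> elements, so there are at most \<open>e\<close> independent gradients, and polynomials
  of degree \<open>k\<close> restrict to \<open>C\<close> as a space of dimension \<open>O(k^(n - e))\<close>, while a chain of \<open>d + 1\<close> irreducible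
  subvarieties forces this dimension to grow at least like \<open>k^d\<close>; hence \<open>d \<le> n - e\<close>. Consequently the
  polynomial vector fields tangent to the level sets of the chosen \<open>n - d\<close> generators preserve the
  ideal of \<open>C\<close>, their flows stay in \<open>C\<close>, and near \<open>y\<close> the variety is the manifold cut out by these generators.
  A second order estimate then shows that points close to \<open>y\<close> have a unique nearest point.\<close>

section \<open>Univariate polynomials with the same sign pattern\<close>

text \<open>The obstacle lies at the smooth points. Smoothness is a rank condition at
  \<open>y\<close> alone, and the manifold cut out near \<open>y\<close> by the selected generators
  contains \<open>C\<close> but might a priori be larger. Equality needs that at every point of
  \<open>C\<close> near \<open>y\<close> the gradients of all polynomials vanishing on
  \<open>C\<close> are still combinations of the selected ones. As the dimension is defined by
  chains of real varieties, the bound on the rank comes from counting polynomials. The count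
  controls generic points of \<open>C\<close> only; special points are reached because a
  nonvanishing determinant is a polynomial condition and the vanishing ideal of an irreducible
  variety is prime.

  On the logical side, sign patterns on a line are compared by increasing bijections of that line. A
  witness for an existential quantifier is then transported by the bijection, and no root functions
  have to be carried along. Taking an interior at the end gives openness without losing a smooth
  point, since each of them has a whole ball of good points around it.\<close>

lemma sgn_poly_at_top:
  fixes q :: "real poly"
  assumes "pderiv q \<noteq> 0"
  shows "\<exists>n. \<forall>t\<ge>n. sgn (poly q t) = sgn (poly (pderiv q) t)"
proof -
  have sgn_lc: "\<exists>n. \<forall>t\<ge>n. sgn (poly r t) = sgn (lead_coeff r)" if "r \<noteq> 0" for r :: "real poly"
  proof (cases "lead_coeff r > 0")
    case True
    then obtain n where "\<forall>t\<ge>n. poly r t \<ge> lead_coeff r"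
      using poly_pinfty_gt_lc by blast
    with True show ?thesis by (intro exI[of _ n]) (auto simp: sgn_if)
  next
    case False
    with that have "lead_coeff (-r) > 0"
      using leading_coeff_neq_0[of r] by (simp add: less_le)
    moreover from this obtain n where "\<forall>t\<ge>n. poly (-r) t \<ge> lead_coeff (-r)"
      using poly_pinfty_gt_lc by blast
    ultimately show ?thesis by (intro exI[of _ n]) (force simp: sgn_if)
  qed
  \<comment> \<open>Differentiation multiplies the leading coefficient by the degree, which is
    positive, and leading coefficients decide the signs near infinity.\<close>
  have "degree q \<noteq> 0" using assms by (simp add: pderiv_eq_0_iff)
  then have "sgn (lead_coeff (pderiv q)) = sgn (lead_coeff q)" "q \<noteq> 0"
    by (auto simp: degree_pderiv coeff_pderiv sgn_mult)
  with sgn_lc[of q] sgn_lc[OF assms] obtain a b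
    where "\<forall>t\<ge>a. sgn (poly q t) = sgn (lead_coeff q)"
      "\<forall>t\<ge>b. sgn (poly (pderiv q) t) = sgn (lead_coeff q)" by metis
  then show ?thesis by (intro exI[of _ "max a b"]) auto
qed

text \<open>Arguments are inserted in increasing order; to the right of the last one the map
  continues along a line of positive slope. Surjectivity is kept because roots of the polynomials on
  the target side must be images.\<close>

lemma extend_strict_mono_on:
  fixes g :: "real \<Rightarrow> real"
  assumes "finite W" "strict_mono_on W g"
  shows "\<exists>\<phi>. strict_mono \<phi> \<and> surj \<phi> \<and> (\<forall>w\<in>W. \<phi> w = g w)"
  using assms
proof (induction W rule: finite_linorder_max_induct)
  case empty
  show ?case by (intro exI[of _ id]) (auto simp: strict_mono_def)
next
  case (insert w W)
  then have "strict_mono_on W g" by (auto simp: strict_mono_on_def)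
  with insert.IH obtain \<phi> where \<phi>: "strict_mono \<phi>" "surj \<phi>" "\<forall>w\<in>W. \<phi> w = g w" by blast
  show ?case
  proof (cases "W = {}")
    case True
    show ?thesis
    proof (intro exI[of _ "\<lambda>x. x - w + g w"] conjI)
      show "surj (\<lambda>x. x - w + g w)" by (rule surjI[of _ "\<lambda>y. y + w - g w"]) simp
    qed (auto simp: strict_mono_def True)
  next
    case False
    define m where "m = Max W"
    have m: "m \<in> W" "\<And>v. v \<in> W \<Longrightarrow> v \<le> m" using False insert.hyps by (auto simp: m_def)
    have mw: "m < w" using m insert by auto
    have gmw: "g m < g w" using insert.prems m mw by (auto simp: strict_mono_on_def)
    \<comment> \<open>The slope that takes the line from \<open>(m, g m)\<close> to
      \<open>(w, g w)\<close>.\<close>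
    define c where "c = (g w - g m) / (w - m)"
    have c: "c > 0" using mw gmw by (simp add: c_def)
    define \<psi> where "\<psi> x = (if x \<le> m then \<phi> x else g m + (x - m) * c)" for x
    have \<phi>m: "\<phi> m = g m" using \<phi> m by auto
    have "strict_mono \<psi>"
    proof (rule strict_monoI)
      fix x y :: real assume xy: "x < y"
      have "\<phi> x \<le> g m" if "x \<le> m" using \<phi>(1) that \<phi>m by (metis strict_mono_less_eq)
      moreover have "(y - m) * c > 0" if "y > m" using that c by simp
      moreover have "\<phi> x < \<phi> y" using \<phi>(1) xy by (simp add: strict_mono_less)
      moreover have "(x - m) * c < (y - m) * c" using xy c by simp
      ultimately show "\<psi> x < \<psi> y" using xy by (auto simp: \<psi>_def)
    qed
    moreover have "surj \<psi>"
    proof (rule surjI)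
      fix y
      show "\<psi> (if y \<le> g m then inv \<phi> y else m + (y - g m) / c) = y"
      proof (cases "y \<le> g m")
        case True
        have "\<phi> (inv \<phi> y) = y" using \<phi>(2) by (simp add: surj_f_inv_f)
        moreover from this have "inv \<phi> y \<le> m"
          using True \<phi>(1) \<phi>m by (metis strict_mono_less_eq)
        ultimately show ?thesis using True by (simp add: \<psi>_def)
      next
        case False
        then have "\<not> m + (y - g m) / c \<le> m" using c by (simp add: not_le)
        then show ?thesis using False c by (simp add: \<psi>_def)
      qed
    qed
    moreover have "\<forall>v\<in>insert w W. \<psi> v = g v"
      using mw m \<phi>(3) by (auto simp: \<psi>_def c_def)
    ultimately show ?thesis by blast
  qed
qed

lemma sgn_poly_eq_of_no_root:
  fixes q :: "real poly"
  assumes "\<And>s. min a b \<le> s \<Longrightarrow> s \<le> max a b \<Longrightarrow> poly q s \<noteq> 0"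
  shows "sgn (poly q a) = sgn (poly q b)"
proof (rule ccontr)
  assume neq: "sgn (poly q a) \<noteq> sgn (poly q b)"
  then have "a \<noteq> b" by auto
  have nz: "poly q a \<noteq> 0" "poly q b \<noteq> 0" using assms[of a] assms[of b] by auto
  have "poly q (min a b) * poly q (max a b) < 0"
    using neq nz by (cases "a \<le> b") (auto simp: sgn_if mult_less_0_iff not_less split: if_splits)
  then obtain x where "x > min a b" "x < max a b" "poly q x = 0"
    using poly_IVT[of "min a b" "max a b" q] \<open>a \<noteq> b\<close> by (auto simp: min_def max_def split: if_splits)
  then show False using assms[of x] by auto
qed

lemma sgn_poly_eq:
  fixes q :: "real poly"
  assumes "\<And>t. poly q t = 0 \<Longrightarrow> (t < a \<longleftrightarrow> t < b) \<and> (a < t \<longleftrightarrow> b < t)"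
  shows "sgn (poly q a) = sgn (poly q b)"
proof (cases "a = b")
  case False
  show ?thesis
  proof (rule sgn_poly_eq_of_no_root)
    fix s assume "min a b \<le> s" "s \<le> max a b"
    then show "poly q s \<noteq> 0" using assms[of s] False by (auto simp: min_def max_def split: if_splits)
  qed
qed simp

text \<open>By the mean value theorem \<open>poly p t\<close> is \<open>t - s\<close> times a value
  of \<open>pderiv p\<close> in between, and \<open>pderiv p\<close> keeps one sign there because
  none of its roots lies between \<open>s\<close> and \<open>t\<close>, ends included.\<close>

lemma sgn_poly_increment:
  fixes p :: "real poly"
  assumes "poly p s = 0" "s \<noteq> t"
    and "\<And>w. poly (pderiv p) w = 0 \<Longrightarrow> (w < s \<longleftrightarrow> w < t) \<and> (s < w \<longleftrightarrow> t < w)"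
  shows "sgn (poly p t) = sgn (t - s) * sgn (poly (pderiv p) t)"
proof -
  have same: "sgn (poly (pderiv p) x) = sgn (poly (pderiv p) t)" if "min s t \<le> x" "x \<le> max s t" for x
  proof (rule sgn_poly_eq_of_no_root)
    fix w assume "min x t \<le> w" "w \<le> max x t"
    then have "min s t \<le> w" "w \<le> max s t" using that by auto
    then show "poly (pderiv p) w \<noteq> 0" using assms(3)[of w] assms(2) 
      by (auto simp: min_def max_def split: if_splits)
  qed
  consider "s < t" | "t < s" using assms(2) by linarith
  then show ?thesis
  proof cases
    case 1
    then obtain x where x: "s < x" "x < t" "poly p t - poly p s = (t - s) * poly (pderiv p) x"
      using poly_MVT by blast
    with same[of x] 1 show ?thesis using assms(1) by (simp add: sgn_mult)
  next
    case 2
    then obtain x where x: "t < x" "x < s" "poly p s - poly p t = (s - t) * poly (pderiv p) x"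
      using poly_MVT by blast
    then have "poly p t = (t - s) * poly (pderiv p) x" using assms(1) by (simp add: algebra_simps)
    with same[of x] 2 x show ?thesis by (simp add: sgn_mult)
  qed
qed

text \<open>For an increasing bijection \<open>\<phi>\<close>, the points \<open>t\<close> and \<open>t'\<close> lie in corresponding cells of the
  partitions of the line cut out by \<open>Z\<close> and \<open>\<phi> ` Z\<close>.\<close>

definition same_cell :: "real set \<Rightarrow> (real \<Rightarrow> real) \<Rightarrow> real \<Rightarrow> real \<Rightarrow> bool" where
  "same_cell Z \<phi> t t' \<longleftrightarrow> (\<forall>w\<in>Z. (w < t \<longleftrightarrow> \<phi> w < t') \<and> (t < w \<longleftrightarrow> t' < \<phi> w))"

text \<open>To the right of \<open>t\<close> the polynomial \<open>p\<close> increases within its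
  cell, so it is positive at the right endpoint \<open>b\<close>. There the sign of \<open>q\<close>
  is known, and continuity gives a positive value of \<open>q\<close> just inside the corresponding
  cell. An unbounded cell has no such endpoint; the common sign of \<open>q\<close> and
  \<open>pderiv q\<close> near infinity replaces it.\<close>

lemma cell_positive_value_increasing:
  fixes p q :: "real poly"
  assumes Z: "finite Z" and \<phi>: "strict_mono \<phi>" "surj \<phi>"
    and sd: "\<And>t. sgn (poly (pderiv p) t) = sgn (poly (pderiv q) (\<phi> t))"
    and nz: "pderiv p \<noteq> 0" and rd: "\<And>t. poly (pderiv p) t = 0 \<Longrightarrow> t \<in> Z"
    and pq: "\<And>t. t \<in> Z \<Longrightarrow> sgn (poly p t) = sgn (poly q (\<phi> t))"
    and t: "t \<notin> Z" "poly p t > 0" "poly (pderiv p) t > 0"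
  shows "\<exists>t'. same_cell Z \<phi> t t' \<and> poly q t' > 0"
proof -
  have nzq: "pderiv q \<noteq> 0"
  proof
    assume "pderiv q = 0"
    then have "\<forall>t. poly (pderiv p) t = 0" using sd by (simp add: sgn_0_0)
    then show False using nz poly_all_0_iff_0 by blast
  qed
  have mono: "\<phi> a < \<phi> b \<longleftrightarrow> a < b" for a b using \<phi>(1) by (simp add: strict_mono_less)
  have pos: "poly (pderiv p) s > 0" if "t \<le> s" "\<And>w. w \<in> Z \<Longrightarrow> t < w \<Longrightarrow> s < w" for s
  proof -
    have "sgn (poly (pderiv p) s) = sgn (poly (pderiv p) t)"
    proof (rule sgn_poly_eq)
      fix w assume "poly (pderiv p) w = 0"
      then have "w \<in> Z" "w \<noteq> t" using rd t(3) by auto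
      then show "(w < s \<longleftrightarrow> w < t) \<and> (s < w \<longleftrightarrow> t < w)"
        using that(2)[of w] that(1) by (cases w t rule: linorder_cases) auto
    qed
    with t(3) show ?thesis by (simp add: sgn_if split: if_splits)
  qed
  show ?thesis
  proof (cases "\<exists>w\<in>Z. t < w")
    case True
    define b where "b = Min {w\<in>Z. t < w}"
    have fin: "finite {w\<in>Z. t < w}" and ne: "{w\<in>Z. t < w} \<noteq> {}" using Z True by auto
    have b: "b \<in> Z" "t < b" using Min_in[OF fin ne] by (auto simp: b_def)
    have bl: "b \<le> w" if "w \<in> Z" "t < w" for w using Min_le[OF fin] that by (auto simp: b_def)
    obtain x where x: "t < x" "x < b" "poly p b - poly p t = (b - t) * poly (pderiv p) x"
      using poly_MVT[OF b(2)] by blast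
    have "poly (pderiv p) x > 0" using pos[of x] x bl by fastforce
    then have "poly p b > 0" using x b t(2) by (smt (verit) mult_pos_pos)
    then have qb: "poly q (\<phi> b) > 0" using pq[OF b(1)] by (simp add: sgn_if split: if_splits)
    have "isCont (poly q) (\<phi> b)" by simp
    then obtain e where e: "e > 0" "\<And>s. \<bar>s - \<phi> b\<bar> < e \<Longrightarrow> \<bar>poly q s - poly q (\<phi> b)\<bar> < poly q (\<phi> b)"
      unfolding continuous_at_eps_delta using qb by (auto simp: dist_real_def)
    \<comment> \<open>The first bound keeps \<open>t'\<close> in the corresponding cell, the second
      keeps it close enough to \<open>\<phi> b\<close> for \<open>q\<close> to stay
      positive.\<close>
    define t' where "t' = max (\<phi> t) (\<phi> b - e / 2)"
    have t': "\<phi> t \<le> t'" "t' < \<phi> b" using e(1) b(2) mono by (auto simp: t'_def)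
    have "\<bar>t' - \<phi> b\<bar> < e" using t' e(1) by (auto simp: t'_def)
    then have "poly q t' > 0" using e(2)[of t'] by linarith
    moreover have "same_cell Z \<phi> t t'"
      unfolding same_cell_def
    proof (intro ballI)
      fix w assume w: "w \<in> Z"
      then have "w \<noteq> t" using t by auto
      then consider "w < t" | "t < w" by linarith
      then show "(w < t \<longleftrightarrow> \<phi> w < t') \<and> (t < w \<longleftrightarrow> t' < \<phi> w)"
      proof cases
        case 1 then show ?thesis using mono[of w t] t' by auto
      next
        case 2
        then have "\<phi> b \<le> \<phi> w" using bl[OF w] \<phi>(1) by (simp add: strict_mono_less_eq)
        with 2 show ?thesis using t' by auto
      qed
    qed
    ultimately show ?thesis by blast
  next
    case False
    then have Zt: "w < t" if "w \<in> Z" for w using that t by (metis linorder_neqE)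
    obtain n where n: "\<And>s. s \<ge> n \<Longrightarrow> sgn (poly q s) = sgn (poly (pderiv q) s)"
      using sgn_poly_at_top[OF nzq] by blast
    define t' where "t' = max (\<phi> t) n"
    obtain s where s: "t' = \<phi> s" using \<phi>(2) by (metis surjD)
    have "t \<le> s" using s \<phi>(1) by (metis max.cobounded1 strict_mono_less_eq t'_def)
    then have "poly (pderiv p) s > 0" using pos[of s] False by blast
    then have "sgn (poly q t') = 1" using n[of t'] sd[of s] s by (simp add: t'_def)
    moreover have "same_cell Z \<phi> t t'"
    proof -
      have "\<phi> w < t'" if "w \<in> Z" for w using mono[of w t] Zt[OF that] by (simp add: t'_def)
      then show ?thesis using Zt unfolding same_cell_def by (meson order_less_asym)
    qed
    ultimately show ?thesis by (metis sgn_1_pos)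
  qed
qed

lemma pderiv_reflect:
  fixes q :: "real poly"
  shows "poly (pderiv (pcompose q [:0, -1:])) t = - poly (pderiv q) (- t)"
  by (simp add: pderiv_pcompose poly_pcompose pderiv_pCons)

text \<open>If \<open>p\<close> decreases at \<open>t\<close>, reflection of the line at the origin
  leads back to the increasing case, with \<open>\<phi>\<close> conjugated by negation.\<close>

lemma cell_positive_value:
  fixes p q :: "real poly"
  assumes Z: "finite Z" and \<phi>: "strict_mono \<phi>" "surj \<phi>"
    and sd: "\<And>t. sgn (poly (pderiv p) t) = sgn (poly (pderiv q) (\<phi> t))"
    and nz: "pderiv p \<noteq> 0" and rd: "\<And>t. poly (pderiv p) t = 0 \<Longrightarrow> t \<in> Z"
    and pq: "\<And>t. t \<in> Z \<Longrightarrow> sgn (poly p t) = sgn (poly q (\<phi> t))"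
    and t: "t \<notin> Z" "poly p t > 0"
  shows "\<exists>t'. same_cell Z \<phi> t t' \<and> poly q t' > 0"
proof (cases "poly (pderiv p) t > 0")
  case True
  then show ?thesis using cell_positive_value_increasing[OF Z \<phi> sd nz rd pq t] by blast
next
  case False
  then have neg: "poly (pderiv p) t < 0" using rd t(1) by force
  let ?p = "pcompose p [:0, -1:]" and ?q = "pcompose q [:0, -1:]" and ?\<psi> = "\<lambda>s. - \<phi> (- s)"
  have "\<exists>t'. same_cell (uminus ` Z) ?\<psi> (- t) t' \<and> poly ?q t' > 0"
  proof (rule cell_positive_value_increasing)
    show "strict_mono ?\<psi>" using \<phi>(1) by (simp add: strict_mono_def)
    show "surj ?\<psi>" using \<phi>(2) by (intro surjI[of _ "\<lambda>y. - inv \<phi> (- y)"]) (simp add: surj_f_inv_f)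
    show "pderiv ?p \<noteq> 0"
    proof
      assume "pderiv ?p = 0"
      then show False using pderiv_reflect[of p "- t"] neg by simp
    qed
    show "sgn (poly (pderiv ?p) s) = sgn (poly (pderiv ?q) (?\<psi> s))" for s
      using sd[of "- s"] by (simp only: pderiv_reflect sgn_minus minus_minus)
    show "s \<in> uminus ` Z" if "poly (pderiv ?p) s = 0" for s
      using that rd[of "- s"] by (intro image_eqI[of _ _ "- s"]) (simp_all add: pderiv_reflect)
    show "sgn (poly ?p s) = sgn (poly ?q (?\<psi> s))" if "s \<in> uminus ` Z" for s
      using that pq by (auto simp: poly_pcompose)
    show "- t \<notin> uminus ` Z" using t(1) by auto
    show "poly (pderiv ?p) (- t) > 0" using neg by (simp add: pderiv_reflect)
  qed (use Z t in \<open>simp_all add: poly_pcompose\<close>)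
  then obtain t' where t': "same_cell (uminus ` Z) ?\<psi> (- t) t'" "poly ?q t' > 0" by blast
  have "same_cell Z \<phi> t (- t')"
    unfolding same_cell_def
  proof
    fix w assume "w \<in> Z"
    then have "(- w < - t \<longleftrightarrow> - \<phi> w < t') \<and> (- t < - w \<longleftrightarrow> t' < - \<phi> w)"
      using t'(1) unfolding same_cell_def by force
    then show "(w < t \<longleftrightarrow> \<phi> w < - t') \<and> (t < w \<longleftrightarrow> - t' < \<phi> w)" by auto
  qed
  with t'(2) show ?thesis by (auto simp: poly_pcompose)
qed

text \<open>Negative values follow by negating both polynomials. At a root \<open>t\<close> of
  \<open>p\<close> the derivative is nonzero, so \<open>p\<close> has opposite signs slightly to the
  left and to the right; both signs occur for \<open>q\<close> in the corresponding cell, and the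
  intermediate value theorem gives a root there.\<close>

lemma cell_sign_value:
  fixes p q :: "real poly"
  assumes Z: "finite Z" and \<phi>: "strict_mono \<phi>" "surj \<phi>"
    and sd: "\<And>t. sgn (poly (pderiv p) t) = sgn (poly (pderiv q) (\<phi> t))"
    and nz: "pderiv p \<noteq> 0" and rd: "\<And>t. poly (pderiv p) t = 0 \<Longrightarrow> t \<in> Z"
    and pq: "\<And>t. t \<in> Z \<Longrightarrow> sgn (poly p t) = sgn (poly q (\<phi> t))"
    and t: "t \<notin> Z"
  shows "\<exists>t'. same_cell Z \<phi> t t' \<and> sgn (poly q t') = sgn (poly p t)"
proof -
  have nonzero: "\<exists>t'. same_cell Z \<phi> s t' \<and> sgn (poly q t') = sgn (poly p s)"
    if s: "s \<notin> Z" "poly p s \<noteq> 0" for s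
  proof (cases "poly p s > 0")
    case True
    then show ?thesis using cell_positive_value[OF Z \<phi> sd nz rd pq s(1)] by force
  next
    case False
    have "\<exists>t'. same_cell Z \<phi> s t' \<and> poly (- q) t' > 0"
    proof (rule cell_positive_value[OF Z \<phi>, of "- p" "- q"])
      show "poly (- p) s > 0" using False s(2) by simp
    qed (use nz rd pq s sd in \<open>auto simp: pderiv_minus sgn_minus\<close>)
    then show ?thesis using False s(2) by force
  qed
  show ?thesis
  proof (cases "poly p t = 0")
    case False then show ?thesis using nonzero t by blast
  next
    case True
    obtain e where e: "e > 0" "\<And>w. w \<in> Z \<Longrightarrow> e \<le> \<bar>w - t\<bar>"
      using finite_set_avoid[OF Z, of t] t by (auto simp: dist_real_def) (metis abs_minus_commute)
    define a b where "a = t - e / 2" and "b = t + e / 2"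
    have near: "(w < s \<longleftrightarrow> w < t) \<and> (s < w \<longleftrightarrow> t < w)" if "w \<in> Z" "s \<in> {a, b}" for w s
      using e(2)[OF that(1)] e(1) that(2) by (auto simp: a_def b_def abs_if split: if_splits)
    have ab: "a < t" "t < b" using e by (auto simp: a_def b_def)
    have dt: "poly (pderiv p) t \<noteq> 0" using rd t by blast
    have ders: "sgn (poly (pderiv p) s) = sgn (poly (pderiv p) t)" if "s \<in> {a, b}" for s
      by (rule sgn_poly_eq) (use rd near that in blast)
    have sa: "sgn (poly p a) = - sgn (poly (pderiv p) t)"
      using sgn_poly_increment[of p t a] True ab near[of _ a] rd ders[of a] by force
    have sb: "sgn (poly p b) = sgn (poly (pderiv p) t)"
      using sgn_poly_increment[of p t b] True ab near[of _ b] rd ders[of b] by force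
    have "a \<notin> Z" "b \<notin> Z" using near[of a a] near[of b b] ab by auto
    moreover have "poly p a \<noteq> 0" "poly p b \<noteq> 0" using sa sb dt by (auto simp: sgn_0_0)
    ultimately obtain a' b' where a': "same_cell Z \<phi> a a'" "sgn (poly q a') = sgn (poly p a)"
      and b': "same_cell Z \<phi> b b'" "sgn (poly q b') = sgn (poly p b)" using nonzero by metis
    have "sgn (poly q a') \<noteq> sgn (poly q b')" using a' b' sa sb dt by (simp add: sgn_if)
    then obtain s where s: "min a' b' \<le> s" "s \<le> max a' b'" "poly q s = 0"
      using sgn_poly_eq_of_no_root by metis
    have "same_cell Z \<phi> t s"
      unfolding same_cell_def
    proof (intro ballI)
      fix w assume w: "w \<in> Z"
      have "w \<noteq> t" using w t by auto
      then show "(w < t \<longleftrightarrow> \<phi> w < s) \<and> (t < w \<longleftrightarrow> s < \<phi> w)"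
        using a'(1) b'(1) w near[OF w, of a] near[OF w, of b] s(1,2) unfolding same_cell_def
        by (smt (verit) insertCI)
    qed
    with s True show ?thesis by auto
  qed
qed

text \<open>The core of Hoermander's argument. Unless \<open>p\<close> is constant, it is strictly
  monotone on each cell cut out by the roots of the nonzero \<open>P i\<close> and of
  \<open>pderiv p\<close>, hence has at most one root in it, and the data at the ends of the cell
  and at infinity decide whether there is one. Changing \<open>\<phi>\<close> so that it also
  matches these roots makes it respect \<open>p\<close>. Constant \<open>p\<close> is settled by
  \<open>rc\<close>.\<close>

lemma sign_equivalence_refine:
  fixes P Q :: "'i \<Rightarrow> real poly" and p q :: "real poly"
  assumes fin: "finite I" and \<phi>: "strict_mono \<phi>" "surj \<phi>"
    and sg: "\<And>i t. i \<in> I \<Longrightarrow> sgn (poly (P i) t) = sgn (poly (Q i) (\<phi> t))"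
    and sd: "\<And>t. sgn (poly (pderiv p) t) = sgn (poly (pderiv q) (\<phi> t))"
    and rt: "\<And>i t. i \<in> I \<Longrightarrow> P i \<noteq> 0 \<Longrightarrow> poly (P i) t = 0 \<Longrightarrow> sgn (poly p t) = sgn (poly q (\<phi> t))"
    and rd: "\<And>t. pderiv p \<noteq> 0 \<Longrightarrow> poly (pderiv p) t = 0 \<Longrightarrow> sgn (poly p t) = sgn (poly q (\<phi> t))"
    and rc: "sgn (coeff p 0) = sgn (coeff q 0)"
  shows "\<exists>\<phi>'. strict_mono \<phi>' \<and> surj \<phi>' \<and>
    (\<forall>i\<in>I. \<forall>t. sgn (poly (P i) t) = sgn (poly (Q i) (\<phi>' t))) \<and>
    (\<forall>t. sgn (poly p t) = sgn (poly q (\<phi>' t)))"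
proof -
  have zero: "f = 0 \<longleftrightarrow> g = 0"
    if "\<And>t. sgn (poly f t) = sgn (poly g (\<phi> t))" for f g :: "real poly"
  proof -
    have "f = 0 \<longleftrightarrow> (\<forall>t. poly g (\<phi> t) = 0)"
      using that poly_all_0_iff_0[of f] by (metis sgn_0_0)
    also have "\<dots> \<longleftrightarrow> g = 0"
      using poly_all_0_iff_0[of g] \<phi>(2) by (metis surjD)
    finally show ?thesis .
  qed
  have mono: "\<phi> a < \<phi> b \<longleftrightarrow> a < b" for a b using \<phi>(1) by (simp add: strict_mono_less)
  show ?thesis
  proof (cases "pderiv p = 0")
    case True
    then have "pderiv q = 0" using zero[OF sd] by simp
    with True obtain a b where ab: "p = [:a:]" "q = [:b:]"
      using degree_eq_zeroE by (metis pderiv_eq_0_iff)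
    with rc have "\<forall>t. sgn (poly p t) = sgn (poly q (\<phi> t))" by simp
    then show ?thesis using \<phi> sg by blast
  next
    case nz: False
    then have nzq: "pderiv q \<noteq> 0" using zero[OF sd] by simp
    then have nz0: "p \<noteq> 0" "q \<noteq> 0" using nz by auto
    define Z where "Z = (\<Union>i\<in>{i\<in>I. P i \<noteq> 0}. {t. poly (P i) t = 0}) \<union> {t. poly (pderiv p) t = 0}"
    have Z: "finite Z" using fin nz by (auto simp: Z_def intro!: poly_roots_finite)
    have rdZ: "t \<in> Z" if "poly (pderiv p) t = 0" for t using that by (simp add: Z_def)
    have pqZ: "sgn (poly p t) = sgn (poly q (\<phi> t))" if "t \<in> Z" for t
      using that rt rd[OF nz] by (auto simp: Z_def)
    have rdqZ: "t \<in> \<phi> ` Z" if "poly (pderiv q) t = 0" for t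
    proof -
      obtain s where s: "t = \<phi> s" using \<phi>(2) by (metis surjD)
      then have "poly (pderiv p) s = 0" using sd[of s] that by (simp add: sgn_0_0)
      then show ?thesis using rdZ s by blast
    qed
    define R where "R = {t. poly p t = 0}"
    have finR: "finite R" using nz0 by (auto simp: R_def intro!: poly_roots_finite)
    have "\<forall>z\<in>R - Z. \<exists>z'. same_cell Z \<phi> z z' \<and> poly q z' = 0"
    proof
      fix z assume "z \<in> R - Z"
      then show "\<exists>z'. same_cell Z \<phi> z z' \<and> poly q z' = 0"
        using cell_sign_value[OF Z \<phi> sd nz rdZ pqZ, of z] by (auto simp: R_def sgn_0_0)
    qed
    then obtain r where r: "\<And>z. z \<in> R - Z \<Longrightarrow> same_cell Z \<phi> z (r z) \<and> poly q (r z) = 0" by metis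
    define g where "g z = (if z \<in> Z then \<phi> z else r z)" for z
    have "strict_mono_on (Z \<union> R) g"
    proof (rule strict_mono_onI)
      fix x y assume xy: "x \<in> Z \<union> R" "y \<in> Z \<union> R" "x < y"
      consider "x \<in> Z" "y \<in> Z" | "x \<in> Z" "y \<in> R - Z" | "x \<in> R - Z" "y \<in> Z" | "x \<in> R - Z" "y \<in> R - Z"
        using xy by blast
      then show "g x < g y"
      proof cases
        case 1 then show ?thesis using mono xy by (simp add: g_def)
      next
        case 2 then show ?thesis using r[of y] xy by (auto simp: g_def same_cell_def)
      next
        case 3 then show ?thesis using r[of x] xy by (auto simp: g_def same_cell_def)
      next
        \<comment> \<open>Rolle: two new roots are separated by a root of the derivative, which
          belongs to \<open>Z\<close> and is already placed correctly.\<close>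
        case 4
        then have "poly p x = 0" "poly p y = 0" by (auto simp: R_def)
        then obtain w where w: "x < w" "w < y" "poly (pderiv p) w = 0"
          using poly_MVT[OF xy(3), of p] xy(3) by auto
        then have "r x < \<phi> w" "\<phi> w < r y" using r[of x] r[of y] 4 rdZ by (auto simp: same_cell_def)
        then show ?thesis using 4 by (simp add: g_def)
      qed
    qed
    then obtain \<psi> where \<psi>: "strict_mono \<psi>" "surj \<psi>" "\<And>w. w \<in> Z \<union> R \<Longrightarrow> \<psi> w = g w"
      using extend_strict_mono_on[of "Z \<union> R" g] Z finR by blast
    have mono': "\<psi> a < \<psi> b \<longleftrightarrow> a < b" for a b using \<psi>(1) by (simp add: strict_mono_less)
    have \<psi>Z: "\<psi> w = \<phi> w" if "w \<in> Z" for w using \<psi>(3) that by (simp add: g_def)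
    have cell: "same_cell Z \<phi> t (\<psi> t)" for t
      unfolding same_cell_def using mono' \<psi>Z by metis
    have cell\<phi>: "same_cell Z \<phi> t (\<phi> t)" for t
      unfolding same_cell_def using mono by metis
    have shift: "sgn (poly h a) = sgn (poly h b)"
      if "\<And>t. poly h t = 0 \<Longrightarrow> t \<in> \<phi> ` Z" "same_cell Z \<phi> t a" "same_cell Z \<phi> t b"
      for h :: "real poly" and a b t
      by (rule sgn_poly_eq) (use that in \<open>force simp: same_cell_def\<close>)
    have "sgn (poly (P i) t) = sgn (poly (Q i) (\<psi> t))" if i: "i \<in> I" for i t
    proof (cases "P i = 0")
      case True
      then have "Q i = 0" using zero[OF sg[OF i]] by simp
      with True show ?thesis by simp
    next
      case False
      have "s \<in> \<phi> ` Z" if "poly (Q i) s = 0" for s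
      proof -
        obtain w where w: "s = \<phi> w" using \<phi>(2) by (metis surjD)
        then have "poly (P i) w = 0" using sg[OF i, of w] that by (simp add: sgn_0_0)
        then show ?thesis using w False i by (auto simp: Z_def)
      qed
      then show ?thesis using shift[of "Q i" t "\<psi> t" "\<phi> t"] cell cell\<phi> sg[OF i, of t] by simp
    qed
    moreover have "sgn (poly p t) = sgn (poly q (\<psi> t))" for t
    proof (cases "t \<in> Z \<union> R")
      case True
      then show ?thesis
      proof (cases "t \<in> Z")
        case True then show ?thesis using pqZ \<psi>Z by simp
      next
        case False
        then have "t \<in> R - Z" using True by blast
        then show ?thesis using r[of t] \<psi>(3)[of t] by (auto simp: g_def R_def)
      qed
    next
      case False
      then have tZ: "t \<notin> Z" and pt: "poly p t \<noteq> 0" by (auto simp: R_def)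
      \<comment> \<open>Different signs would produce a root of \<open>q\<close> in the cell
        corresponding to that of \<open>t\<close>. The transfer of signs, run backwards along
        \<open>inv \<phi>\<close>, then gives a root \<open>s\<close> of \<open>p\<close> in the
        cell of \<open>t\<close>. Now both signs are determined by the derivatives and by the side
        of \<open>s\<close>, respectively \<open>\<psi> s\<close>, on which the arguments lie, and
        these agree.\<close>
      show ?thesis
      proof (rule ccontr)
        assume neq: "sgn (poly p t) \<noteq> sgn (poly q (\<psi> t))"
        obtain t'' where t'': "same_cell Z \<phi> t t''" "sgn (poly q t'') = sgn (poly p t)"
          using cell_sign_value[OF Z \<phi> sd nz rdZ pqZ tZ] by blast
        with neq obtain s' where s': "min (\<psi> t) t'' \<le> s'" "s' \<le> max (\<psi> t) t''" "poly q s' = 0"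
          using sgn_poly_eq_of_no_root[of "\<psi> t" t'' q] by metis
        have cs': "same_cell Z \<phi> t s'"
          unfolding same_cell_def
        proof (intro ballI)
          fix w assume w: "w \<in> Z"
          then have "w \<noteq> t" using tZ by auto
          then show "(w < t \<longleftrightarrow> \<phi> w < s') \<and> (t < w \<longleftrightarrow> s' < \<phi> w)"
            using w t''(1) cell[of t] s'(1,2) unfolding same_cell_def by (smt (verit))
        qed
        have inj: "\<phi> a = \<phi> b \<longleftrightarrow> a = b" for a b using \<phi>(1) by (simp add: strict_mono_eq)
        have inv: "inv \<phi> (\<phi> a) = a" "\<phi> (inv \<phi> a) = a" for a
          using inj \<phi>(2) by (simp_all add: inj_def surj_f_inv_f)
        have inv_mono: "strict_mono (inv \<phi>)"
          by (rule strict_monoI) (metis inv(2) mono)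
        have inv_surj: "surj (inv \<phi>)" by (metis inv(1) surjI)
        have s'Z: "s' \<notin> \<phi> ` Z"
          using cs' tZ unfolding same_cell_def by (metis imageE linorder_neqE order_less_irrefl)
        have "\<exists>s. same_cell (\<phi> ` Z) (inv \<phi>) s' s \<and> sgn (poly p s) = sgn (poly q s')"
        proof (rule cell_sign_value[OF _ inv_mono inv_surj _ nzq rdqZ _ s'Z])
          show "finite (\<phi> ` Z)" using Z by simp
          show "sgn (poly (pderiv q) u) = sgn (poly (pderiv p) (inv \<phi> u))" for u
            using sd[of "inv \<phi> u"] inv by simp
          show "sgn (poly q u) = sgn (poly p (inv \<phi> u))" if "u \<in> \<phi> ` Z" for u
            using that pqZ inv by auto
        qed
        then obtain s where s: "same_cell (\<phi> ` Z) (inv \<phi>) s' s" "poly p s = 0"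
          using s'(3) by (auto simp: sgn_0_0)
        have cs: "(w < s \<longleftrightarrow> w < t) \<and> (s < w \<longleftrightarrow> t < w)" if "w \<in> Z" for w
          using s(1) cs' that inv(1)[of w] unfolding same_cell_def by auto
        have sZ: "s \<notin> Z" using cs[of s] tZ by auto
        have sR: "s \<in> R - Z" using s(2) sZ by (simp add: R_def)
        have root: "poly q (\<psi> s) = 0" using r[OF sR] \<psi>(3)[of s] sR sZ by (simp add: g_def)
        have st: "s \<noteq> t" using s(2) pt by auto
        have "sgn (poly p t) = sgn (t - s) * sgn (poly (pderiv p) t)"
          by (rule sgn_poly_increment[OF s(2) st]) (use cs rdZ in blast)
        also have "sgn (t - s) = sgn (\<psi> t - \<psi> s)"
          using mono'[of s t] mono'[of t s] by (auto simp: sgn_if)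
        also have "sgn (poly (pderiv p) t) = sgn (poly (pderiv q) (\<psi> t))"
          using shift[of "pderiv q" t "\<psi> t" "\<phi> t"] rdqZ cell cell\<phi> sd by simp
        also have "sgn (\<psi> t - \<psi> s) * sgn (poly (pderiv q) (\<psi> t)) = sgn (poly q (\<psi> t))"
        proof (rule sgn_poly_increment[OF root, symmetric])
          show "\<psi> s \<noteq> \<psi> t" using st \<psi>(1) by (simp add: strict_mono_eq)
          fix u assume "poly (pderiv q) u = 0"
          then obtain w where w: "w \<in> Z" "u = \<phi> w" using rdqZ by blast
          then show "(u < \<psi> s \<longleftrightarrow> u < \<psi> t) \<and> (\<psi> s < u \<longleftrightarrow> \<psi> t < u)"
            using cell[of s] cell[of t] cs[of w] unfolding same_cell_def by auto
        qed
        finally show False using neq by simp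
      qed
    qed
    ultimately show ?thesis using \<psi> by blast
  qed
qed

section \<open>Families of univariate polynomials over a ring of functions\<close>

definition function_subring :: "('x \<Rightarrow> real) set \<Rightarrow> bool" where
  "function_subring A \<longleftrightarrow> (\<forall>c. (\<lambda>x. c) \<in> A) \<and>
    (\<forall>f\<in>A. \<forall>g\<in>A. (\<lambda>x. f x + g x) \<in> A \<and> (\<lambda>x. f x * g x) \<in> A)"

text \<open>The parameter \<open>x\<close> selects a member of the family. The coefficients form
  only a ring, so remainders have to be computed without division.\<close>

definition coeffs_in :: "('x \<Rightarrow> real) set \<Rightarrow> ('x \<Rightarrow> real poly) \<Rightarrow> bool" where
  "coeffs_in A f \<longleftrightarrow> (\<forall>i. (\<lambda>x. coeff (f x) i) \<in> A)"

lemma function_subring_const: "function_subring A \<Longrightarrow> (\<lambda>x. c) \<in> A"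
  by (simp add: function_subring_def)

lemma function_subring_add:
  "function_subring A \<Longrightarrow> f \<in> A \<Longrightarrow> g \<in> A \<Longrightarrow> (\<lambda>x. f x + g x) \<in> A"
  by (simp add: function_subring_def)

lemma function_subring_mult:
  "function_subring A \<Longrightarrow> f \<in> A \<Longrightarrow> g \<in> A \<Longrightarrow> (\<lambda>x. f x * g x) \<in> A"
  by (simp add: function_subring_def)

lemma function_subring_sum:
  assumes "function_subring A" "\<And>i. i \<in> I \<Longrightarrow> f i \<in> A"
  shows "(\<lambda>x. \<Sum>i\<in>I. f i x) \<in> A"
  using assms by (induction I rule: infinite_finite_induct) (auto simp: function_subring_def)

lemma coeffs_inD: "coeffs_in A f \<Longrightarrow> (\<lambda>x. coeff (f x) i) \<in> A"
  by (simp add: coeffs_in_def)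

lemma coeffs_in_mult:
  assumes "function_subring A" "coeffs_in A f" "coeffs_in A g"
  shows "coeffs_in A (\<lambda>x. f x * g x)"
  unfolding coeffs_in_def coeff_mult
  by (intro allI function_subring_sum function_subring_mult coeffs_inD assms)

lemma coeffs_in_add:
  assumes "function_subring A" "coeffs_in A f" "coeffs_in A g"
  shows "coeffs_in A (\<lambda>x. f x + g x)"
  unfolding coeffs_in_def coeff_add by (intro allI function_subring_add coeffs_inD assms)

lemma coeffs_in_smult:
  assumes "function_subring A" "c \<in> A" "coeffs_in A f"
  shows "coeffs_in A (\<lambda>x. smult (c x) (f x))"
  unfolding coeffs_in_def coeff_smult by (intro allI function_subring_mult coeffs_inD assms)

lemma coeffs_in_pderiv:
  assumes "function_subring A" "coeffs_in A f"
  shows "coeffs_in A (\<lambda>x. pderiv (f x))"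
  unfolding coeffs_in_def coeff_pderiv
  by (intro allI function_subring_mult function_subring_const coeffs_inD assms)

lemma coeffs_in_monom:
  assumes "function_subring A" "c \<in> A"
  shows "coeffs_in A (\<lambda>x. monom (c x) n)"
  unfolding coeffs_in_def
proof
  fix i show "(\<lambda>x. coeff (monom (c x) n) i) \<in> A"
    using assms by (cases "i = n") (simp_all add: function_subring_const)
qed

lemma coeffs_in_sum:
  assumes "function_subring A" "\<And>i. i \<in> I \<Longrightarrow> coeffs_in A (f i)"
  shows "coeffs_in A (\<lambda>x. \<Sum>i\<in>I. f i x)"
  unfolding coeffs_in_def coeff_sum
  by (intro allI function_subring_sum[OF assms(1)]) (use assms(2) in \<open>auto simp: coeffs_in_def\<close>)

text \<open>The degree of a member of a family of polynomials varies with the parameter. Only those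
  parameters matter for which \<open>g x\<close> has degree exactly \<open>m\<close>; for the others \<open>g x\<close> is cut off.\<close>

lemma parametric_remainder:
  assumes A: "function_subring A" and g: "coeffs_in A g" and m: "m \<ge> 1"
  shows "coeffs_in A f \<Longrightarrow> (\<And>x. degree (f x) \<le> n) \<Longrightarrow>
    \<exists>r s. coeffs_in A r \<and> (\<forall>x. degree (r x) < m) \<and>
      (\<forall>x. degree (g x) = m \<longrightarrow> (\<exists>b. smult (coeff (g x) m ^ s) (f x) = b * g x + r x))"
proof (induction n arbitrary: f)
  case 0
  then show ?case using m by (intro exI[of _ f] exI[of _ 0]) (auto intro!: exI[of _ 0])
next
  case (Suc n)
  show ?case
  proof (cases "Suc n < m")
    case True
    then show ?thesis using Suc.prems 
      by (intro exI[of _ f] exI[of _ 0]) (auto intro!: exI[of _ 0] le_less_trans[of _ "Suc n"])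
  next
    case False
    define h where "h x = (\<Sum>i\<le>m. monom (coeff (g x) i) i)" for x
    have h: "coeffs_in A h"
      unfolding h_def by (intro coeffs_in_sum coeffs_in_monom A) (use g in \<open>auto simp: coeffs_in_def\<close>)
    have hg: "h x = g x" if "degree (g x) = m" for x
      using poly_as_sum_of_monoms[of "g x"] that by (simp add: h_def)
    have cm: "coeff (h x) m = coeff (g x) m" for x by (simp add: h_def coeff_sum coeff_monom)
    have dh: "degree (h x) \<le> m" for x
      unfolding h_def by (intro degree_sum_le) (auto intro: order_trans[OF degree_monom_le])
    \<comment> \<open>One division step, with multiplication by the leading coefficient in place of
      division. The terms of degree \<open>Suc n\<close> cancel for every parameter, even where
      \<open>g x\<close> has a degree other than \<open>m\<close>. The factor \<open>- 1\<close>
      expresses negation by a constant of the ring.\<close>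
    define f1 where "f1 x = smult (coeff (g x) m) (f x) +
      monom (- 1 * coeff (f x) (Suc n)) (Suc n - m) * h x" for x
    have "coeffs_in A f1"
      unfolding f1_def
    proof (intro coeffs_in_add coeffs_in_smult coeffs_in_mult coeffs_in_monom A h Suc.prems(1))
      show "(\<lambda>x. coeff (g x) m) \<in> A" using g by (auto simp: coeffs_in_def)
      show "(\<lambda>x. - 1 * coeff (f x) (Suc n)) \<in> A"
        by (intro function_subring_mult function_subring_const A coeffs_inD Suc.prems(1))
    qed
    moreover have "degree (f1 x) \<le> n" for x
    proof (rule degree_le, intro allI impI)
      fix i assume "n < i"
      then consider "i = Suc n" | "Suc n < i" by linarith
      then show "coeff (f1 x) i = 0"
      proof cases
        case 1
        then show ?thesis using False by (simp add: f1_def coeff_monom_mult cm)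
      next
        case 2
        then have "coeff (f x) i = 0" "coeff (h x) (i - (Suc n - m)) = 0"
          using Suc.prems(2)[of x] dh[of x] False by (auto intro!: coeff_eq_0)
        then show ?thesis by (simp add: f1_def coeff_monom_mult)
      qed
    qed
    ultimately obtain r s where r: "coeffs_in A r" "\<And>x. degree (r x) < m"
      "\<And>x. degree (g x) = m \<Longrightarrow> \<exists>b. smult (coeff (g x) m ^ s) (f1 x) = b * g x + r x"
      using Suc.IH by blast
    have "\<exists>b. smult (coeff (g x) m ^ Suc s) (f x) = b * g x + r x" if x: "degree (g x) = m" for x
    proof -
      obtain b where b: "smult (coeff (g x) m ^ s) (f1 x) = b * g x + r x" using r(3)[OF x] by blast
      have "smult (coeff (g x) m ^ Suc s) (f x) = smult (coeff (g x) m ^ s) (smult (coeff (g x) m) (f x))"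
        by (simp add: mult.commute)
      also have "smult (coeff (g x) m) (f x) = f1 x + monom (coeff (f x) (Suc n)) (Suc n - m) * g x"
        by (simp add: f1_def hg[OF x] minus_monom[symmetric])
      also have "smult (coeff (g x) m ^ s) \<dots> = 
        (b + smult (coeff (g x) m ^ s) (monom (coeff (f x) (Suc n)) (Suc n - m))) * g x + r x"
        by (simp add: smult_add_right b algebra_simps)
      finally show ?thesis by blast
    qed
    with r show ?thesis by (intro exI[of _ r] exI[of _ "Suc s"]) auto
  qed
qed

definition sign_agree :: "('x \<Rightarrow> real) set \<Rightarrow> 'x \<Rightarrow> 'x \<Rightarrow> bool" where
  "sign_agree cs x y \<longleftrightarrow> (\<forall>c\<in>cs. sgn (c x) = sgn (c y))"

lemma sign_agreeD: "sign_agree cs x y \<Longrightarrow> c \<in> cs \<Longrightarrow> sgn (c x) = sgn (c y)"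
  by (simp add: sign_agree_def)

text \<open>One bijection serves all members of \<open>F\<close> at once, so the relative order of
  their roots is preserved as well.\<close>

definition sign_equivalent :: "('x \<Rightarrow> real poly) set \<Rightarrow> 'x \<Rightarrow> 'x \<Rightarrow> bool" where
  "sign_equivalent F x y \<longleftrightarrow> (\<exists>\<phi>. strict_mono \<phi> \<and> surj \<phi> \<and>
    (\<forall>f\<in>F. \<forall>t. sgn (poly (f x) t) = sgn (poly (f y) (\<phi> t))))"

text \<open>At a root of \<open>g x\<close> the polynomial \<open>p x\<close> agrees, up to a power
  of the leading coefficient of \<open>g x\<close>, with its remainder. The signs of
  \<open>p\<close> at the roots of its derivative and of the members of \<open>F\<close> can thus be
  read off from polynomials of degree below \<open>D\<close>, and \<open>G\<close> allows finitely
  many of these to be added to \<open>F\<close>.\<close>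

lemma sign_equivalent_insert:
  assumes A: "function_subring A" and fin: "finite F"
    and F: "\<And>f. f \<in> insert p F \<Longrightarrow> coeffs_in A f \<and> (\<forall>x. degree (f x) \<le> D)" and D: "D \<ge> 1"
    and G: "\<And>L. finite L \<Longrightarrow> (\<And>f. f \<in> L \<Longrightarrow> coeffs_in A f \<and> (\<forall>x. degree (f x) < D)) \<Longrightarrow>
      \<exists>cs. finite cs \<and> cs \<subseteq> A \<and> (\<forall>x y. sign_agree cs x y \<longrightarrow> sign_equivalent (F \<union> L) x y)"
  shows "\<exists>cs. finite cs \<and> cs \<subseteq> A \<and> (\<forall>x y. sign_agree cs x y \<longrightarrow> sign_equivalent (insert p F) x y)"
proof -
  define p' where "p' x = pderiv (p x)" for x
  have p: "coeffs_in A p" "\<And>x. degree (p x) \<le> D" using F by auto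
  have p': "coeffs_in A p'" "\<And>x. degree (p' x) < D"
  proof -
    show "coeffs_in A p'" using coeffs_in_pderiv[OF A p(1)] unfolding p'_def .
    show "degree (p' x) < D" for x
      using p(2)[of x] D unfolding p'_def degree_pderiv by linarith
  qed
  define K where "K = insert p' F"
  have K: "coeffs_in A f" "degree (f x) \<le> D" if "f \<in> K" for f x
    using that F[of f] p' by (auto simp: K_def intro: less_imp_le)
  have finK: "finite K" using fin by (simp add: K_def)
  define good where "good g m r \<longleftrightarrow> coeffs_in A r \<and> (\<forall>x. degree (r x) < m) \<and>
      (\<exists>s. \<forall>x. degree (g x) = m \<longrightarrow> (\<exists>b. smult (coeff (g x) m ^ s) (p x) = b * g x + r x))"
    for g m and r :: "'a \<Rightarrow> real poly"
  have "\<exists>r. good g m r" if "g \<in> K" "m \<ge> 1" for g m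
    using parametric_remainder[OF A K(1)[OF that(1)] that(2) p] unfolding good_def by blast
  then obtain r where r: "\<And>g m. g \<in> K \<Longrightarrow> m \<ge> 1 \<Longrightarrow> good g m (r g m)"
    by metis
  \<comment> \<open>The degree of \<open>g x\<close> varies with \<open>x\<close>, so a remainder is
    prepared for each possible degree. Degree \<open>0\<close> is left out: a nonzero constant has
    no roots.\<close>
  define L where "L = insert p' ((\<lambda>(g, m). r g m) ` (K \<times> {1..D}))"
  have finL: "finite L" using finK by (simp add: L_def)
  have L: "coeffs_in A f \<and> (\<forall>x. degree (f x) < D)" if "f \<in> L" for f
  proof (cases "f = p'")
    case False
    then have "f \<in> (\<lambda>(g, m). r g m) ` (K \<times> {1..D})" using that by (simp add: L_def)
    then obtain g m where gm: "g \<in> K" "m \<ge> 1" "m \<le> D" "f = r g m" by auto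
    then have "coeffs_in A f" "\<And>x. degree (f x) < m" using r[of g m] by (auto simp: good_def)
    then show ?thesis using gm(3) less_le_trans by blast
  qed (use p' in auto)
  obtain cs where cs: "finite cs" "cs \<subseteq> A"
    "\<And>x y. sign_agree cs x y \<Longrightarrow> sign_equivalent (F \<union> L) x y" using G[OF finL L] by blast
  \<comment> \<open>Equal signs of all coefficients force \<open>g x\<close> and \<open>g y\<close>
    to have the same degree, so that the same remainder applies to both; the constant coefficient of
    \<open>p\<close> is kept for the case of constant \<open>p x\<close>.\<close>
  define cs' where "cs' = cs \<union> insert (\<lambda>x. coeff (p x) 0) ((\<lambda>(g, i). (\<lambda>x. coeff (g x) i)) ` (K \<times> {..D}))"
  have "finite cs'" using cs finK by (simp add: cs'_def)
  moreover have "cs' \<subseteq> A"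
    unfolding cs'_def
  proof (intro Un_least insert_subsetI cs(2))
    show "(\<lambda>x. coeff (p x) 0) \<in> A" by (rule coeffs_inD[OF p(1)])
    show "(\<lambda>(g, i) x. coeff (g x) i) ` (K \<times> {..D}) \<subseteq> A" using coeffs_inD[OF K(1)] by fast
  qed
  moreover have "sign_equivalent (insert p F) x y" if agree: "sign_agree cs' x y" for x y :: 'a
  proof -
    have "sign_equivalent (F \<union> L) x y" using agree cs(3) by (auto simp: sign_agree_def cs'_def)
    then obtain \<phi> where \<phi>: "strict_mono \<phi>" "surj \<phi>"
      "\<And>f t. f \<in> F \<union> L \<Longrightarrow> sgn (poly (f x) t) = sgn (poly (f y) (\<phi> t))"
      unfolding sign_equivalent_def by blast
    have coeffs: "sgn (coeff (g x) i) = sgn (coeff (g y) i)" if g: "g \<in> K" for g i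
    proof (cases "i \<le> D")
      case True
      then have "(\<lambda>x. coeff (g x) i) \<in> cs'" using g unfolding cs'_def by force
      from sign_agreeD[OF agree this] show ?thesis .
    next
      case False
      then have "degree (g x) < i" "degree (g y) < i" using K(2)[OF g, of x] K(2)[OF g, of y] by auto
      then show ?thesis by (simp add: coeff_eq_0)
    qed
    have deg: "degree (g x) = degree (g y)" if g: "g \<in> K" for g
    proof -
      have "coeff (g x) i = 0 \<longleftrightarrow> coeff (g y) i = 0" for i using coeffs[OF g, of i] by (metis sgn_0_0)
      then show ?thesis unfolding degree_def by simp
    qed
    have root: "sgn (poly (p x) t) = sgn (poly (p y) (\<phi> t))"
      if g: "g \<in> K" "g x \<noteq> 0" "poly (g x) t = 0" for g t
    proof -
      define m where "m = degree (g x)"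
      have "m \<noteq> 0"
      proof
        assume "m = 0"
        then obtain a where "g x = [:a:]" using degree_eq_zeroE m_def by metis
        with g show False by simp
      qed
      then have m1: "m \<ge> 1" "m \<in> {1..D}" using K(2)[OF g(1)] by (auto simp: m_def)
      obtain s where s: "\<And>z. degree (g z) = m \<Longrightarrow> \<exists>b. smult (coeff (g z) m ^ s) (p z) = b * g z + r g m z"
        using r[OF g(1) m1(1)] unfolding good_def by blast
      obtain b c where bc: "smult (coeff (g x) m ^ s) (p x) = b * g x + r g m x"
        "smult (coeff (g y) m ^ s) (p y) = c * g y + r g m y"
        using s[of x] s[of y] deg[OF g(1)] by (auto simp: m_def)
      have gy: "poly (g y) (\<phi> t) = 0"
      proof -
        have "g \<in> F \<union> L" using g(1) by (auto simp: K_def L_def)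
        then show ?thesis using \<phi>(3)[of g t] g(3) by (simp add: sgn_0_0)
      qed
      have "r g m \<in> F \<union> L" using g(1) m1 by (force simp: L_def)
      then have "sgn (poly (r g m x) t) = sgn (poly (r g m y) (\<phi> t))" using \<phi>(3) by blast
      moreover have "poly (r g m x) t = coeff (g x) m ^ s * poly (p x) t"
        using arg_cong[OF bc(1), of "\<lambda>q. poly q t"] g(3) by simp
      moreover have "poly (r g m y) (\<phi> t) = coeff (g y) m ^ s * poly (p y) (\<phi> t)"
        using arg_cong[OF bc(2), of "\<lambda>q. poly q (\<phi> t)"] gy by simp
      moreover have "sgn (coeff (g x) m ^ s) = sgn (coeff (g y) m ^ s)"
        using coeffs[OF g(1), of m] by (simp add: power_sgn)
      moreover have "sgn (coeff (g x) m ^ s) \<noteq> 0"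
        using g(2) by (simp add: m_def sgn_0_0)
      ultimately show ?thesis by (auto simp: sgn_mult)
    qed
    have "\<exists>\<phi>'. strict_mono \<phi>' \<and> surj \<phi>' \<and>
      (\<forall>f\<in>F. \<forall>t. sgn (poly (f x) t) = sgn (poly (f y) (\<phi>' t))) \<and>
      (\<forall>t. sgn (poly (p x) t) = sgn (poly (p y) (\<phi>' t)))"
    proof (rule sign_equivalence_refine[OF fin \<phi>(1,2)])
      have "p' \<in> F \<union> L" by (simp add: L_def)
      then show "sgn (poly (pderiv (p x)) t) = sgn (poly (pderiv (p y)) (\<phi> t))" for t
        using \<phi>(3)[of p' t] by (simp add: p'_def)
      show "sgn (poly (f x) t) = sgn (poly (f y) (\<phi> t))" if "f \<in> F" for f t
        using \<phi>(3) that by blast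
      show "sgn (poly (p x) t) = sgn (poly (p y) (\<phi> t))"
        if "f \<in> F" "f x \<noteq> 0" "poly (f x) t = 0" for f t
        using root[of f t] that by (simp add: K_def)
      show "sgn (poly (p x) t) = sgn (poly (p y) (\<phi> t))"
        if "pderiv (p x) \<noteq> 0" "poly (pderiv (p x)) t = 0" for t
        using root[of p' t] that by (simp add: K_def p'_def)
      show "sgn (coeff (p x) 0) = sgn (coeff (p y) 0)"
        using sign_agreeD[OF agree, of "\<lambda>x. coeff (p x) 0"] by (simp add: cs'_def)
    qed
    then show ?thesis unfolding sign_equivalent_def by blast
  qed
  ultimately show ?thesis by blast
qed

text \<open>A double induction, on the degree bound and, within it, on the number of polynomials
  allowed to reach the bound. Each of these is traded for its derivative and for remainders of
  smaller degree.\<close>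

theorem sign_equivalent_finite:
  assumes A: "function_subring A"
  shows "finite F \<Longrightarrow> (\<And>f. f \<in> F \<Longrightarrow> coeffs_in A f \<and> (\<forall>x. degree (f x) \<le> D)) \<Longrightarrow>
    \<exists>cs. finite cs \<and> cs \<subseteq> A \<and> (\<forall>x y. sign_agree cs x y \<longrightarrow> sign_equivalent F x y)"
proof (induction D arbitrary: F)
  case 0
  show ?case
  proof (intro exI conjI allI impI)
    show "finite ((\<lambda>f x. coeff (f x) 0) ` F)" using 0 by simp
    show "(\<lambda>f x. coeff (f x) 0) ` F \<subseteq> A" using 0 by (auto simp: coeffs_in_def)
    fix x y assume agree: "sign_agree ((\<lambda>f x. coeff (f x) 0) ` F) x y"
    have "poly (f x) t = coeff (f x) 0" if "f \<in> F" for f x t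
    proof -
      have "degree (f x) = 0" using 0(2)[OF that] by simp
      then obtain a where "f x = [:a:]" by (rule degree_eq_zeroE)
      then show ?thesis by simp
    qed
    with agree show "sign_equivalent F x y"
      unfolding sign_equivalent_def sign_agree_def
      by (intro exI[of _ id]) (auto simp: strict_mono_def)
  qed
next
  case (Suc D)
  \<comment> \<open>The set \<open>L\<close> stays arbitrary in the inner induction, because
    removing a member of \<open>H\<close> adds further polynomials of lower degree.\<close>
  have "\<exists>cs. finite cs \<and> cs \<subseteq> A \<and> (\<forall>x y. sign_agree cs x y \<longrightarrow> sign_equivalent (H \<union> L) x y)"
    if "finite H" "\<And>f. f \<in> H \<Longrightarrow> coeffs_in A f \<and> (\<forall>x. degree (f x) \<le> Suc D)"
      "finite L" "\<And>f. f \<in> L \<Longrightarrow> coeffs_in A f \<and> (\<forall>x. degree (f x) < Suc D)" for H L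
    using that
  proof (induction H arbitrary: L rule: finite_induct)
    case empty
    then show ?case using Suc.IH[of L] by (simp add: less_Suc_eq_le)
  next
    case (insert p H)
    have "\<exists>cs. finite cs \<and> cs \<subseteq> A \<and>
      (\<forall>x y. sign_agree cs x y \<longrightarrow> sign_equivalent (insert p (H \<union> L)) x y)"
    proof (rule sign_equivalent_insert[OF A, where D = "Suc D"])
      show "finite (H \<union> L)" using insert by simp
      show "coeffs_in A f \<and> (\<forall>x. degree (f x) \<le> Suc D)" if "f \<in> insert p (H \<union> L)" for f
        using that insert.prems(1)[of f] insert.prems(3)[of f] less_imp_le by blast
      show "\<exists>cs. finite cs \<and> cs \<subseteq> A \<and> (\<forall>x y. sign_agree cs x y \<longrightarrow> sign_equivalent (H \<union> L \<union> L') x y)"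
        if "finite L'" "\<And>f. f \<in> L' \<Longrightarrow> coeffs_in A f \<and> (\<forall>x. degree (f x) < Suc D)" for L'
      proof -
        have "\<exists>cs. finite cs \<and> cs \<subseteq> A \<and> (\<forall>x y. sign_agree cs x y \<longrightarrow> sign_equivalent (H \<union> (L \<union> L')) x y)"
        proof (rule insert.IH)
          show "finite (L \<union> L')" using insert.prems(2) that(1) by simp
        qed (use insert.prems that(2) in blast)+
        then show ?thesis by (simp only: Un_assoc)
      qed
    qed simp
    then show ?case by simp
  qed
  from this[of F "{}"] Suc.prems show ?case by simp
qed

section \<open>Elimination of quantifiers\<close>

text \<open>Semialgebraic sets are the sets whose membership depends only on the signs of finitely many
  polynomials; in this form closure under Boolean operations is immediate.\<close>

definition sign_determined :: "('a::euclidean_space \<Rightarrow> real) set \<Rightarrow> 'a set \<Rightarrow> bool" where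
  "sign_determined Ps S \<longleftrightarrow> finite Ps \<and> (\<forall>p\<in>Ps. real_polynomial_function p) \<and>
    (\<forall>x y. sign_agree Ps x y \<longrightarrow> (x \<in> S \<longleftrightarrow> y \<in> S))"

text \<open>Only equations and strict positivity appear on the right, as
  \<open>basic_semialgebraic\<close> demands.\<close>

lemma sgn_eq_iff:
  fixes a b :: real
  shows "sgn a = sgn b \<longleftrightarrow> (a = 0 \<longrightarrow> b = 0) \<and> (a > 0 \<longrightarrow> b > 0) \<and> (a < 0 \<longrightarrow> - b > 0)"
  by (cases a "0 :: real" rule: linorder_cases; cases b "0 :: real" rule: linorder_cases) simp_all

text \<open>There are finitely many sign vectors, since each of the finitely many polynomials
  contributes one of three signs. Each vector describes a basic set, and \<open>S\<close> is a union
  of such cells.\<close>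

lemma sign_determined_imp_semialgebraic:
  assumes "sign_determined Ps S"
  shows "semialgebraic S"
proof -
  define cell where "cell x = {y. sign_agree Ps x y}" for x
  have fin: "finite Ps" and poly: "\<And>p. p \<in> Ps \<Longrightarrow> real_polynomial_function p"
    and det: "\<And>x y. sign_agree Ps x y \<Longrightarrow> x \<in> S \<longleftrightarrow> y \<in> S"
    using assms by (auto simp: sign_determined_def)
  have eq: "cell x = {y. (\<forall>p\<in>{p\<in>Ps. p x = 0}. p y = 0) \<and>
      (\<forall>q\<in>{p\<in>Ps. p x > 0} \<union> (\<lambda>p y. - p y) ` {p\<in>Ps. p x < 0}. q y > 0)}" for x
  proof -
    have "sign_agree Ps x y \<longleftrightarrow> (\<forall>p\<in>Ps. (p x = 0 \<longrightarrow> p y = 0) \<and> (p x > 0 \<longrightarrow> p y > 0) \<and> (p x < 0 \<longrightarrow> - p y > 0))" for y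
      unfolding sign_agree_def by (rule ball_cong[OF refl]) (rule sgn_eq_iff)
    then show ?thesis unfolding cell_def ball_Un ball_simps(9) by blast
  qed
  have basic: "basic_semialgebraic (cell x)" for x
    unfolding basic_semialgebraic_def
  proof (intro exI conjI)
    show "cell x = {y. (\<forall>p\<in>{p\<in>Ps. p x = 0}. p y = 0) \<and>
      (\<forall>q\<in>{p\<in>Ps. p x > 0} \<union> (\<lambda>p y. - p y) ` {p\<in>Ps. p x < 0}. q y > 0)}" by (rule eq)
    show "\<forall>q\<in>{p\<in>Ps. p x > 0} \<union> (\<lambda>p y. - p y) ` {p\<in>Ps. p x < 0}. real_polynomial_function q"
      using poly real_polynomial_function_minus by blast
  qed (use fin poly in simp_all)
  have "finite (range cell)"
  proof -
    define key where "key x = restrict (\<lambda>p. sgn (p x)) Ps" for x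
    have "range key \<subseteq> (\<Pi>\<^sub>E p\<in>Ps. {-1, 0, 1})" 
    proof
      fix k assume "k \<in> range key"
      then obtain x where k: "k = key x" by blast
      have sgn: "sgn r \<in> {-1, 0, 1}" for r :: real by (cases r "0 :: real" rule: linorder_cases) auto
      show "k \<in> (\<Pi>\<^sub>E p\<in>Ps. {-1, 0, 1})"
        unfolding k key_def by (intro restrict_PiE_iff[THEN iffD2] ballI sgn)
    qed
    moreover have "finite (\<Pi>\<^sub>E p\<in>Ps. {-1, 0, 1 :: real})" by (rule finite_PiE[OF fin]) simp
    ultimately have "finite (range key)" by (rule finite_subset)
    moreover have "cell x = {z. key z = key x}" for x
    proof -
      have "key z = key x \<longleftrightarrow> (\<forall>p\<in>Ps. sgn (p z) = sgn (p x))" for z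
      proof
        assume eq: "key z = key x"
        show "\<forall>p\<in>Ps. sgn (p z) = sgn (p x)"
        proof
          fix p assume "p \<in> Ps"
          then show "sgn (p z) = sgn (p x)" using fun_cong[OF eq, of p] unfolding key_def by simp
        qed
      qed (simp add: key_def restrict_def fun_eq_iff)
      then show ?thesis unfolding cell_def sign_agree_def by auto
    qed
    then have "range cell = (\<lambda>k. {z. key z = k}) ` range key" unfolding image_image by (rule image_cong[OF refl])
    ultimately show ?thesis by (simp only: finite_imageI)
  qed
  moreover have "S = \<Union>(cell ` S)"
  proof (intro equalityI subsetI)
    fix x assume "x \<in> S"
    moreover have "x \<in> cell x" by (simp add: cell_def sign_agree_def)
    ultimately show "x \<in> \<Union>(cell ` S)" by blast
  next
    fix x assume "x \<in> \<Union>(cell ` S)"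
    then show "x \<in> S" using det unfolding cell_def by blast
  qed
  moreover have "finite (cell ` S)"
    using \<open>finite (range cell)\<close> by (rule finite_subset[rotated]) blast
  ultimately show ?thesis unfolding semialgebraic_def using basic by blast
qed

lemma semialgebraic_iff_sign_determined:
  "semialgebraic S \<longleftrightarrow> (\<exists>Ps. sign_determined Ps S)"
proof
  assume "semialgebraic S"
  then obtain F where F: "finite F" "\<And>B. B \<in> F \<Longrightarrow> basic_semialgebraic B" "S = \<Union>F"
    unfolding semialgebraic_def by blast
  have "\<exists>Ps. sign_determined Ps B" if "B \<in> F" for B
  proof -
    obtain P Q where PQ: "finite P" "finite Q" "\<forall>p\<in>P. real_polynomial_function p"
      "\<forall>q\<in>Q. real_polynomial_function q" "B = {x. (\<forall>p\<in>P. p x = 0) \<and> (\<forall>q\<in>Q. q x > 0)}"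
      using F(2)[OF \<open>B \<in> F\<close>] unfolding basic_semialgebraic_def by blast
    have "x \<in> B \<longleftrightarrow> y \<in> B" if "sign_agree (P \<union> Q) x y" for x y
    proof -
      have "p x = 0 \<longleftrightarrow> p y = 0" if "p \<in> P" for p
        using \<open>sign_agree (P \<union> Q) x y\<close> that unfolding sign_agree_def by (metis UnI1 sgn_0_0)
      moreover have "q x > 0 \<longleftrightarrow> q y > 0" if "q \<in> Q" for q
        using \<open>sign_agree (P \<union> Q) x y\<close> that unfolding sign_agree_def by (metis UnI2 sgn_1_pos)
      ultimately show ?thesis by (simp add: PQ(5))
    qed
    then show ?thesis using PQ by (intro exI[of _ "P \<union> Q"]) (auto simp: sign_determined_def)
  qed
  then obtain Ps where Ps: "\<And>B. B \<in> F \<Longrightarrow> sign_determined (Ps B) B" by metis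
  have "sign_determined (\<Union>B\<in>F. Ps B) S"
    unfolding sign_determined_def
  proof (intro conjI allI impI)
    fix x y assume "sign_agree (\<Union>B\<in>F. Ps B) x y"
    then have "sign_agree (Ps B) x y" if "B \<in> F" for B using that by (auto simp: sign_agree_def)
    then have "x \<in> B \<longleftrightarrow> y \<in> B" if "B \<in> F" for B using Ps[OF that] that unfolding sign_determined_def by blast
    then show "x \<in> S \<longleftrightarrow> y \<in> S" by (simp add: F(3))
  qed (use F(1) Ps in \<open>auto simp: sign_determined_def\<close>)
  then show "\<exists>Ps. sign_determined Ps S" by blast
qed (use sign_determined_imp_semialgebraic in blast)

lemma semialgebraic_Compl:
  assumes "semialgebraic S" shows "semialgebraic (- S)"
proof -
  obtain P where "sign_determined P S" using assms semialgebraic_iff_sign_determined by blast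
  then have "sign_determined P (- S)" unfolding sign_determined_def by blast
  then show ?thesis using semialgebraic_iff_sign_determined by blast
qed

lemma semialgebraic_Int:
  assumes "semialgebraic S" "semialgebraic T" shows "semialgebraic (S \<inter> T)"
proof -
  obtain P Q where PQ: "sign_determined P S" "sign_determined Q T"
    using assms semialgebraic_iff_sign_determined by blast
  have "sign_determined (P \<union> Q) (S \<inter> T)"
    unfolding sign_determined_def
  proof (intro conjI allI impI)
    fix x y assume "sign_agree (P \<union> Q) x y"
    then have "sign_agree P x y" "sign_agree Q x y" by (auto simp: sign_agree_def)
    then show "x \<in> S \<inter> T \<longleftrightarrow> y \<in> S \<inter> T" using PQ unfolding sign_determined_def by blast
  qed (use PQ in \<open>auto simp: sign_determined_def\<close>)
  then show ?thesis using semialgebraic_iff_sign_determined by blast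
qed

lemma real_polynomial_function_linear_compose:
  assumes "real_polynomial_function p" "bounded_linear h"
  shows "real_polynomial_function (\<lambda>x. p (h x))"
  using assms(1)
proof induction
  case (linear f)
  show ?case by (rule real_polynomial_function.intros(1)[OF bounded_linear_compose[OF linear assms(2)]])
qed auto

lemma semialgebraic_vimage_linear:
  assumes "semialgebraic S" "bounded_linear h"
  shows "semialgebraic {x. h x \<in> S}"
proof -
  obtain P where P: "sign_determined P S" using assms semialgebraic_iff_sign_determined by blast
  have "sign_determined ((\<lambda>p x. p (h x)) ` P) {x. h x \<in> S}"
    unfolding sign_determined_def
  proof (intro conjI allI impI)
    fix x y assume "sign_agree ((\<lambda>p x. p (h x)) ` P) x y"
    then have "sign_agree P (h x) (h y)" by (auto simp: sign_agree_def)
    then show "x \<in> {x. h x \<in> S} \<longleftrightarrow> y \<in> {x. h x \<in> S}" using P unfolding sign_determined_def by blast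
  qed (use P assms(2) in \<open>auto simp: sign_determined_def intro: real_polynomial_function_linear_compose\<close>)
  then show ?thesis using semialgebraic_iff_sign_determined by blast
qed

lemma semialgebraic_positive:
  assumes "real_polynomial_function p" shows "semialgebraic {x. p x > 0}"
proof -
  have "sign_determined {p} {x. p x > 0}"
    using assms unfolding sign_determined_def sign_agree_def by (auto simp: sgn_if split: if_splits)
  then show ?thesis using semialgebraic_iff_sign_determined by blast
qed

lemma semialgebraic_real_variety:
  assumes "real_variety C" shows "semialgebraic C"
proof -
  obtain P where P: "finite P" "\<forall>p\<in>P. real_polynomial_function p" "C = {x. \<forall>p\<in>P. p x = 0}"
    using assms unfolding real_variety_def by blast
  then have "basic_semialgebraic C"
    unfolding basic_semialgebraic_def by (intro exI[of _ P] exI[of _ "{}"]) auto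
  then show ?thesis unfolding semialgebraic_def by (intro exI[of _ "{C}"]) auto
qed

lemma function_subring_real_polynomial_function: "function_subring {p. real_polynomial_function p}"
  by (auto simp: function_subring_def)

text \<open>This puts a polynomial in the form needed for Hoermander's theorem: the position on the
  line is the variable, the base point is the parameter, and the degree bound is uniform in the
  parameter.\<close>

lemma polynomial_along_line:
  fixes e :: "'a::euclidean_space"
  assumes "real_polynomial_function p"
  shows "\<exists>f D. coeffs_in {p. real_polynomial_function p} f \<and> (\<forall>x. degree (f x) \<le> D) \<and>
    (\<forall>x t. p (x + t *\<^sub>R e) = poly (f x) t)"
  using assms
proof induction
  case (linear h)
  have "coeffs_in {p. real_polynomial_function p} (\<lambda>x. [:h x, h e:])"
    unfolding coeffs_in_def
  proof
    fix i show "(\<lambda>x. coeff [:h x, h e:] i) \<in> {p. real_polynomial_function p}"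
      using linear by (cases i) (auto simp: coeff_pCons split: nat.split)
  qed
  moreover have "h (x + t *\<^sub>R e) = poly [:h x, h e:] t" for x t
    using linear by (simp add: linear_simps)
  ultimately show ?case by (intro exI[of _ "\<lambda>x. [:h x, h e:]"] exI[of _ 1]) auto
next
  case (const c)
  have "coeffs_in {p. real_polynomial_function p} (\<lambda>x::'a. [:c:])"
    by (auto simp: coeffs_in_def)
  then show ?case by (intro exI[of _ "\<lambda>x. [:c:]"] exI[of _ 0]) auto
next
  case (add p q)
  then obtain f D g E where fg: "coeffs_in {p. real_polynomial_function p} f" "\<And>x. degree (f x) \<le> D"
    "\<And>x t. p (x + t *\<^sub>R e) = poly (f x) t" "coeffs_in {p. real_polynomial_function p} g"
    "\<And>x. degree (g x) \<le> E" "\<And>x t. q (x + t *\<^sub>R e) = poly (g x) t" by blast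
  have "degree (f x + g x) \<le> max D E" for x using fg by (meson degree_add_le max.coboundedI1 max.coboundedI2)
  with fg show ?case
    by (intro exI[of _ "\<lambda>x. f x + g x"] exI[of _ "max D E"])
      (auto intro!: coeffs_in_add function_subring_real_polynomial_function)
next
  case (mult p q)
  then obtain f D g E where fg: "coeffs_in {p. real_polynomial_function p} f" "\<And>x. degree (f x) \<le> D"
    "\<And>x t. p (x + t *\<^sub>R e) = poly (f x) t" "coeffs_in {p. real_polynomial_function p} g"
    "\<And>x. degree (g x) \<le> E" "\<And>x t. q (x + t *\<^sub>R e) = poly (g x) t" by blast
  have "degree (f x * g x) \<le> D + E" for x using fg by (meson degree_mult_le add_mono order_trans)
  with fg show ?case
    by (intro exI[of _ "\<lambda>x. f x * g x"] exI[of _ "D + E"])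
      (auto intro!: coeffs_in_mult function_subring_real_polynomial_function)
qed

text \<open>The bijection that matches the sign patterns along the lines through \<open>x\<close>
  and \<open>y\<close> carries a parameter of a point of \<open>S\<close> on the first line to one
  on the second. Hence the signs of the finitely many functions \<open>cs\<close> decide membership
  in the projection.\<close>

theorem semialgebraic_projection_line:
  fixes e :: "'a::euclidean_space"
  assumes "semialgebraic S"
  shows "semialgebraic {x. \<exists>t. x + t *\<^sub>R e \<in> S}"
proof -
  let ?A = "{p :: 'a \<Rightarrow> real. real_polynomial_function p}"
  obtain P where P: "sign_determined P S" using assms semialgebraic_iff_sign_determined by blast
  have "\<exists>f D. coeffs_in ?A f \<and> (\<forall>x. degree (f x) \<le> D) \<and> (\<forall>x t. p (x + t *\<^sub>R e) = poly (f x) t)"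
    if "p \<in> P" for p
    using P that polynomial_along_line unfolding sign_determined_def by blast
  then obtain f D where f: "\<And>p. p \<in> P \<Longrightarrow> coeffs_in ?A (f p)" "\<And>p x. p \<in> P \<Longrightarrow> degree (f p x) \<le> D p"
    "\<And>p x t. p \<in> P \<Longrightarrow> p (x + t *\<^sub>R e) = poly (f p x) t" by metis
  have finP: "finite P" using P by (simp add: sign_determined_def)
  have "\<exists>cs. finite cs \<and> cs \<subseteq> ?A \<and> (\<forall>x y. sign_agree cs x y \<longrightarrow> sign_equivalent (f ` P) x y)"
  proof (rule sign_equivalent_finite[OF function_subring_real_polynomial_function])
    fix g assume "g \<in> f ` P"
    then obtain p where p: "p \<in> P" "g = f p" by blast
    have "degree (g x) \<le> Max (D ` P)" for x using f(2)[OF p(1), of x] p finP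
      by (meson Max_ge finite_imageI image_eqI order_trans)
    with f(1)[OF p(1)] p show "coeffs_in ?A g \<and> (\<forall>x. degree (g x) \<le> Max (D ` P))" by simp
  qed (use finP in simp)
  then obtain cs where cs: "finite cs" "cs \<subseteq> ?A" "\<And>x y. sign_agree cs x y \<Longrightarrow> sign_equivalent (f ` P) x y"
    by blast
  have imp: "\<exists>t. y + t *\<^sub>R e \<in> S" if "sign_agree cs x y" "x + t *\<^sub>R e \<in> S" for x y t
  proof -
    obtain \<phi> where \<phi>: "\<And>p t. p \<in> P \<Longrightarrow> sgn (poly (f p x) t) = sgn (poly (f p y) (\<phi> t))"
      using cs(3)[OF \<open>sign_agree cs x y\<close>] unfolding sign_equivalent_def by blast
    then have "sign_agree P (x + t *\<^sub>R e) (y + \<phi> t *\<^sub>R e)" by (simp add: sign_agree_def f(3))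
    then show ?thesis using P that(2) unfolding sign_determined_def by blast
  qed
  have "sign_determined cs {x. \<exists>t. x + t *\<^sub>R e \<in> S}"
    unfolding sign_determined_def
  proof (intro conjI allI impI)
    fix x y assume xy: "sign_agree cs x y"
    then have "sign_agree cs y x" by (simp add: sign_agree_def)
    with xy show "x \<in> {x. \<exists>t. x + t *\<^sub>R e \<in> S} \<longleftrightarrow> y \<in> {x. \<exists>t. x + t *\<^sub>R e \<in> S}" using imp by blast
  qed (use cs in auto)
  then show ?thesis using semialgebraic_iff_sign_determined by blast
qed

text \<open>The coordinates of the second factor are eliminated one by one along the vectors
  \<open>(0, b)\<close>; restricting to second component \<open>0\<close> then leaves the
  projection.\<close>

theorem semialgebraic_projection:
  fixes S :: "('a::euclidean_space \<times> 'b::euclidean_space) set"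
  assumes "semialgebraic S"
  shows "semialgebraic {x. \<exists>y. (x, y) \<in> S}"
proof -
  have "semialgebraic {z. \<exists>t. (fst z, snd z + (\<Sum>b\<in>B. t b *\<^sub>R b)) \<in> S}" if "finite B" for B :: "'b set"
    using that
  proof (induction B rule: finite_induct)
    case empty
    then show ?case using assms by simp
  next
    case (insert b B)
    have "(\<exists>t. (fst z, snd z + (\<Sum>c\<in>insert b B. t c *\<^sub>R c)) \<in> S) \<longleftrightarrow>
      (\<exists>u t. (fst z, snd z + u *\<^sub>R b + (\<Sum>c\<in>B. t c *\<^sub>R c)) \<in> S)" for z
    proof
      assume "\<exists>t. (fst z, snd z + (\<Sum>c\<in>insert b B. t c *\<^sub>R c)) \<in> S"
      then obtain t where "(fst z, snd z + (\<Sum>c\<in>insert b B. t c *\<^sub>R c)) \<in> S" by blast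
      then have "(fst z, snd z + t b *\<^sub>R b + (\<Sum>c\<in>B. t c *\<^sub>R c)) \<in> S"
        using insert.hyps by (simp add: add.assoc)
      then show "\<exists>u t. (fst z, snd z + u *\<^sub>R b + (\<Sum>c\<in>B. t c *\<^sub>R c)) \<in> S" by blast
    next
      assume "\<exists>u t. (fst z, snd z + u *\<^sub>R b + (\<Sum>c\<in>B. t c *\<^sub>R c)) \<in> S"
      then obtain u t where ut: "(fst z, snd z + u *\<^sub>R b + (\<Sum>c\<in>B. t c *\<^sub>R c)) \<in> S" by blast
      have "(\<Sum>c\<in>B. t c *\<^sub>R c) = (\<Sum>c\<in>B. (t(b := u)) c *\<^sub>R c)"
        using insert.hyps by (intro sum.cong) auto
      with ut have "(fst z, snd z + (\<Sum>c\<in>insert b B. (t(b := u)) c *\<^sub>R c)) \<in> S"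
        using insert.hyps by (simp add: add.assoc)
      then show "\<exists>t. (fst z, snd z + (\<Sum>c\<in>insert b B. t c *\<^sub>R c)) \<in> S" by blast
    qed
    then show ?case using semialgebraic_projection_line[OF insert.IH, of "(0, b)"] by simp
  qed
  from semialgebraic_vimage_linear[OF this[OF finite_Basis], of "\<lambda>x. (x, 0)"]
  have "semialgebraic {x. \<exists>t. (x, \<Sum>b\<in>Basis. t b *\<^sub>R b) \<in> S}"
    by (simp add: bounded_linear_Pair)
  moreover have "(\<exists>t. (x, \<Sum>b\<in>Basis. t b *\<^sub>R b) \<in> S) \<longleftrightarrow> (\<exists>y. (x, y) \<in> S)" for x
  proof
    assume "\<exists>y. (x, y) \<in> S"
    then obtain y where "(x, y) \<in> S" by blast
    then have "(x, \<Sum>b\<in>Basis. (y \<bullet> b) *\<^sub>R b) \<in> S" by (simp add: euclidean_representation)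
    then show "\<exists>t. (x, \<Sum>b\<in>Basis. t b *\<^sub>R b) \<in> S" by blast
  qed blast
  ultimately show ?thesis by simp
qed

section \<open>Interiors and sets of unique nearest points\<close>

lemma real_polynomial_function_inner_self:
  fixes h :: "'a::euclidean_space \<Rightarrow> 'b::euclidean_space"
  assumes "linear h"
  shows "real_polynomial_function (\<lambda>x. h x \<bullet> h x)"
proof -
  have lin: "real_polynomial_function (\<lambda>x. h x \<bullet> b)" for b
    using bounded_linear_compose[OF bounded_linear_inner_left assms[unfolded linear_conv_bounded_linear]]
    by (rule real_polynomial_function.intros(1))
  have "(\<lambda>x. h x \<bullet> h x) = (\<lambda>x. \<Sum>b\<in>Basis. (h x \<bullet> b) * (h x \<bullet> b))"
    by (rule ext, subst euclidean_inner) (rule refl)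
  then show ?thesis
    by (simp only:) (intro real_polynomial_function_sum real_polynomial_function.intros(4) finite_Basis lin)
qed

lemma square_gt_inner_iff:
  fixes x y :: "'a::real_inner"
  assumes "e > 0"
  shows "0 < e\<^sup>2 - (x - y) \<bullet> (x - y) \<longleftrightarrow> dist x y < e"
proof -
  have "(x - y) \<bullet> (x - y) = (dist x y)\<^sup>2"
    by (metis dist_norm power2_norm_eq_inner)
  then have "e\<^sup>2 - (x - y) \<bullet> (x - y) = (e - dist x y) * (e + dist x y)"
    by (simp only: power2_eq_square) (simp add: algebra_simps)
  moreover have "e + dist x y > 0" using assms zero_le_dist[of x y] by linarith
  ultimately show ?thesis by (simp only: zero_less_mult_iff) auto
qed

text \<open>In terms of balls, interior points are described by an existential quantifier over
  radii, which is a projection, followed by a universal one over points, which is the complement of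
  a projection.\<close>

lemma semialgebraic_interior:
  fixes S :: "'a::euclidean_space set"
  assumes "semialgebraic S" shows "semialgebraic (interior S)"
proof -
  \<comment> \<open>For \<open>e > 0\<close>, membership of \<open>((x, e), y)\<close> says that
    \<open>y\<close> prevents \<open>ball x e\<close> from lying in \<open>S\<close>; squaring makes
    the distance condition polynomial.\<close>
  define T where "T = {w :: ('a \<times> real) \<times> 'a. snd w \<in> - S} \<inter>
    {w. (snd (fst w))\<^sup>2 - (fst (fst w) - snd w) \<bullet> (fst (fst w) - snd w) > 0}"
  have "linear (\<lambda>w :: ('a \<times> real) \<times> 'a. fst (fst w) - snd w)" "linear (\<lambda>w :: ('a \<times> real) \<times> 'a. snd (fst w))"
    by (rule linearI; simp add: algebra_simps)+
  then have poly: "real_polynomial_function (\<lambda>w :: ('a \<times> real) \<times> 'a.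
      (snd (fst w))\<^sup>2 - (fst (fst w) - snd w) \<bullet> (fst (fst w) - snd w))"
    by (intro real_polynomial_function_diff real_polynomial_function_power real_polynomial_function_inner_self
        real_polynomial_function.intros(1)) (simp_all add: linear_conv_bounded_linear)
  have "semialgebraic T"
    unfolding T_def
    by (rule semialgebraic_Int[OF semialgebraic_vimage_linear[OF semialgebraic_Compl[OF assms] bounded_linear_snd]
          semialgebraic_positive[OF poly]])
  then have "semialgebraic {v. \<exists>y. (v, y) \<in> T}" by (rule semialgebraic_projection)
  moreover have "semialgebraic {v :: 'a \<times> real. snd v > 0}"
    by (rule semialgebraic_positive[OF real_polynomial_function.intros(1)[OF bounded_linear_snd]])
  ultimately have "semialgebraic ({v. snd v > 0} \<inter> - {v. \<exists>y. (v, y) \<in> T})"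
    using semialgebraic_Int semialgebraic_Compl by blast
  then have proj: "semialgebraic {x. \<exists>e. (x, e) \<in> {v. snd v > 0} \<inter> - {v. \<exists>y. (v, y) \<in> T}}"
    by (rule semialgebraic_projection)
  have iff: "(x, e) \<in> {v. snd v > 0} \<inter> - {v. \<exists>y. (v, y) \<in> T} \<longleftrightarrow> 0 < e \<and> ball x e \<subseteq> S" for x e
  proof -
    have mem: "((x, e), y) \<in> T \<longleftrightarrow> y \<notin> S \<and> dist x y < e" if e: "e > 0" for y
    proof -
      have "((x, e), y) \<in> T \<longleftrightarrow> y \<notin> S \<and> 0 < e\<^sup>2 - (x - y) \<bullet> (x - y)"
        unfolding T_def Int_iff mem_Collect_eq fst_conv snd_conv Compl_iff ..
      then show ?thesis using square_gt_inner_iff[OF e] by blast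
    qed
    show ?thesis
    proof (cases "e > 0")
      case True
      then show ?thesis
        unfolding Int_iff Compl_iff mem_Collect_eq snd_conv mem[OF True] subset_iff mem_ball by blast
    qed auto
  qed
  have "x \<in> {x. \<exists>e. (x, e) \<in> {v. snd v > 0} \<inter> - {v. \<exists>y. (v, y) \<in> T}} \<longleftrightarrow> x \<in> interior S" for x
    unfolding mem_Collect_eq[of x] iff mem_interior ..
  then have "{x. \<exists>e. (x, e) \<in> {v. snd v > 0} \<inter> - {v. \<exists>y. (v, y) \<in> T}} = interior S"
    by (rule set_eqI)
  with proj show ?thesis by (rule back_subst[of semialgebraic])
qed

text \<open>\<open>T\<close> says that some \<open>z\<close> in \<open>C\<close> is strictly closer
  than \<open>y\<close>, so \<open>B\<close> is the graph of \<open>best_approximation C\<close>;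
  \<open>D\<close> collects pairs of different nearest points. Existence and uniqueness become a
  projection of \<open>B\<close> and the complement of a projection of \<open>D\<close>.\<close>

lemma semialgebraic_unique_best_approximation:
  assumes "real_variety C"
  shows "semialgebraic {x. \<exists>!y. best_approximation C x y}"
proof -
  have C: "semialgebraic C" by (rule semialgebraic_real_variety[OF assms])
  define T where "T = {w :: ('a \<times> 'a) \<times> 'a. snd w \<in> C} \<inter> {w. (fst (fst w) - snd (fst w)) \<bullet> (fst (fst w) - snd (fst w)) -
    (fst (fst w) - snd w) \<bullet> (fst (fst w) - snd w) > 0}"
  have "linear (\<lambda>w :: ('a \<times> 'a) \<times> 'a. fst (fst w) - snd w)" "linear (\<lambda>w :: ('a \<times> 'a) \<times> 'a. fst (fst w) - snd (fst w))"
    by (rule linearI; simp add: algebra_simps)+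
  then have "real_polynomial_function (\<lambda>w :: ('a \<times> 'a) \<times> 'a.
      (fst (fst w) - snd (fst w)) \<bullet> (fst (fst w) - snd (fst w)) - (fst (fst w) - snd w) \<bullet> (fst (fst w) - snd w))"
    by (intro real_polynomial_function_diff real_polynomial_function_inner_self)
  then have "semialgebraic T"
    unfolding T_def by (rule semialgebraic_Int[OF semialgebraic_vimage_linear[OF C bounded_linear_snd] semialgebraic_positive])
  then have projT: "semialgebraic {v. \<exists>z. (v, z) \<in> T}" by (rule semialgebraic_projection)
  define B where "B = {v :: 'a \<times> 'a. snd v \<in> C} \<inter> - {v. \<exists>z. (v, z) \<in> T}"
  have B: "semialgebraic B"
    unfolding B_def
    by (rule semialgebraic_Int[OF semialgebraic_vimage_linear[OF C bounded_linear_snd] semialgebraic_Compl[OF projT]])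
  have memB: "(x, y) \<in> B \<longleftrightarrow> best_approximation C x y" for x y
  proof -
    have "((x, y), z) \<in> T \<longleftrightarrow> z \<in> C \<and> \<not> norm (x - y) \<le> norm (x - z)" for z
      unfolding T_def norm_le by auto
    then show ?thesis unfolding B_def best_approximation_def by auto
  qed
  define D where "D = {w :: 'a \<times> 'a \<times> 'a. (fst w, fst (snd w)) \<in> B} \<inter>
    ({w. (fst w, snd (snd w)) \<in> B} \<inter> {w. (fst (snd w) - snd (snd w)) \<bullet> (fst (snd w) - snd (snd w)) > 0})"
  have lin: "linear (\<lambda>w :: 'a \<times> 'a \<times> 'a. (fst w, fst (snd w)))" "linear (\<lambda>w :: 'a \<times> 'a \<times> 'a. (fst w, snd (snd w)))"
      "linear (\<lambda>w :: 'a \<times> 'a \<times> 'a. fst (snd w) - snd (snd w))"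
    by (rule linearI; simp add: algebra_simps)+
  then have "semialgebraic D"
    unfolding D_def
    by (intro semialgebraic_Int semialgebraic_vimage_linear[OF B] semialgebraic_positive[OF real_polynomial_function_inner_self])
      (simp_all add: linear_conv_bounded_linear)
  then have "semialgebraic {x. \<exists>w. (x, w) \<in> D}" by (rule semialgebraic_projection)
  then have S: "semialgebraic ({x. \<exists>y. (x, y) \<in> B} \<inter> - {x. \<exists>w. (x, w) \<in> D})"
    using semialgebraic_Int semialgebraic_Compl semialgebraic_projection[OF B] by blast
  have "(x, y, y') \<in> D \<longleftrightarrow> best_approximation C x y \<and> best_approximation C x y' \<and> y \<noteq> y'" for x y y'
    unfolding D_def by (simp add: memB)
  then have "x \<in> {x. \<exists>y. (x, y) \<in> B} \<inter> - {x. \<exists>w. (x, w) \<in> D} \<longleftrightarrow> x \<in> {x. \<exists>!y. best_approximation C x y}" for x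
    unfolding memB split_paired_Ex Int_iff Compl_iff mem_Collect_eq by blast
  then have "{x. \<exists>y. (x, y) \<in> B} \<inter> - {x. \<exists>w. (x, w) \<in> D} = {x. \<exists>!y. best_approximation C x y}"
    by (rule set_eqI)
  with S show ?thesis by (rule back_subst[of semialgebraic])
qed

section \<open>Growth of spaces of polynomials on irreducible varieties\<close>

definition vanishes_on :: "('a \<Rightarrow> real) \<Rightarrow> 'a set \<Rightarrow> bool" where
  "vanishes_on f C \<longleftrightarrow> (\<forall>x\<in>C. f x = 0)"

lemma vanishes_onD: "vanishes_on f C \<Longrightarrow> x \<in> C \<Longrightarrow> f x = 0"
  by (simp add: vanishes_on_def)

lemma real_variety_Int_zero:
  assumes "real_variety C" "real_polynomial_function f"
  shows "real_variety {x\<in>C. f x = 0}"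
proof -
  obtain P where P: "finite P" "\<forall>p\<in>P. real_polynomial_function p" "C = {x. \<forall>p\<in>P. p x = 0}"
    using assms(1) unfolding real_variety_def by blast
  then have "{x\<in>C. f x = 0} = {x. \<forall>p\<in>insert f P. p x = 0}" by auto
  with P assms(2) show ?thesis unfolding real_variety_def by (intro exI[of _ "insert f P"]) auto
qed

text \<open>Primality of the vanishing ideal: otherwise the zero sets of \<open>f\<close> and
  \<open>g\<close> in \<open>C\<close> would be two strict subvarieties covering
  \<open>C\<close>.\<close>

lemma irreducible_variety_mult:
  assumes C: "irreducible_variety C" and f: "real_polynomial_function f" and g: "real_polynomial_function g"
    and fg: "vanishes_on (\<lambda>x. f x * g x) C"
  shows "vanishes_on f C \<or> vanishes_on g C"
proof (rule ccontr)
  assume "\<not> (vanishes_on f C \<or> vanishes_on g C)"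
  then have "{x\<in>C. f x = 0} \<subset> C" "{x\<in>C. g x = 0} \<subset> C" by (auto simp: vanishes_on_def)
  moreover have "C = {x\<in>C. f x = 0} \<union> {x\<in>C. g x = 0}" using fg by (auto simp: vanishes_on_def)
  moreover have "real_variety C" using C by (simp add: irreducible_variety_def)
  moreover note real_variety_Int_zero[OF calculation(4) f] real_variety_Int_zero[OF calculation(4) g]
  ultimately show False
    using C unfolding irreducible_variety_def by meson
qed

text \<open>A homogeneous system with more unknowns than equations has a nontrivial solution; the
  induction is Gaussian elimination with pivot \<open>u i0 m\<close>.\<close>

lemma linear_dependence:
  fixes u :: "'i \<Rightarrow> nat \<Rightarrow> real"
  shows "finite J \<Longrightarrow> m < card J \<Longrightarrow> \<exists>c. (\<exists>i\<in>J. c i \<noteq> 0) \<and> (\<forall>j<m. (\<Sum>i\<in>J. c i * u i j) = 0)"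
proof (induction m arbitrary: J u)
  case 0
  then have "J \<noteq> {}" by auto
  then show ?case by (intro exI[of _ "\<lambda>_. 1"]) auto
next
  case (Suc m)
  show ?case
  proof (cases "\<forall>i\<in>J. u i m = 0")
    case True
    obtain c where "\<exists>i\<in>J. c i \<noteq> 0" "\<forall>j<m. (\<Sum>i\<in>J. c i * u i j) = 0"
      using Suc.IH[of J u] Suc.prems by auto
    with True show ?thesis by (intro exI[of _ c]) (auto simp: less_Suc_eq)
  next
    case False
    then obtain i0 where i0: "i0 \<in> J" "u i0 m \<noteq> 0" by blast
    define u' where "u' i j = u i j - u i m / u i0 m * u i0 j" for i j
    have "m < card (J - {i0})" using Suc.prems i0 by simp
    then obtain c where c: "\<exists>i\<in>J - {i0}. c i \<noteq> 0" "\<And>j. j < m \<Longrightarrow> (\<Sum>i\<in>J - {i0}. c i * u' i j) = 0"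
      using Suc.IH[of "J - {i0}" u'] Suc.prems by auto
    \<comment> \<open>The value that equation \<open>m\<close> forces on the coefficient of
      \<open>i0\<close>.\<close>
    define s where "s = (\<Sum>i\<in>J - {i0}. c i * u i m) / u i0 m"
    define d where "d = c(i0 := - s)"
    have sum: "(\<Sum>i\<in>J. d i * u i j) = - s * u i0 j + (\<Sum>i\<in>J - {i0}. c i * u i j)" for j
      using Suc.prems i0 by (simp add: sum.remove[of J i0] d_def)
    have "(\<Sum>i\<in>J. d i * u i j) = 0" if "j < Suc m" for j
    proof (cases "j = m")
      case True
      then show ?thesis using i0 by (simp add: sum s_def)
    next
      case False
      then have "0 = (\<Sum>i\<in>J - {i0}. c i * u' i j)" using c(2) that by simp
      also have "\<dots> = (\<Sum>i\<in>J - {i0}. c i * u i j) - (\<Sum>i\<in>J - {i0}. c i * u i m) * (u i0 j / u i0 m)"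
        unfolding sum_distrib_right sum_subtractf[symmetric] u'_def
        by (rule sum.cong) (auto simp: algebra_simps)
      finally show ?thesis by (simp add: sum s_def)
    qed
    moreover have "\<exists>i\<in>J. d i \<noteq> 0" using c(1) by (auto simp: d_def)
    ultimately show ?thesis by blast
  qed
qed

section \<open>Monomials in the polynomials separating a chain\<close>

fun power_product :: "('a \<Rightarrow> real) list \<Rightarrow> nat list \<Rightarrow> 'a \<Rightarrow> real" where
  "power_product (q # qs) (a # l) x = q x ^ a * power_product qs l x"
| "power_product _ _ x = 1"

text \<open>A box of exponents instead of a bound on the total degree: it splits off the first
  exponent as a product, and its size is an exact power.\<close>

definition exponents :: "nat \<Rightarrow> nat \<Rightarrow> nat list set" where
  "exponents k M = {l. set l \<subseteq> {..M} \<and> length l = k}"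

lemma finite_exponents: "finite (exponents k M)" and card_exponents: "card (exponents k M) = (M + 1) ^ k"
  unfolding exponents_def by (simp_all add: finite_lists_length_eq card_lists_length_eq)

lemma sum_exponents_Suc:
  "(\<Sum>l\<in>exponents (Suc k) M. f l) = (\<Sum>a\<le>M. \<Sum>l\<in>exponents k M. f (a # l))"
proof -
  have eq: "exponents (Suc k) M = (\<lambda>(a, l). a # l) ` ({..M} \<times> exponents k M)"
    by (auto simp: exponents_def length_Suc_conv image_iff)
  have "inj_on (\<lambda>(a, l). a # l) ({..M} \<times> exponents k M)" by (auto simp: inj_on_def)
  then show ?thesis
    unfolding eq by (subst sum.reindex) (auto simp: sum.cartesian_product case_prod_beta finite_exponents)
qed

lemma real_polynomial_function_power_product:
  "list_all real_polynomial_function qs \<Longrightarrow> real_polynomial_function (power_product qs l)"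
proof (induction qs arbitrary: l)
  case Nil
  then show ?case by (auto intro: real_polynomial_function.intros)
next
  case (Cons q qs)
  show ?case
  proof (cases l)
    case Nil
    then have "power_product (q # qs) l = (\<lambda>x. 1)" by auto
    then show ?thesis by (auto intro: real_polynomial_function.intros)
  next
    case (Cons a l')
    then have "power_product (q # qs) l = (\<lambda>x. q x ^ a * power_product qs l' x)" by auto
    then show ?thesis using Cons.IH[of l'] Cons.prems by (auto intro: real_polynomial_function.intros)
  qed
qed

lemma real_variety_strict_subset:
  assumes "real_variety V" "V \<subset> W"
  shows "\<exists>q. real_polynomial_function q \<and> vanishes_on q V \<and> \<not> vanishes_on q W"
proof -
  obtain P where P: "\<forall>p\<in>P. real_polynomial_function p" "V = {x. \<forall>p\<in>P. p x = 0}"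
    using assms(1) unfolding real_variety_def by blast
  obtain x where "x \<in> W" "x \<notin> V" using assms(2) by blast
  then obtain q where "q \<in> P" "q x \<noteq> 0" using P by blast
  with P \<open>x \<in> W\<close> show ?thesis by (intro exI[of _ q]) (auto simp: vanishes_on_def)
qed

text \<open>If each \<open>q\<close> vanishes on one member of the chain but not on the next, then the \<open>q\<close> are
  algebraically independent on the last member.\<close>

lemma chain_independent:
  fixes V :: "nat \<Rightarrow> 'a::euclidean_space set"
  shows "(\<And>i. i \<le> k \<Longrightarrow> irreducible_variety (V i)) \<Longrightarrow> (\<And>i. i < k \<Longrightarrow> V i \<subset> V (Suc i)) \<Longrightarrow>
    \<exists>qs. list_all real_polynomial_function qs \<and> length qs = k \<and>
      (\<forall>M c. vanishes_on (\<lambda>x. \<Sum>l\<in>exponents k M. c l * power_product qs l x) (V k) \<longrightarrow>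
        (\<forall>l\<in>exponents k M. c l = 0))"
proof (induction k)
  case 0
  have "V 0 \<noteq> {}" using 0(1)[of 0] by (simp add: irreducible_variety_def)
  moreover have "exponents 0 M = {[]}" for M by (auto simp: exponents_def)
  ultimately show ?case by (intro exI[of _ "[]"]) (auto simp: vanishes_on_def)
next
  case (Suc k)
  have "\<exists>qs. list_all real_polynomial_function qs \<and> length qs = k \<and>
      (\<forall>M c. vanishes_on (\<lambda>x. \<Sum>l\<in>exponents k M. c l * power_product qs l x) (V k) \<longrightarrow>
        (\<forall>l\<in>exponents k M. c l = 0))"
    by (rule Suc.IH) (use Suc.prems in simp_all)
  then obtain qs where qs: "list_all real_polynomial_function qs" "length qs = k"
    "\<And>M c l. vanishes_on (\<lambda>x. \<Sum>l\<in>exponents k M. c l * power_product qs l x) (V k) \<Longrightarrow>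
        l \<in> exponents k M \<Longrightarrow> c l = 0" by blast
  have irr: "irreducible_variety (V (Suc k))" using Suc.prems by simp
  have "real_variety (V k)" "V k \<subset> V (Suc k)" using Suc.prems by (auto simp: irreducible_variety_def)
  then obtain q where q: "real_polynomial_function q" "vanishes_on q (V k)" "\<not> vanishes_on q (V (Suc k))"
    using real_variety_strict_subset by blast
  have "c l = 0"
    if van: "vanishes_on (\<lambda>x. \<Sum>l\<in>exponents (Suc k) M. c l * power_product (q # qs) l x) (V (Suc k))"
      and l: "l \<in> exponents (Suc k) M" for M c l
  proof -
    define g where "g a x = (\<Sum>l\<in>exponents k M. c (a # l) * power_product qs l x)" for a x
    have gpoly: "real_polynomial_function (g a)" for a
      unfolding g_def
      by (intro real_polynomial_function_sum finite_exponents real_polynomial_function.intros(2,4)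
          real_polynomial_function_power_product qs(1))
    have sum: "(\<Sum>l\<in>exponents (Suc k) M. c l * power_product (q # qs) l x) = (\<Sum>a\<le>M. q x ^ a * g a x)" for x
      unfolding sum_exponents_Suc g_def sum_distrib_left by (simp add: mult_ac)
    have zero: "\<forall>l\<in>exponents k M. c (a # l) = 0" if "a \<le> M" for a
      using that
    proof (induction a rule: less_induct)
      case (less a)
      \<comment> \<open>The coefficients belonging to powers below \<open>a\<close> are already
        zero, so the relation reads \<open>q x ^ a * h x = 0\<close>. Primality removes the power of
        \<open>q\<close>, and on \<open>V k\<close>, where \<open>q\<close> vanishes, only the term
        \<open>g a\<close> of \<open>h\<close> is left.\<close>
      define h where "h x = (\<Sum>b\<in>{a..M}. q x ^ (b - a) * g b x)" for x
      have hpoly: "real_polynomial_function h"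
        unfolding h_def by (intro real_polynomial_function_sum real_polynomial_function.intros(4)
          real_polynomial_function_power gpoly q(1)) simp
      have "q x ^ a * h x = (\<Sum>b\<le>M. q x ^ b * g b x)" for x
      proof -
        have "q x ^ a * h x = (\<Sum>b\<in>{a..M}. q x ^ b * g b x)"
          unfolding h_def sum_distrib_left by (rule sum.cong) (auto simp: power_add[symmetric] mult.assoc[symmetric])
        also have "\<dots> = (\<Sum>b\<le>M. q x ^ b * g b x)"
          using less by (intro sum.mono_neutral_left) (auto simp: g_def)
        finally show ?thesis .
      qed
      then have "vanishes_on (\<lambda>x. q x ^ a * h x) (V (Suc k))" using van by (simp add: sum)
      then have "vanishes_on (\<lambda>x. q x ^ a) (V (Suc k)) \<or> vanishes_on h (V (Suc k))"
        by (intro irreducible_variety_mult[OF irr] real_polynomial_function_power q(1) hpoly)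
      moreover have "\<not> vanishes_on (\<lambda>x. q x ^ a) (V (Suc k))" using q(3) by (auto simp: vanishes_on_def)
      ultimately have "vanishes_on h (V k)" using \<open>V k \<subset> V (Suc k)\<close> by (auto simp: vanishes_on_def)
      moreover have "h x = g a x" if "x \<in> V k" for x
      proof -
        have "h x = (\<Sum>b\<in>{a}. q x ^ (b - a) * g b x)"
          unfolding h_def using less.prems vanishes_onD[OF q(2) that]
          by (intro sum.mono_neutral_right) auto
        then show ?thesis by simp
      qed
      ultimately have "vanishes_on (g a) (V k)" by (simp add: vanishes_on_def)
      then show ?case using qs(3)[where M = M and c = "\<lambda>l. c (a # l)"] unfolding g_def by blast
    qed
    obtain a l' where "l = a # l'" "a \<le> M" "l' \<in> exponents k M"
      using l by (auto simp: exponents_def length_Suc_conv)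
    then show ?thesis using zero by blast
  qed
  with qs q(1) show ?case by (intro exI[of _ "q # qs"]) auto
qed

text \<open>Polynomials in the first \<open>k\<close> coordinates, enumerated by \<open>b\<close>,
  of degree at most \<open>N\<close> in each of them separately. Coefficients beyond
  \<open>N\<close> are set to zero so that products are plain Cauchy products.\<close>

primrec bounded_polys :: "(nat \<Rightarrow> 'n) \<Rightarrow> nat \<Rightarrow> nat \<Rightarrow> (real^'n \<Rightarrow> real) set" where
  "bounded_polys b 0 N = {f. \<exists>c. f = (\<lambda>x. c)}"
| "bounded_polys b (Suc k) N = {f. \<exists>a. (\<forall>i. a i \<in> bounded_polys b k N) \<and> (\<forall>i>N. a i = (\<lambda>x. 0)) \<and>
    f = (\<lambda>x. \<Sum>i\<le>N. a i x * (x $ b k) ^ i)}"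

lemma bounded_polys_const: "(\<lambda>x. c) \<in> bounded_polys b k N"
proof (induction k arbitrary: c)
  case (Suc k)
  show ?case
    unfolding bounded_polys.simps mem_Collect_eq
  proof (intro exI[of _ "\<lambda>i x. if i = 0 then c else 0"] conjI allI)
    show "(\<lambda>x. if i = 0 then c else 0) \<in> bounded_polys b k N" for i
      using Suc.IH[of "if i = 0 then c else 0"] .
  qed (auto simp: if_distrib[of "\<lambda>c. c * _"] cong: if_cong)
qed auto

lemma bounded_polys_Suc:
  assumes "f \<in> bounded_polys b k N" shows "f \<in> bounded_polys b (Suc k) N"
  unfolding bounded_polys.simps mem_Collect_eq
proof (intro exI[of _ "\<lambda>i. if i = 0 then f else (\<lambda>x. 0)"] conjI allI)
  show "(if i = 0 then f else (\<lambda>x. 0)) \<in> bounded_polys b k N" for i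
    using assms by (simp add: bounded_polys_const)
  show "f = (\<lambda>x. \<Sum>i\<le>N. (if i = 0 then f else (\<lambda>x. 0)) x * (x $ b k) ^ i)"
  proof
    fix x
    have "(\<Sum>i\<le>N. (if i = 0 then f else (\<lambda>x. 0)) x * (x $ b k) ^ i) =
        (\<Sum>i\<in>{0}. (if i = 0 then f else (\<lambda>x. 0)) x * (x $ b k) ^ i)"
      by (intro sum.mono_neutral_right) auto
    then show "f x = (\<Sum>i\<le>N. (if i = 0 then f else (\<lambda>x. 0)) x * (x $ b k) ^ i)" by simp
  qed
qed auto

lemma bounded_polys_mono:
  "f \<in> bounded_polys b k N \<Longrightarrow> N \<le> M \<Longrightarrow> f \<in> bounded_polys b k M"
proof (induction k arbitrary: f)
  case (Suc k)
  then obtain a where a: "\<And>i. a i \<in> bounded_polys b k N" "\<And>i. i > N \<Longrightarrow> a i = (\<lambda>x. 0)"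
    "f = (\<lambda>x. \<Sum>i\<le>N. a i x * (x $ b k) ^ i)" by auto
  have "(\<Sum>i\<le>N. a i x * (x $ b k) ^ i) = (\<Sum>i\<le>M. a i x * (x $ b k) ^ i)" for x
    using Suc.prems(2) a(2) by (intro sum.mono_neutral_left) auto
  then show ?case
    unfolding bounded_polys.simps mem_Collect_eq using a Suc by (intro exI[of _ a]) auto
qed simp

lemma bounded_polys_add:
  "f \<in> bounded_polys b k N \<Longrightarrow> g \<in> bounded_polys b k N \<Longrightarrow> (\<lambda>x. f x + g x) \<in> bounded_polys b k N"
proof (induction k arbitrary: f g)
  case (Suc k)
  then obtain a a' where a: "\<And>i. a i \<in> bounded_polys b k N" "\<And>i. i > N \<Longrightarrow> a i = (\<lambda>x. 0)"
    "f = (\<lambda>x. \<Sum>i\<le>N. a i x * (x $ b k) ^ i)"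
    and a': "\<And>i. a' i \<in> bounded_polys b k N" "\<And>i. i > N \<Longrightarrow> a' i = (\<lambda>x. 0)"
    "g = (\<lambda>x. \<Sum>i\<le>N. a' i x * (x $ b k) ^ i)" by auto
  show ?case
    unfolding bounded_polys.simps mem_Collect_eq
    by (intro exI[of _ "\<lambda>i x. a i x + a' i x"] conjI allI Suc.IH a(1) a'(1))
      (auto simp: a(2,3) a'(2,3) sum.distrib algebra_simps)
qed auto

lemma bounded_polys_sum:
  assumes "\<And>i. i \<in> I \<Longrightarrow> f i \<in> bounded_polys b k N"
  shows "(\<lambda>x. \<Sum>i\<in>I. f i x) \<in> bounded_polys b k N"
  using assms
proof (induction I rule: infinite_finite_induct)
  case (insert i I)
  then show ?case by (simp add: bounded_polys_add)
qed (simp_all add: bounded_polys_const)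

lemma bounded_polys_mult:
  "f \<in> bounded_polys b k N \<Longrightarrow> g \<in> bounded_polys b k M \<Longrightarrow> (\<lambda>x. f x * g x) \<in> bounded_polys b k (N + M)"
proof (induction k arbitrary: f g)
  case (Suc k)
  then obtain a a' where a: "\<And>i. a i \<in> bounded_polys b k N" "\<And>i. i > N \<Longrightarrow> a i = (\<lambda>x. 0)"
    "f = (\<lambda>x. \<Sum>i\<le>N. a i x * (x $ b k) ^ i)"
    and a': "\<And>i. a' i \<in> bounded_polys b k M" "\<And>i. i > M \<Longrightarrow> a' i = (\<lambda>x. 0)"
    "g = (\<lambda>x. \<Sum>i\<le>M. a' i x * (x $ b k) ^ i)" by auto
  show ?case
    unfolding bounded_polys.simps mem_Collect_eq
  proof (intro exI[of _ "\<lambda>r x. \<Sum>s\<le>r. a s x * a' (r - s) x"] conjI allI impI)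
    show "(\<lambda>x. \<Sum>s\<le>r. a s x * a' (r - s) x) \<in> bounded_polys b k (N + M)" for r
      by (intro bounded_polys_sum Suc.IH a(1) a'(1))
    show "(\<lambda>x. \<Sum>s\<le>r. a s x * a' (r - s) x) = (\<lambda>x. 0)" if "r > N + M" for r
    proof
      fix x
      have "a s x * a' (r - s) x = 0" for s
        using a(2)[of s] a'(2)[of "r - s"] that by (cases "s > N") auto
      then show "(\<Sum>s\<le>r. a s x * a' (r - s) x) = 0" by (intro sum.neutral ballI)
    qed
    show "(\<lambda>x. f x * g x) = (\<lambda>x. \<Sum>r\<le>N + M. (\<Sum>s\<le>r. a s x * a' (r - s) x) * (x $ b k) ^ r)"
      unfolding a(3) a'(3) by (rule ext, rule polynomial_product) (simp_all add: a(2) a'(2))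
  qed
qed auto

lemma bounded_polys_power:
  "f \<in> bounded_polys b k N \<Longrightarrow> (\<lambda>x. f x ^ a) \<in> bounded_polys b k (a * N)"
  by (induction a) (simp_all add: bounded_polys_const bounded_polys_mult)

lemma bounded_polys_polynomial:
  "f \<in> bounded_polys b k N \<Longrightarrow> real_polynomial_function f"
proof (induction k arbitrary: f)
  case 0
  then show ?case by (auto intro: real_polynomial_function.intros)
next
  case (Suc k)
  then obtain a where a: "\<And>i. a i \<in> bounded_polys b k N"
    "f = (\<lambda>x. \<Sum>i\<le>N. a i x * (x $ b k) ^ i)" by auto
  show ?case
    unfolding a(2)
    by (intro real_polynomial_function_sum real_polynomial_function.intros(4) Suc.IH a(1) real_polynomial_function_power
        real_polynomial_function.intros(1) bounded_linear_vec_nth) simp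
qed

lemma bounded_polys_le:
  assumes "f \<in> bounded_polys b k N" "k \<le> m" shows "f \<in> bounded_polys b m N"
  using assms(2,1) by (induction m rule: dec_induct) (auto intro: bounded_polys_Suc simp del: bounded_polys.simps)

lemma bounded_polys_coordinate:
  assumes "j < k" shows "(\<lambda>x. x $ b j) \<in> bounded_polys b k 1"
proof -
  have "(\<lambda>x. x $ b j) \<in> bounded_polys b (Suc j) 1"
    unfolding bounded_polys.simps mem_Collect_eq
  proof (intro exI[of _ "\<lambda>i x. if i = 1 then 1 else 0"] conjI allI)
    show "(\<lambda>x. if i = 1 then 1 else 0) \<in> bounded_polys b j 1" for i
      using bounded_polys_const[of "if i = 1 then 1 else 0"] .
  qed auto
  with assms show ?thesis by (meson Suc_leI bounded_polys_le)
qed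

lemma polynomial_imp_bounded_polys:
  fixes b :: "nat \<Rightarrow> 'n::finite"
  assumes b: "b ` {..<k} = UNIV" and "real_polynomial_function f"
  shows "\<exists>N. f \<in> bounded_polys b k N"
  using assms(2)
proof induction
  case (linear f)
  have "\<exists>j<k. b j = i" for i
  proof -
    have "i \<in> b ` {..<k}" by (simp only: b UNIV_I)
    then show ?thesis by blast
  qed
  then obtain r where r: "\<And>i. r i < k" "\<And>i. b (r i) = i" by metis
  have eq: "f = (\<lambda>x. \<Sum>i\<in>UNIV. f (axis i 1) * x $ b (r i))"
  proof
    fix x
    have "f x = f (\<Sum>i\<in>UNIV. x $ i *\<^sub>R axis i 1)"
      by (metis (mono_tags, lifting) basis_expansion scalar_mult_eq_scaleR sum.cong)
    also have "\<dots> = (\<Sum>i\<in>UNIV. f (axis i 1) * x $ b (r i))"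
      using linear by (simp add: bounded_linear.linear linear_sum linear_simps r mult.commute)
    finally show "f x = (\<Sum>i\<in>UNIV. f (axis i 1) * x $ b (r i))" .
  qed
  have "(\<lambda>x. \<Sum>i\<in>UNIV. f (axis i 1) * x $ b (r i)) \<in> bounded_polys b k (0 + 1)"
    by (intro bounded_polys_sum bounded_polys_mult bounded_polys_const bounded_polys_coordinate r)
  from back_subst[of "\<lambda>h. h \<in> bounded_polys b k (0 + 1)", OF this eq[symmetric]]
  have "f \<in> bounded_polys b k (0 + 1)" .
  then show ?case by blast
next
  case (const c)
  show ?case using bounded_polys_const by blast
next
  case (add f g)
  then obtain N M where "f \<in> bounded_polys b k N" "g \<in> bounded_polys b k M" by blast
  then have "f \<in> bounded_polys b k (max N M)" "g \<in> bounded_polys b k (max N M)"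
    by (auto intro: bounded_polys_mono)
  then show ?case using bounded_polys_add by blast
next
  case (mult f g)
  then show ?case using bounded_polys_mult by blast
qed

section \<open>Localization at an irreducible variety\<close>

definition nonvanishing_poly :: "'a::euclidean_space set \<Rightarrow> ('a \<Rightarrow> real) \<Rightarrow> bool" where
  "nonvanishing_poly C A \<longleftrightarrow> real_polynomial_function A \<and> \<not> vanishes_on A C"

lemma nonvanishing_poly_mult:
  assumes "irreducible_variety C" "nonvanishing_poly C A" "nonvanishing_poly C B"
  shows "nonvanishing_poly C (\<lambda>x. A x * B x)"
  using assms irreducible_variety_mult unfolding nonvanishing_poly_def
  by (metis real_polynomial_function.intros(4))

lemma nonvanishing_poly_1: "irreducible_variety C \<Longrightarrow> nonvanishing_poly C (\<lambda>x. 1)"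
  unfolding nonvanishing_poly_def vanishes_on_def irreducible_variety_def
  using real_polynomial_function.intros(2)[of 1] by auto

lemma nonvanishing_poly_power:
  assumes "irreducible_variety C" "nonvanishing_poly C A"
  shows "nonvanishing_poly C (\<lambda>x. A x ^ k)"
  by (induction k) (simp_all add: nonvanishing_poly_1 nonvanishing_poly_mult assms)

text \<open>Membership of \<open>q\<close> in the ideal generated by the \<open>\<Psi>\<close> after localizing at the prime ideal of \<open>C\<close>.\<close>

definition locally_generated ::
  "'a::euclidean_space set \<Rightarrow> nat \<Rightarrow> (nat \<Rightarrow> 'a \<Rightarrow> real) \<Rightarrow> ('a \<Rightarrow> real) \<Rightarrow> bool" where
  "locally_generated C e \<Psi> q \<longleftrightarrow> (\<exists>A B. nonvanishing_poly C A \<and>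
    (\<forall>j. real_polynomial_function (B j)) \<and> (\<forall>x. A x * q x = (\<Sum>j<e. B j x * \<Psi> j x)))"

lemma locally_generated_0:
  assumes "irreducible_variety C" shows "locally_generated C e \<Psi> (\<lambda>x. 0)"
  unfolding locally_generated_def
  using nonvanishing_poly_1[OF assms] real_polynomial_function.intros(2)[of 0]
  by (intro exI[of _ "\<lambda>x. 1"] exI[of _ "\<lambda>j x. 0"]) simp

lemma locally_generated_add:
  assumes C: "irreducible_variety C" and f: "locally_generated C e \<Psi> f" and g: "locally_generated C e \<Psi> g"
  shows "locally_generated C e \<Psi> (\<lambda>x. f x + g x)"
proof -
  obtain A B where A: "nonvanishing_poly C A" and B: "\<And>j. real_polynomial_function (B j)"
    and AB: "\<And>x. A x * f x = (\<Sum>j<e. B j x * \<Psi> j x)"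
    using f unfolding locally_generated_def by blast
  obtain A' B' where A': "nonvanishing_poly C A'" and B': "\<And>j. real_polynomial_function (B' j)"
    and AB': "\<And>x. A' x * g x = (\<Sum>j<e. B' j x * \<Psi> j x)"
    using g unfolding locally_generated_def by blast
  show ?thesis
    unfolding locally_generated_def
  proof (intro exI conjI allI)
    show "nonvanishing_poly C (\<lambda>x. A x * A' x)" using C A A' by (rule nonvanishing_poly_mult)
    show "real_polynomial_function (\<lambda>x. A' x * B j x + A x * B' j x)" for j
      using A A' B B' unfolding nonvanishing_poly_def by (intro real_polynomial_function.intros(3,4)) auto
    show "A x * A' x * (f x + g x) = (\<Sum>j<e. (A' x * B j x + A x * B' j x) * \<Psi> j x)" for x
    proof -
      have "A x * A' x * (f x + g x) = A' x * (A x * f x) + A x * (A' x * g x)" by (simp add: algebra_simps)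
      also have "\<dots> = (\<Sum>j<e. (A' x * B j x + A x * B' j x) * \<Psi> j x)"
        unfolding AB AB' sum_distrib_left sum.distrib[symmetric] by (simp add: algebra_simps)
      finally show ?thesis .
    qed
  qed
qed

lemma locally_generated_mult:
  assumes f: "locally_generated C e \<Psi> f" and h: "real_polynomial_function h"
  shows "locally_generated C e \<Psi> (\<lambda>x. f x * h x)"
proof -
  obtain A B where A: "nonvanishing_poly C A" and B: "\<And>j. real_polynomial_function (B j)"
    and AB: "\<And>x. A x * f x = (\<Sum>j<e. B j x * \<Psi> j x)"
    using f unfolding locally_generated_def by blast
  show ?thesis
    unfolding locally_generated_def
  proof (intro exI conjI allI)
    show "real_polynomial_function (\<lambda>x. h x * B j x)" for j by (intro real_polynomial_function.intros(4) h B)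
    show "A x * (f x * h x) = (\<Sum>j<e. (h x * B j x) * \<Psi> j x)" for x
    proof -
      have "A x * (f x * h x) = h x * (A x * f x)" by simp
      also have "\<dots> = (\<Sum>j<e. (h x * B j x) * \<Psi> j x)"
        unfolding AB sum_distrib_left by (simp add: mult.assoc)
      finally show ?thesis .
    qed
  qed (rule A)
qed

lemma locally_generated_sum:
  assumes "irreducible_variety C" "\<And>i. i \<in> I \<Longrightarrow> locally_generated C e \<Psi> (f i)"
  shows "locally_generated C e \<Psi> (\<lambda>x. \<Sum>i\<in>I. f i x)"
  using assms(2)
  by (induction I rule: infinite_finite_induct)
    (simp_all add: locally_generated_0 locally_generated_add assms(1))

text \<open>Up to the factor \<open>A\<close>, the restrictions to \<open>C\<close> of the members of \<open>F\<close> span a space of dimension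
  at most \<open>m\<close>.\<close>

definition spanned_by :: "'a::euclidean_space set \<Rightarrow> ('a \<Rightarrow> real) set \<Rightarrow> nat \<Rightarrow> bool" where
  "spanned_by C F m \<longleftrightarrow> (\<exists>A g. nonvanishing_poly C A \<and>
    (\<forall>q\<in>F. \<exists>u. \<forall>x\<in>C. A x * q x = (\<Sum>j<m. u j * g j x)))"

lemma spanned_by_mono:
  assumes "spanned_by C F m" "m \<le> m'" shows "spanned_by C F m'"
proof -
  obtain A g where A: "nonvanishing_poly C A"
    and g: "\<And>q. q \<in> F \<Longrightarrow> \<exists>u. \<forall>x\<in>C. A x * q x = (\<Sum>j<m. u j * g j x)"
    using assms(1) unfolding spanned_by_def by blast
  have "\<exists>u. \<forall>x\<in>C. A x * q x = (\<Sum>j<m'. u j * g j x)" if q: "q \<in> F" for q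
  proof -
    obtain u where u: "\<And>x. x \<in> C \<Longrightarrow> A x * q x = (\<Sum>j<m. u j * g j x)" using g[OF q] by blast
    have "(\<Sum>j<m. u j * g j x) = (\<Sum>j<m'. (if j < m then u j else 0) * g j x)" for x
      using assms(2) by (intro sum.mono_neutral_cong_left) auto
    then show ?thesis using u by (intro exI[of _ "\<lambda>j. if j < m then u j else 0"]) simp
  qed
  with A show ?thesis unfolding spanned_by_def by blast
qed

lemma sum_div_mod:
  fixes f :: "nat \<Rightarrow> nat \<Rightarrow> real"
  shows "(\<Sum>s<P * m. f (s div m) (s mod m)) = (\<Sum>i<P. \<Sum>j<m. f i j)"
proof -
  have "(\<Sum>s\<in>{i * m..<i * m + m}. f (s div m) (s mod m)) = (\<Sum>j<m. f i j)" for i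
  proof -
    have "(\<Sum>s\<in>{i * m..<i * m + m}. f (s div m) (s mod m)) = (\<Sum>j\<in>{0..<m}. f ((j + i * m) div m) ((j + i * m) mod m))"
      using sum.shift_bounds_nat_ivl[of "\<lambda>s. f (s div m) (s mod m)" 0 "i * m" m] by (simp add: add.commute)
    also have "\<dots> = (\<Sum>j<m. f i j)" unfolding lessThan_atLeast0 by (intro sum.cong) auto
    finally show ?thesis .
  qed
  then show ?thesis using sum.nat_group[of "\<lambda>s. f (s div m) (s mod m)" m P] by simp
qed

text \<open>The \<open>m\<close> old spanning functions times the \<open>P\<close> powers of
  \<open>y\<close> span the new family; a pair of indices is coded as \<open>s\<close> through
  \<open>s div m\<close> and \<open>s mod m\<close>. The factors \<open>A\<close> and
  \<open>D\<close> multiply, which irreducibility permits.\<close>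

lemma spanned_by_combine:
  assumes C: "irreducible_variety C" and F: "spanned_by C F m" and D: "nonvanishing_poly C D"
    and F': "\<And>q. q \<in> F' \<Longrightarrow> \<exists>a. (\<forall>i<P. a i \<in> F) \<and> (\<forall>x\<in>C. D x * q x = (\<Sum>i<P. a i x * y x ^ i))"
  shows "spanned_by C F' (P * m)"
proof -
  obtain A g where A: "nonvanishing_poly C A"
    and g: "\<And>q. q \<in> F \<Longrightarrow> \<exists>u. \<forall>x\<in>C. A x * q x = (\<Sum>j<m. u j * g j x)"
    using F unfolding spanned_by_def by blast
  have "\<exists>u. \<forall>x\<in>C. A x * D x * q x = (\<Sum>s<P * m. u s * (g (s mod m) x * y x ^ (s div m)))"
    if q: "q \<in> F'" for q
  proof -
    obtain a where a: "\<And>i. i < P \<Longrightarrow> a i \<in> F" "\<And>x. x \<in> C \<Longrightarrow> D x * q x = (\<Sum>i<P. a i x * y x ^ i)"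
      using F'[OF q] by blast
    have "\<exists>u. \<forall>x\<in>C. i < P \<longrightarrow> A x * a i x = (\<Sum>j<m. u j * g j x)" for i
      using g[OF a(1)[of i]] by (cases "i < P") auto
    then obtain u where u: "\<And>i x. i < P \<Longrightarrow> x \<in> C \<Longrightarrow> A x * a i x = (\<Sum>j<m. u i j * g j x)" by metis
    show ?thesis
    proof (intro exI ballI)
      fix x assume x: "x \<in> C"
      have "A x * D x * q x = (\<Sum>i<P. (A x * a i x) * y x ^ i)"
        using a(2)[OF x] by (simp add: mult.assoc sum_distrib_left)
      also have "\<dots> = (\<Sum>i<P. \<Sum>j<m. u i j * (g j x * y x ^ i))"
        using u x by (intro sum.cong refl) (simp add: sum_distrib_right mult.assoc)
      also have "\<dots> = (\<Sum>s<P * m. u (s div m) (s mod m) * (g (s mod m) x * y x ^ (s div m)))"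
        by (rule sum_div_mod[symmetric])
      finally show "A x * D x * q x = (\<Sum>s<P * m. u (s div m) (s mod m) * (g (s mod m) x * y x ^ (s div m)))" .
    qed
  qed
  moreover have "nonvanishing_poly C (\<lambda>x. A x * D x)" using C A D by (rule nonvanishing_poly_mult)
  ultimately show ?thesis
    unfolding spanned_by_def
    by (intro exI[of _ "\<lambda>x. A x * D x"] exI[of _ "\<lambda>s x. g (s mod m) x * y x ^ (s div m)"]) blast
qed

text \<open>An algebraic equation on \<open>C\<close> for the coordinate \<open>b k\<close> over the
  preceding ones, with leading coefficient nonzero in the function field. Degree \<open>0\<close>
  cannot occur, since \<open>c 0\<close> would have to vanish on \<open>C\<close> and not vanish on
  it.\<close>

definition relation_of_degree :: "'n::finite itself \<Rightarrow> (real^'n) set \<Rightarrow> (nat \<Rightarrow> 'n) \<Rightarrow> nat \<Rightarrow> nat \<Rightarrow> bool" where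
  "relation_of_degree _ C b k m \<longleftrightarrow> (\<exists>D c. (\<forall>i. c i \<in> bounded_polys b k D) \<and>
    vanishes_on (\<lambda>x. \<Sum>i\<le>m. c i x * (x $ b k) ^ i) C \<and> \<not> vanishes_on (c m) C)"

text \<open>The top coefficient must vanish on \<open>C\<close>, or it would lead a relation;
  dropping it leaves a shorter sum of the same kind.\<close>

lemma no_relation_coefficients:
  assumes "\<And>i. i < P \<Longrightarrow> \<not> relation_of_degree TYPE('n::finite) C b k i"
    and "\<And>i. a i \<in> bounded_polys b k D"
    and "vanishes_on (\<lambda>x. \<Sum>i<P. a i x * (x $ b k) ^ i) C" and "i < P"
  shows "vanishes_on (a i) C"
  using assms(1,3,4)
proof (induction P)
  case (Suc P)
  have "vanishes_on (\<lambda>x. \<Sum>i\<le>P. a i x * (x $ b k) ^ i) C"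
    using Suc.prems(2) by (simp add: lessThan_Suc_atMost)
  then have P: "vanishes_on (a P) C"
    using Suc.prems(1)[of P] assms(2) unfolding relation_of_degree_def by blast
  then have "vanishes_on (\<lambda>x. \<Sum>i<P. a i x * (x $ b k) ^ i) C"
    using Suc.prems(2) by (simp add: vanishes_on_def)
  then show ?case using Suc P by (cases "i = P") auto
qed simp

text \<open>Each step of the division costs a factor \<open>c m\<close> and at most \<open>D\<close>
  in the degree of the coefficients. That the resulting bound \<open>E + N * D\<close> is linear in
  \<open>N\<close> is what later preserves the growth exponent.\<close>

lemma pseudo_division:
  fixes c :: "nat \<Rightarrow> real^'n::finite \<Rightarrow> real"
  assumes c: "\<And>i. c i \<in> bounded_polys b k D"
  shows "(\<And>i. a i \<in> bounded_polys b k E) \<Longrightarrow>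
    \<exists>r B. real_polynomial_function B \<and> (\<forall>i. r i \<in> bounded_polys b k (E + N * D)) \<and>
      (\<forall>x. c m x ^ N * (\<Sum>i<N. a i x * (x $ b k) ^ i) =
        B x * (\<Sum>i\<le>m. c i x * (x $ b k) ^ i) + (\<Sum>i<m. r i x * (x $ b k) ^ i))"
proof (induction N arbitrary: a E)
  case 0
  show ?case
    using real_polynomial_function.intros(2)[of 0] bounded_polys_const[of 0 b k E]
    by (intro exI[of _ "\<lambda>_ _. 0"] exI[of _ "\<lambda>_. 0"]) simp
next
  case (Suc N)
  have ylin: "real_polynomial_function (\<lambda>x :: real^'n. x $ b k)"
    by (intro real_polynomial_function.intros(1) bounded_linear_vec_nth)
  have cpow: "(\<lambda>x. c m x ^ j) \<in> bounded_polys b k (j * D)" for j by (rule bounded_polys_power[OF c])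
  show ?case
  proof (cases "N < m")
    case True
    have "\<exists>r B. real_polynomial_function B \<and> (\<forall>i. r i \<in> bounded_polys b k (E + N * D)) \<and>
      (\<forall>x. c m x ^ N * (\<Sum>i<N. a i x * (x $ b k) ^ i) =
        B x * (\<Sum>i\<le>m. c i x * (x $ b k) ^ i) + (\<Sum>i<m. r i x * (x $ b k) ^ i))"
      by (rule Suc.IH) (rule Suc.prems)
    then obtain r B where r: "real_polynomial_function B" "\<And>i. r i \<in> bounded_polys b k (E + N * D)"
      "\<And>x. c m x ^ N * (\<Sum>i<N. a i x * (x $ b k) ^ i) =
        B x * (\<Sum>i\<le>m. c i x * (x $ b k) ^ i) + (\<Sum>i<m. r i x * (x $ b k) ^ i)"
      by (elim exE conjE) (rule that, simp_all only: simp_thms)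
    \<comment> \<open>There is nothing to divide yet: the new top term joins the remainder, and the
      additional factor \<open>c m\<close> only keeps its exponent equal to the number of
      coefficients.\<close>
    define r' where "r' i x = c m x * r i x + (if i = N then c m x ^ Suc N * a N x else 0)" for i x
    show ?thesis
    proof (intro exI conjI allI)
      show "real_polynomial_function (\<lambda>x. c m x * B x)"
        by (intro real_polynomial_function.intros(4) r(1) bounded_polys_polynomial[OF c])
      show "r' i \<in> bounded_polys b k (E + Suc N * D)" for i
      proof -
        have 1: "(\<lambda>x. c m x * r i x) \<in> bounded_polys b k (E + Suc N * D)"
          by (rule bounded_polys_mono[OF bounded_polys_mult[OF c r(2)]]) simp
        have 2: "(\<lambda>x. c m x ^ Suc N * a N x) \<in> bounded_polys b k (E + Suc N * D)"
          by (rule bounded_polys_mono[OF bounded_polys_mult[OF cpow Suc.prems]]) simp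
        show ?thesis
        proof (cases "i = N")
          case True
          then show ?thesis unfolding r'_def using bounded_polys_add[OF 1 2] by simp
        next
          case False
          then show ?thesis unfolding r'_def using 1 by simp
        qed
      qed
      fix x :: "real^'n"
      have "(\<Sum>i<m. r' i x * (x $ b k) ^ i) =
          c m x * (\<Sum>i<m. r i x * (x $ b k) ^ i) + (\<Sum>i<m. (if i = N then c m x ^ Suc N * a N x else 0) * (x $ b k) ^ i)"
        unfolding r'_def by (simp add: sum_distrib_left algebra_simps sum.distrib)
      also have "(\<Sum>i<m. (if i = N then c m x ^ Suc N * a N x else 0) * (x $ b k) ^ i) =
          (\<Sum>i\<in>{N}. (if i = N then c m x ^ Suc N * a N x else 0) * (x $ b k) ^ i)"
        using True by (intro sum.mono_neutral_right) auto
      finally have sum: "(\<Sum>i<m. r' i x * (x $ b k) ^ i) =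
          c m x * (\<Sum>i<m. r i x * (x $ b k) ^ i) + c m x ^ Suc N * a N x * (x $ b k) ^ N" by simp
      have "c m x ^ Suc N * (\<Sum>i<Suc N. a i x * (x $ b k) ^ i) =
          c m x * (c m x ^ N * (\<Sum>i<N. a i x * (x $ b k) ^ i)) + c m x ^ Suc N * a N x * (x $ b k) ^ N"
        by (simp add: algebra_simps)
      then show "c m x ^ Suc N * (\<Sum>i<Suc N. a i x * (x $ b k) ^ i) =
          c m x * B x * (\<Sum>i\<le>m. c i x * (x $ b k) ^ i) + (\<Sum>i<m. r' i x * (x $ b k) ^ i)"
        unfolding r(3) sum by (simp add: algebra_simps)
    qed
  next
    case False
    \<comment> \<open>The coefficients of \<open>c m\<close> times the dividend minus
      \<open>a N\<close> times the divisor shifted by \<open>N - m\<close>; the terms of degree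
      \<open>N\<close> cancel.\<close>
    define a' where "a' i x = c m x * a i x + (if N - m \<le> i then - 1 * a N x * c (i - (N - m)) x else 0)" for i x
    have a': "a' i \<in> bounded_polys b k (E + D)" for i
    proof -
      have 1: "(\<lambda>x. c m x * a i x) \<in> bounded_polys b k (E + D)"
        using bounded_polys_mult[OF c Suc.prems] by (simp add: add.commute)
      have 2: "(\<lambda>x. - 1 * a N x * c j x) \<in> bounded_polys b k (E + D)" for j
        using bounded_polys_mult[OF bounded_polys_mult[OF bounded_polys_const Suc.prems, where N = 0] c, of "- 1"]
        by simp
      show ?thesis
      proof (cases "N - m \<le> i")
        case True
        then show ?thesis unfolding a'_def using bounded_polys_add[OF 1 2[of "i - (N - m)"]] by simp
      next
        case False
        then show ?thesis unfolding a'_def using 1 by simp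
      qed
    qed
    have "\<exists>r B. real_polynomial_function B \<and> (\<forall>i. r i \<in> bounded_polys b k (E + D + N * D)) \<and>
      (\<forall>x. c m x ^ N * (\<Sum>i<N. a' i x * (x $ b k) ^ i) =
        B x * (\<Sum>i\<le>m. c i x * (x $ b k) ^ i) + (\<Sum>i<m. r i x * (x $ b k) ^ i))"
      by (rule Suc.IH) (rule a')
    then obtain r B where r: "real_polynomial_function B" "\<And>i. r i \<in> bounded_polys b k (E + D + N * D)"
      "\<And>x. c m x ^ N * (\<Sum>i<N. a' i x * (x $ b k) ^ i) =
        B x * (\<Sum>i\<le>m. c i x * (x $ b k) ^ i) + (\<Sum>i<m. r i x * (x $ b k) ^ i)"
      by (elim exE conjE) (rule that, simp_all only: simp_thms)
    show ?thesis
    proof (intro exI conjI allI)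
      show "real_polynomial_function (\<lambda>x. B x + c m x ^ N * (a N x * (x $ b k) ^ (N - m)))"
        by (intro real_polynomial_function.intros(3,4) real_polynomial_function_power ylin r(1)
            bounded_polys_polynomial[OF c] bounded_polys_polynomial[OF Suc.prems])
      show "r i \<in> bounded_polys b k (E + Suc N * D)" for i using r(2)[of i] by (simp add: add.assoc)
      fix x :: "real^'n"
      let ?y = "x $ b k" and ?\<Psi> = "\<Sum>i\<le>m. c i x * (x $ b k) ^ i"
      have "a N x * ?y ^ (N - m) * ?\<Psi> = (\<Sum>i\<le>m. a N x * c i x * ?y ^ (i + (N - m)))"
        unfolding sum_distrib_left by (simp add: power_add mult_ac)
      also have "\<dots> = (\<Sum>i\<in>{0 + (N - m)..m + (N - m)}. a N x * c (i - (N - m)) x * ?y ^ i)"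
        unfolding sum.shift_bounds_cl_nat_ivl by (simp add: atLeast0AtMost)
      also have "{0 + (N - m)..m + (N - m)} = {N - m..N}" using False by auto
      also have "(\<Sum>i\<in>{N - m..N}. a N x * c (i - (N - m)) x * ?y ^ i) =
          (\<Sum>i\<le>N. (if N - m \<le> i then a N x * c (i - (N - m)) x else 0) * ?y ^ i)"
        by (intro sum.mono_neutral_cong_left) auto
      also have "\<dots> = (\<Sum>i<N. (if N - m \<le> i then a N x * c (i - (N - m)) x else 0) * ?y ^ i) + a N x * c m x * ?y ^ N"
        unfolding lessThan_Suc_atMost[symmetric] using False by simp
      finally have 1: "a N x * ?y ^ (N - m) * ?\<Psi> =
        (\<Sum>i<N. (if N - m \<le> i then a N x * c (i - (N - m)) x else 0) * ?y ^ i) + a N x * c m x * ?y ^ N" .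
      have "(\<Sum>i<N. a' i x * ?y ^ i) = (\<Sum>i<N. c m x * (a i x * ?y ^ i)) -
          (\<Sum>i<N. (if N - m \<le> i then a N x * c (i - (N - m)) x else 0) * ?y ^ i)"
        unfolding sum_subtractf[symmetric] a'_def by (intro sum.cong refl) (simp add: algebra_simps)
      with 1 have 2: "c m x * (\<Sum>i<Suc N. a i x * ?y ^ i) = a N x * ?y ^ (N - m) * ?\<Psi> + (\<Sum>i<N. a' i x * ?y ^ i)"
        by (simp add: sum_distrib_left algebra_simps)
      have "c m x ^ Suc N * (\<Sum>i<Suc N. a i x * ?y ^ i) = c m x ^ N * (c m x * (\<Sum>i<Suc N. a i x * ?y ^ i))"
        by simp
      also have "\<dots> = c m x ^ N * (a N x * ?y ^ (N - m)) * ?\<Psi> + c m x ^ N * (\<Sum>i<N. a' i x * ?y ^ i)"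
        unfolding 2 by (simp add: algebra_simps)
      finally show "c m x ^ Suc N * (\<Sum>i<Suc N. a i x * ?y ^ i) =
          (B x + c m x ^ N * (a N x * ?y ^ (N - m))) * ?\<Psi> + (\<Sum>i<m. r i x * ?y ^ i)"
        unfolding r(3) by (simp add: algebra_simps)
    qed
  qed
qed

lemma bounded_polys_SucE:
  assumes "q \<in> bounded_polys b (Suc k) N"
  obtains a where "\<And>i. a i \<in> bounded_polys b k N" "\<And>x. q x = (\<Sum>i<Suc N. a i x * (x $ b k) ^ i)"
  using assms by (auto simp: lessThan_Suc_atMost)

text \<open>Without a relation, a polynomial in the new coordinate vanishes on \<open>C\<close> only
  if all its coefficients do, so no new generator arises. The \<open>N + 1\<close> powers of the
  coordinate raise the growth exponent by one.\<close>

lemma generic_generators_transcendental: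
  fixes C :: "(real^'n::finite) set"
  assumes C: "irreducible_variety C"
    and gen: "\<And>N q. q \<in> bounded_polys b k N \<Longrightarrow> vanishes_on q C \<Longrightarrow> locally_generated C e \<Psi> q"
    and span: "\<And>N. spanned_by C (bounded_polys b k N) (K * (N + 1) ^ s)"
    and norel: "\<And>m. \<not> relation_of_degree TYPE('n) C b k m"
  shows "q \<in> bounded_polys b (Suc k) N \<Longrightarrow> vanishes_on q C \<Longrightarrow> locally_generated C e \<Psi> q"
    and "spanned_by C (bounded_polys b (Suc k) N) (K * (N + 1) ^ Suc s)"
proof -
  assume "q \<in> bounded_polys b (Suc k) N" and van: "vanishes_on q C"
  then obtain a where a: "\<And>i. a i \<in> bounded_polys b k N" "\<And>x. q x = (\<Sum>i<Suc N. a i x * (x $ b k) ^ i)"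
    using bounded_polys_SucE by blast
  have "vanishes_on (a i) C" if "i < Suc N" for i
    by (rule no_relation_coefficients[OF norel a(1) _ that]) (use van in \<open>simp only: vanishes_on_def a(2)\<close>)
  then have "locally_generated C e \<Psi> (\<lambda>x. \<Sum>i<Suc N. a i x * (x $ b k) ^ i)"
    by (intro locally_generated_sum[OF C] locally_generated_mult gen[OF a(1)] real_polynomial_function_power
        real_polynomial_function.intros(1) bounded_linear_vec_nth) simp
  then show "locally_generated C e \<Psi> q"
    by (simp only: a(2)[symmetric])
next
  have "spanned_by C (bounded_polys b (Suc k) N) (Suc N * (K * (N + 1) ^ s))"
  proof (rule spanned_by_combine[OF C span nonvanishing_poly_1[OF C], where y = "\<lambda>x. x $ b k"])
    fix q :: "real^'n \<Rightarrow> real"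
    assume "q \<in> bounded_polys b (Suc k) N"
    then obtain a where a: "\<And>i. a i \<in> bounded_polys b k N" "\<And>x. q x = (\<Sum>i<Suc N. a i x * (x $ b k) ^ i)"
      using bounded_polys_SucE by blast
    then show "\<exists>a. (\<forall>i<Suc N. a i \<in> bounded_polys b k N) \<and>
        (\<forall>x\<in>C. 1 * q x = (\<Sum>i<Suc N. a i x * (x $ b k) ^ i))"
      by (intro exI[of _ a]) simp
  qed
  then show "spanned_by C (bounded_polys b (Suc k) N) (K * (N + 1) ^ Suc s)"
    by (simp add: mult_ac)
qed

text \<open>Pseudo-division by the relation \<open>\<Phi>\<close> leaves a remainder of degree below
  \<open>m\<close>. If the dividend vanishes on \<open>C\<close>, so do the coefficients of the
  remainder, hence \<open>\<Phi>\<close> is the only new generator. In any case the remainder has a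
  fixed number \<open>m\<close> of coefficients, whose degrees are linear in \<open>N\<close>, so
  the growth exponent is unchanged.\<close>

lemma generic_generators_algebraic:
  fixes C :: "(real^'n::finite) set"
  assumes C: "irreducible_variety C"
    and gen: "\<And>N q. q \<in> bounded_polys b k N \<Longrightarrow> vanishes_on q C \<Longrightarrow> locally_generated C e \<Psi> q"
    and span: "\<And>N. spanned_by C (bounded_polys b k N) (K * (N + 1) ^ s)"
    and c: "\<And>i. c i \<in> bounded_polys b k D" "\<not> vanishes_on (c m) C"
    and \<Phi>: "vanishes_on \<Phi> C" "\<And>x. \<Phi> x = (\<Sum>i\<le>m. c i x * (x $ b k) ^ i)"
    and norel: "\<And>i. i < m \<Longrightarrow> \<not> relation_of_degree TYPE('n) C b k i"
  shows "q \<in> bounded_polys b (Suc k) N \<Longrightarrow> vanishes_on q C \<Longrightarrow>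
      locally_generated C (Suc e) (\<Psi>(e := \<Phi>)) q"
    and "spanned_by C (bounded_polys b (Suc k) N) (m * K * (D + 2) ^ s * (N + 1) ^ s)"
proof -
  have cm: "nonvanishing_poly C (c m)"
    using c bounded_polys_polynomial unfolding nonvanishing_poly_def by blast
  have division: "\<exists>r B. real_polynomial_function B \<and> (\<forall>i. r i \<in> bounded_polys b k (N + Suc N * D)) \<and>
      (\<forall>x. c m x ^ Suc N * q x = B x * \<Phi> x + (\<Sum>i<m. r i x * (x $ b k) ^ i))"
    if q: "q \<in> bounded_polys b (Suc k) N" for q N
  proof -
    obtain a where a: "\<And>i. a i \<in> bounded_polys b k N" "\<And>x. q x = (\<Sum>i<Suc N. a i x * (x $ b k) ^ i)"
      using bounded_polys_SucE[OF q] by blast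
    show ?thesis unfolding a(2) \<Phi>(2) by (rule pseudo_division[OF c(1) a(1)])
  qed
  {
    assume q: "q \<in> bounded_polys b (Suc k) N" and van: "vanishes_on q C"
    from division[OF q] obtain r B where B: "real_polynomial_function B"
      and r: "\<And>i. r i \<in> bounded_polys b k (N + Suc N * D)"
      and div: "\<And>x. c m x ^ Suc N * q x = B x * \<Phi> x + (\<Sum>i<m. r i x * (x $ b k) ^ i)"
      by (elim exE conjE) (rule that, simp_all only: simp_thms)
    have "vanishes_on (\<lambda>x. \<Sum>i<m. r i x * (x $ b k) ^ i) C"
      unfolding vanishes_on_def
    proof
      fix x assume "x \<in> C"
      then show "(\<Sum>i<m. r i x * (x $ b k) ^ i) = 0"
        using div[of x] vanishes_onD[OF van] vanishes_onD[OF \<Phi>(1)] by simp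
    qed
    then have van: "vanishes_on (\<lambda>x. \<Sum>i<m. r i x * (x $ b k) ^ i) C" .
    have "vanishes_on (r i) C" if "i < m" for i
      by (rule no_relation_coefficients[where P = m, OF _ r van that]) (rule norel)
    then have "locally_generated C e \<Psi> (\<lambda>x. \<Sum>i<m. r i x * (x $ b k) ^ i)"
      by (intro locally_generated_sum[OF C] locally_generated_mult gen[OF r] real_polynomial_function_power
          real_polynomial_function.intros(1) bounded_linear_vec_nth) simp
    then obtain A B' where A: "nonvanishing_poly C A" and B': "\<And>j. real_polynomial_function (B' j)"
      and AB: "\<And>x. A x * (\<Sum>i<m. r i x * (x $ b k) ^ i) = (\<Sum>j<e. B' j x * \<Psi> j x)"
      unfolding locally_generated_def by blast
    show "locally_generated C (Suc e) (\<Psi>(e := \<Phi>)) q"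
      unfolding locally_generated_def
    proof (intro exI conjI allI)
      show "nonvanishing_poly C (\<lambda>x. A x * c m x ^ Suc N)"
        by (intro nonvanishing_poly_mult nonvanishing_poly_power C A cm)
      have AB_poly: "real_polynomial_function (\<lambda>x. A x * B x)"
        using A B unfolding nonvanishing_poly_def by (intro real_polynomial_function.intros(4)) auto
      show "real_polynomial_function ((B'(e := (\<lambda>x. A x * B x))) j)" for j
        using B'[of j] AB_poly by (cases "j = e") simp_all
      fix x
      have "A x * c m x ^ Suc N * q x = A x * B x * \<Phi> x + A x * (\<Sum>i<m. r i x * (x $ b k) ^ i)"
        unfolding mult.assoc[of "A x"] div by (simp add: algebra_simps)
      also have "\<dots> = (\<Sum>j<Suc e. (B'(e := (\<lambda>x. A x * B x))) j x * (\<Psi>(e := \<Phi>)) j x)"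
        unfolding AB by simp
      finally show "A x * c m x ^ Suc N * q x = (\<Sum>j<Suc e. (B'(e := (\<lambda>x. A x * B x))) j x * (\<Psi>(e := \<Phi>)) j x)" .
    qed
  next
    have "spanned_by C (bounded_polys b (Suc k) N) (m * (K * (N + Suc N * D + 1) ^ s))"
    proof (rule spanned_by_combine[OF C span nonvanishing_poly_power[OF C cm], where y = "\<lambda>x. x $ b k"])
      fix q :: "real^'n \<Rightarrow> real"
      assume q: "q \<in> bounded_polys b (Suc k) N"
      from division[OF q] obtain r B where r: "\<And>i. r i \<in> bounded_polys b k (N + Suc N * D)"
        and div: "\<And>x. c m x ^ Suc N * q x = B x * \<Phi> x + (\<Sum>i<m. r i x * (x $ b k) ^ i)"
        by (elim exE conjE) (rule that, simp_all only: simp_thms)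
      then show "\<exists>a. (\<forall>i<m. a i \<in> bounded_polys b k (N + Suc N * D)) \<and>
          (\<forall>x\<in>C. c m x ^ Suc N * q x = (\<Sum>i<m. a i x * (x $ b k) ^ i))"
        using vanishes_onD[OF \<Phi>(1)] by (intro exI[of _ r]) simp
    qed
    moreover have "m * (K * (N + Suc N * D + 1) ^ s) \<le> m * K * (D + 2) ^ s * (N + 1) ^ s"
    proof -
      \<comment> \<open>The left side equals \<open>(D + 1) * (N + 1)\<close>: the degree bound
        grows by a constant factor only, which is absorbed into the constant in front.\<close>
      have "N + Suc N * D + 1 \<le> (D + 2) * (N + 1)" by (simp add: algebra_simps)
      then have "(N + Suc N * D + 1) ^ s \<le> ((D + 2) * (N + 1)) ^ s" by (rule power_mono) simp
      then show ?thesis unfolding power_mult_distrib mult.assoc by (intro mult_le_mono order_refl)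
    qed
    ultimately show "spanned_by C (bounded_polys b (Suc k) N) (m * K * (D + 2) ^ s * (N + 1) ^ s)"
      by (rule spanned_by_mono)
  }
qed

text \<open>Adding the coordinates one at a time: a coordinate algebraic over the previous ones
  contributes a generator \<open>\<Psi>\<close> of the localized ideal, any other one raises the growth exponent.\<close>

lemma generic_generators:
  fixes C :: "(real^'n::finite) set"
  assumes C: "irreducible_variety C"
  shows "\<exists>e \<Psi> K. e \<le> k \<and> (\<forall>j<e. real_polynomial_function (\<Psi> j) \<and> vanishes_on (\<Psi> j) C) \<and>
    (\<forall>N q. q \<in> bounded_polys b k N \<longrightarrow> vanishes_on q C \<longrightarrow> locally_generated C e \<Psi> q) \<and>
    (\<forall>N. spanned_by C (bounded_polys b k N) (K * (N + 1) ^ (k - e)))"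
proof (induction k)
  case 0
  have ne: "C \<noteq> {}" using C by (simp add: irreducible_variety_def)
  have gen: "locally_generated C 0 (\<lambda>_ _. 0) q" if "q \<in> bounded_polys b 0 N" "vanishes_on q C" for q N
  proof -
    have "\<exists>c. q = (\<lambda>x. c)" using that(1) by simp
    then obtain c where "q = (\<lambda>x. c)" by blast
    with that(2) ne have "q = (\<lambda>x. 0)" by (auto simp: vanishes_on_def)
    then show ?thesis using locally_generated_0[OF C] by simp
  qed
  have "spanned_by C (bounded_polys b 0 N) (Suc 0)" for N
    unfolding spanned_by_def
  proof (rule exI[of _ "\<lambda>x. 1"], rule exI[of _ "\<lambda>_ _. 1"], intro conjI ballI)
    fix q assume "q \<in> bounded_polys b 0 N"
    then obtain c where "q = (\<lambda>x. c)" by auto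
    then show "\<exists>u. \<forall>x\<in>C. (1 :: real) * q x = (\<Sum>j<Suc 0. u j * 1)" by (intro exI[of _ "\<lambda>_. c"]) simp
  qed (rule nonvanishing_poly_1[OF C])
  with gen show ?case
    by (intro exI[of _ 0] exI[of _ "\<lambda>_ _. 0"] exI[of _ 1]) auto
next
  case (Suc k)
  then obtain e \<Psi> K where e: "e \<le> k" and \<Psi>: "\<And>j. j < e \<Longrightarrow> real_polynomial_function (\<Psi> j) \<and> vanishes_on (\<Psi> j) C"
    and gen: "\<And>N q. q \<in> bounded_polys b k N \<Longrightarrow> vanishes_on q C \<Longrightarrow> locally_generated C e \<Psi> q"
    and span: "\<And>N. spanned_by C (bounded_polys b k N) (K * (N + 1) ^ (k - e))" by blast
  show ?case
  proof (cases "\<exists>m. relation_of_degree TYPE('n) C b k m")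
    case False
    then have norel: "\<not> relation_of_degree TYPE('n) C b k m" for m by blast
    have "Suc k - e = Suc (k - e)" using e by simp
    then show ?thesis
      using e \<Psi> generic_generators_transcendental[OF C gen span norel]
      by (intro exI[of _ e] exI[of _ \<Psi>] exI[of _ K]) simp
  next
    case True
    \<comment> \<open>Minimality of the degree makes remainders modulo the relation vanish on
      \<open>C\<close> only if all their coefficients do.\<close>
    define m where "m = (LEAST m. relation_of_degree TYPE('n) C b k m)"
    have rel: "relation_of_degree TYPE('n) C b k m" unfolding m_def using True by (rule LeastI_ex)
    have norel: "\<not> relation_of_degree TYPE('n) C b k i" if "i < m" for i
      using that unfolding m_def by (rule not_less_Least)
    obtain D c where c: "\<And>i. c i \<in> bounded_polys b k D" "\<not> vanishes_on (c m) C"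
      and van: "vanishes_on (\<lambda>x. \<Sum>i\<le>m. c i x * (x $ b k) ^ i) C"
      using rel unfolding relation_of_degree_def by blast
    define \<Phi> where "\<Phi> x = (\<Sum>i\<le>m. c i x * (x $ b k) ^ i)" for x
    have \<Phi>van: "vanishes_on \<Phi> C" using van unfolding \<Phi>_def .
    have \<Phi>poly: "real_polynomial_function \<Phi>"
      unfolding \<Phi>_def by (intro real_polynomial_function_sum real_polynomial_function.intros(4)
          bounded_polys_polynomial[OF c(1)] real_polynomial_function_power
          real_polynomial_function.intros(1) bounded_linear_vec_nth) simp
    note step = generic_generators_algebraic[OF C gen span c \<Phi>van \<Phi>_def norel]
    show ?thesis
    proof (intro exI conjI allI impI)
      show "Suc e \<le> Suc k" using e by simp
      show "locally_generated C (Suc e) (\<Psi>(e := \<Phi>)) q"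
        if "q \<in> bounded_polys b (Suc k) N" "vanishes_on q C" for q N
        by (rule step(1)[OF _ _ _ that])
      show "spanned_by C (bounded_polys b (Suc k) N) (m * K * (D + 2) ^ (k - e) * (N + 1) ^ (Suc k - Suc e))" for N
        unfolding diff_Suc_Suc by (rule step(2))
      show "real_polynomial_function ((\<Psi>(e := \<Phi>)) j)" "vanishes_on ((\<Psi>(e := \<Phi>)) j) C" if "j < Suc e" for j
        using that \<Psi>[of j] \<Phi>van \<Phi>poly by (auto simp: less_Suc_eq)
    qed
  qed
qed

lemma power_product_bounded:
  fixes b :: "nat \<Rightarrow> 'n::finite"
  assumes "list_all (\<lambda>q. q \<in> bounded_polys b n a) qs" "set l \<subseteq> {..M}"
  shows "power_product qs l \<in> bounded_polys b n (length qs * (M * a))"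
  using assms
proof (induction qs arbitrary: l)
  case Nil
  have "power_product [] l = (\<lambda>x :: real^'n. 1)" by (rule ext) simp
  then show ?case by (simp only: bounded_polys_const)
next
  case (Cons q qs)
  show ?case
  proof (cases l)
    case Nil
    have "power_product (q # qs) [] = (\<lambda>x. 1)" by (rule ext) simp
    then show ?thesis by (simp only: Nil bounded_polys_const)
  next
    case l: (Cons c l')
    have q: "q \<in> bounded_polys b n a" and c: "c \<le> M" using Cons.prems l by auto
    have "(\<lambda>x. q x ^ c) \<in> bounded_polys b n (M * a)"
      by (rule bounded_polys_mono[OF bounded_polys_power[OF q]]) (use c in simp)
    moreover have "power_product qs l' \<in> bounded_polys b n (length qs * (M * a))" using Cons l by simp
    ultimately have "(\<lambda>x. q x ^ c * power_product qs l' x) \<in> bounded_polys b n (M * a + length qs * (M * a))"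
      by (rule bounded_polys_mult)
    moreover have "power_product (q # qs) l = (\<lambda>x. q x ^ c * power_product qs l' x)" by (rule ext) (simp add: l)
    ultimately show ?thesis by simp
  qed
qed

text \<open>A chain of length \<open>k\<close> provides \<open>(M + 1) ^ k\<close> monomials that
  are independent on its last member, hence on \<open>C\<close>, while their degrees are linear in
  \<open>M\<close>. They lie in a space whose dimension grows at most like
  \<open>M ^ s\<close>.\<close>

lemma chain_length_le:
  fixes C :: "(real^'n::finite) set" and V :: "nat \<Rightarrow> (real^'n) set"
  assumes C: "irreducible_variety C" and b: "b ` {..<n} = (UNIV :: 'n set)"
    and V: "\<And>i. i \<le> k \<Longrightarrow> irreducible_variety (V i)" "\<And>i. i < k \<Longrightarrow> V i \<subset> V (Suc i)" "V k \<subseteq> C"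
    and span: "\<And>N. spanned_by C (bounded_polys b n N) (K * (N + 1) ^ s)"
  shows "k \<le> s"
proof (rule ccontr)
  assume "\<not> k \<le> s"
  then have ks: "Suc s \<le> k" by simp
  obtain qs where qs: "list_all real_polynomial_function qs" "length qs = k"
    and indep: "\<And>M c l. vanishes_on (\<lambda>x. \<Sum>l\<in>exponents k M. c l * power_product qs l x) (V k) \<Longrightarrow>
        l \<in> exponents k M \<Longrightarrow> c l = 0" using chain_independent[of k V, OF V(1,2)] by blast
  have "\<exists>N. \<forall>q\<in>set qs. q \<in> bounded_polys b n N"
    using qs(1)
  proof (induction qs)
    case (Cons q qs)
    then obtain N where N: "\<And>q. q \<in> set qs \<Longrightarrow> q \<in> bounded_polys b n N" by auto
    obtain N' where N': "q \<in> bounded_polys b n N'" using polynomial_imp_bounded_polys[OF b] Cons.prems by auto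
    show ?case
    proof (intro exI ballI)
      fix p assume "p \<in> set (q # qs)"
      then show "p \<in> bounded_polys b n (max N N')" using N N' bounded_polys_mono by (metis max.cobounded1 max.cobounded2 set_ConsD)
    qed
  qed simp
  then obtain a where a: "list_all (\<lambda>q. q \<in> bounded_polys b n a) qs" by (auto simp: list_all_iff)
  have bound: "(M + 1) ^ k \<le> K * (k * (M * a) + 1) ^ s" for M
  proof (rule ccontr)
    let ?m = "K * (k * (M * a) + 1) ^ s"
    assume "\<not> (M + 1) ^ k \<le> ?m"
    then have less: "?m < card (exponents k M)" by (simp add: card_exponents)
    obtain A g where A: "nonvanishing_poly C A"
      and g: "\<And>q. q \<in> bounded_polys b n (k * (M * a)) \<Longrightarrow> \<exists>u. \<forall>x\<in>C. A x * q x = (\<Sum>j<?m. u j * g j x)"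
      using span[of "k * (M * a)"] unfolding spanned_by_def by blast
    have mem: "power_product qs l \<in> bounded_polys b n (k * (M * a))" if "l \<in> exponents k M" for l
      using power_product_bounded[OF a, of l M] that qs(2) by (simp add: exponents_def)
    have "\<exists>u. \<forall>x\<in>C. l \<in> exponents k M \<longrightarrow> A x * power_product qs l x = (\<Sum>j<?m. u j * g j x)" for l
      using g[OF mem[of l]] by (cases "l \<in> exponents k M") auto
    then obtain u where u: "\<And>l x. x \<in> C \<Longrightarrow> l \<in> exponents k M \<Longrightarrow>
        A x * power_product qs l x = (\<Sum>j<?m. u l j * g j x)" by metis
    \<comment> \<open>More monomials than spanning functions give a nontrivial combination that
      vanishes on \<open>C\<close> after multiplication by \<open>A\<close>; primality then removes
      \<open>A\<close>.\<close>
    obtain c where c: "\<exists>l\<in>exponents k M. c l \<noteq> 0" "\<And>j. j < ?m \<Longrightarrow> (\<Sum>l\<in>exponents k M. c l * u l j) = 0"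
      using linear_dependence[OF finite_exponents less, of u] by blast
    let ?f = "\<lambda>x. \<Sum>l\<in>exponents k M. c l * power_product qs l x"
    have "vanishes_on (\<lambda>x. A x * ?f x) C"
      unfolding vanishes_on_def
    proof
      fix x assume x: "x \<in> C"
      have "A x * ?f x = (\<Sum>l\<in>exponents k M. c l * (A x * power_product qs l x))"
        by (simp add: sum_distrib_left mult_ac)
      also have "\<dots> = (\<Sum>l\<in>exponents k M. \<Sum>j<?m. c l * u l j * g j x)"
        using u[OF x] by (intro sum.cong refl) (simp only: sum_distrib_left mult.assoc)
      also have "\<dots> = (\<Sum>j<?m. (\<Sum>l\<in>exponents k M. c l * u l j) * g j x)"
        by (subst sum.swap) (simp only: sum_distrib_right)
      also have "\<dots> = 0" using c(2) by simp
      finally show "A x * ?f x = 0" .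
    qed
    moreover have "real_polynomial_function ?f"
      by (intro real_polynomial_function_sum finite_exponents real_polynomial_function.intros(2,4)
          real_polynomial_function_power_product qs(1))
    ultimately have "vanishes_on ?f C"
      using irreducible_variety_mult[OF C, of A ?f] A unfolding nonvanishing_poly_def by blast
    then have "vanishes_on ?f (V k)" using V(3) by (auto simp: vanishes_on_def)
    then show False using indep c(1) by blast
  qed
  \<comment> \<open>Chosen so that for \<open>M = c\<close> the upper bound becomes at most
    \<open>c * (c + 1) ^ s\<close>, which is less than \<open>(c + 1) ^ Suc s\<close>.\<close>
  define c where "c = K * (k * a + 1) ^ s"
  have "(c + 1) ^ Suc s \<le> (c + 1) ^ k" using ks by (intro power_increasing) auto
  also have "\<dots> \<le> K * (k * (c * a) + 1) ^ s" by (rule bound)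
  also have "\<dots> \<le> K * ((k * a + 1) * (c + 1)) ^ s"
    by (intro mult_le_mono order_refl power_mono) (simp_all add: algebra_simps)
  also have "\<dots> = c * (c + 1) ^ s" by (simp only: c_def power_mult_distrib mult.assoc)
  finally show False by simp
qed

text \<open>The ideal of \<open>C\<close>, localized at itself, needs no more generators than the
  codimension of \<open>C\<close>. The remaining \<open>n - e\<close> coordinates are those that
  raised the growth exponent.\<close>

theorem variety_dim_le:
  fixes C :: "(real^'n::finite) set"
  assumes C: "irreducible_variety C"
  shows "\<exists>e \<Psi>. e \<le> CARD('n) \<and> variety_dim C \<le> enat (CARD('n) - e) \<and>
    (\<forall>j<e. real_polynomial_function (\<Psi> j) \<and> vanishes_on (\<Psi> j) C) \<and>
    (\<forall>q. real_polynomial_function q \<longrightarrow> vanishes_on q C \<longrightarrow> locally_generated C e \<Psi> q)"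
proof -
  obtain b where "bij_betw b {..<CARD('n)} (UNIV :: 'n set)"
    using ex_bij_betw_nat_finite[of "UNIV :: 'n set"] by (auto simp: atLeast0LessThan)
  then have b: "b ` {..<CARD('n)} = (UNIV :: 'n set)" by (simp add: bij_betw_def)
  obtain e \<Psi> K where e: "e \<le> CARD('n)"
    and \<Psi>: "\<forall>j<e. real_polynomial_function (\<Psi> j) \<and> vanishes_on (\<Psi> j) C"
    and gen: "\<And>N q. q \<in> bounded_polys b CARD('n) N \<Longrightarrow> vanishes_on q C \<Longrightarrow> locally_generated C e \<Psi> q"
    and span: "\<And>N. spanned_by C (bounded_polys b CARD('n) N) (K * (N + 1) ^ (CARD('n) - e))"
    using generic_generators[OF C, of "CARD('n)" b] by blast
  have "variety_dim C \<le> enat (CARD('n) - e)"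
    unfolding variety_dim_def
  proof (rule SUP_least)
    fix k assume "k \<in> {k. \<exists>V :: nat \<Rightarrow> (real^'n) set.
        (\<forall>i\<le>k. irreducible_variety (V i) \<and> V i \<subseteq> C) \<and> (\<forall>i<k. V i \<subset> V (Suc i))}"
    then obtain V :: "nat \<Rightarrow> (real^'n) set" where
      V: "\<And>i. i \<le> k \<Longrightarrow> irreducible_variety (V i)" "\<And>i. i < k \<Longrightarrow> V i \<subset> V (Suc i)" "V k \<subseteq> C" by blast
    show "enat k \<le> enat (CARD('n) - e)" using chain_length_le[OF C b V span] by simp
  qed
  moreover have "locally_generated C e \<Psi> q" if "real_polynomial_function q" "vanishes_on q C" for q
    using polynomial_imp_bounded_polys[OF b that(1)] gen that(2) by blast
  ultimately show ?thesis using e \<Psi> by blast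
qed

section \<open>Gradients at the points of an irreducible variety\<close>

definition grad :: "(real^'n::finite \<Rightarrow> real) \<Rightarrow> real^'n \<Rightarrow> real^'n" where
  "grad f x = (\<chi> i. frechet_derivative f (at x) (axis i 1))"

lemma grad_eqI:
  fixes f :: "real^'n::finite \<Rightarrow> real"
  assumes "(f has_derivative (\<lambda>v. g \<bullet> v)) (at x)" shows "grad f x = g"
proof -
  have "frechet_derivative f (at x) = (\<lambda>v. g \<bullet> v)" using frechet_derivative_at[OF assms] by simp
  then show ?thesis by (simp add: grad_def vec_eq_iff inner_axis)
qed

lemma has_derivative_grad:
  fixes f :: "real^'n::finite \<Rightarrow> real"
  assumes "f differentiable at x" shows "(f has_derivative (\<lambda>v. grad f x \<bullet> v)) (at x)"
proof -
  let ?D = "frechet_derivative f (at x)"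
  have D: "(f has_derivative ?D) (at x)" using assms by (simp add: frechet_derivative_works)
  then have lin: "linear ?D" by (rule has_derivative_linear)
  have "?D v = grad f x \<bullet> v" for v
  proof -
    have "?D v = ?D (\<Sum>i\<in>UNIV. v $ i *\<^sub>R axis i 1)"
      by (metis (mono_tags, lifting) basis_expansion scalar_mult_eq_scaleR sum.cong)
    also have "\<dots> = (\<Sum>i\<in>UNIV. v $ i *\<^sub>R ?D (axis i 1))"
      by (simp only: linear_sum[OF lin] linear_scale[OF lin])
    finally show ?thesis by (simp add: grad_def inner_vec_def mult.commute)
  qed
  then have "?D = (\<lambda>v. grad f x \<bullet> v)" by (rule ext)
  with D show ?thesis by simp
qed

lemma has_derivative_polynomial:
  fixes f :: "real^'n::finite \<Rightarrow> real"
  assumes "real_polynomial_function f" shows "(f has_derivative (\<lambda>v. grad f x \<bullet> v)) (at x)"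
  by (rule has_derivative_grad[OF differentiable_at_real_polynomial_function[OF assms]])

lemma grad_add:
  assumes "real_polynomial_function f" "real_polynomial_function g"
  shows "grad (\<lambda>x. f x + g x) x = grad f x + grad g x"
proof (rule grad_eqI)
  show "((\<lambda>x. f x + g x) has_derivative (\<lambda>v. (grad f x + grad g x) \<bullet> v)) (at x)"
    unfolding inner_add_left by (intro has_derivative_add has_derivative_polynomial assms)
qed

lemma grad_mult:
  assumes "real_polynomial_function f" "real_polynomial_function g"
  shows "grad (\<lambda>x. f x * g x) x = f x *\<^sub>R grad g x + g x *\<^sub>R grad f x"
proof (rule grad_eqI)
  have "((\<lambda>x. f x * g x) has_derivative (\<lambda>v. f x * (grad g x \<bullet> v) + (grad f x \<bullet> v) * g x)) (at x)"
    by (intro has_derivative_mult has_derivative_polynomial assms)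
  then show "((\<lambda>x. f x * g x) has_derivative (\<lambda>v. (f x *\<^sub>R grad g x + g x *\<^sub>R grad f x) \<bullet> v)) (at x)"
    by (simp only: inner_add_left inner_scaleR_left mult.commute[of _ "g x"])
qed

lemma grad_const: "grad (\<lambda>x. c) x = 0"
  by (rule grad_eqI) simp

lemma grad_linear:
  assumes "bounded_linear f" shows "grad f x = (\<chi> i. f (axis i 1))"
  using frechet_derivative_at[OF bounded_linear_imp_has_derivative[OF assms, of "at x"]] by (simp add: grad_def)

lemma grad_inner: "grad (\<lambda>x. a \<bullet> x) x = a"
  by (rule grad_eqI) (intro bounded_linear_imp_has_derivative bounded_linear_inner_right)

lemma grad_sum:
  assumes "finite I" "\<And>i. i \<in> I \<Longrightarrow> real_polynomial_function (f i)"
  shows "grad (\<lambda>x. \<Sum>i\<in>I. f i x) x = (\<Sum>i\<in>I. grad (f i) x)"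
  using assms
proof (induction I rule: finite_induct)
  case (insert i I)
  then have "grad (\<lambda>x. f i x + (\<Sum>i\<in>I. f i x)) x = grad (f i) x + grad (\<lambda>x. \<Sum>i\<in>I. f i x) x"
    by (intro grad_add real_polynomial_function_sum) auto
  with insert show ?case by simp
qed (simp add: grad_const)

lemma real_polynomial_function_grad:
  assumes "real_polynomial_function f" shows "real_polynomial_function (\<lambda>x. grad f x $ i)"
  using assms
proof induction
  case (linear f)
  then show ?case by (simp only: grad_linear vec_lambda_beta real_polynomial_function.intros(2))
next
  case (const c)
  then show ?case by (simp only: grad_const zero_index real_polynomial_function.intros(2))
next
  case (add f g)
  then show ?case
    by (simp only: grad_add vector_add_component) (intro real_polynomial_function.intros(3))
next
  case (mult f g)
  then show ?case
    by (simp only: grad_mult vector_add_component vector_scaleR_component real_scaleR_def)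
      (intro real_polynomial_function.intros(3,4))
qed

text \<open>In the gradient of \<open>A x * q x = (\<Sum>j<e. B j x * \<Psi> j x)\<close> at a point
  of \<open>C\<close>, all terms with an undifferentiated \<open>q\<close> or
  \<open>\<Psi> j\<close> vanish; then one divides by \<open>A z\<close>.\<close>

lemma grad_locally_generated:
  fixes C :: "(real^'n::finite) set" and e :: nat
  assumes q: "real_polynomial_function q" "vanishes_on q C"
    and \<Psi>: "\<And>j. j < e \<Longrightarrow> real_polynomial_function (\<Psi> j) \<and> vanishes_on (\<Psi> j) C"
    and A: "real_polynomial_function A" and B: "\<And>j. real_polynomial_function (B j)"
    and eq: "\<And>x. A x * q x = (\<Sum>j<e. B j x * \<Psi> j x)"
    and z: "z \<in> C" "A z \<noteq> 0"
  shows "grad q z \<in> span ((\<lambda>j. grad (\<Psi> j) z) ` {..<e})"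
proof -
  have "grad (\<lambda>x. A x * q x) z = A z *\<^sub>R grad q z"
    using vanishes_onD[OF q(2) z(1)] by (simp add: grad_mult[OF A q(1)])
  moreover have "grad (\<lambda>x. \<Sum>j<e. B j x * \<Psi> j x) z = (\<Sum>j<e. B j z *\<^sub>R grad (\<Psi> j) z)"
  proof -
    have "grad (\<lambda>x. \<Sum>j<e. B j x * \<Psi> j x) z = (\<Sum>j<e. grad (\<lambda>x. B j x * \<Psi> j x) z)"
      by (rule grad_sum[OF finite_lessThan]) (use B \<Psi> in \<open>auto intro: real_polynomial_function.intros(4)\<close>)
    also have "\<dots> = (\<Sum>j<e. B j z *\<^sub>R grad (\<Psi> j) z)"
    proof (rule sum.cong[OF refl])
      fix j assume "j \<in> {..<e}"
      then have "real_polynomial_function (\<Psi> j)" "\<Psi> j z = 0"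
        using \<Psi>[of j] z(1) by (auto simp: vanishes_on_def)
      then show "grad (\<lambda>x. B j x * \<Psi> j x) z = B j z *\<^sub>R grad (\<Psi> j) z" by (simp add: grad_mult[OF B])
    qed
    finally show ?thesis .
  qed
  ultimately have "A z *\<^sub>R grad q z = (\<Sum>j<e. B j z *\<^sub>R grad (\<Psi> j) z)" by (simp only: eq)
  then have "grad q z = (1 / A z) *\<^sub>R (\<Sum>j<e. B j z *\<^sub>R grad (\<Psi> j) z)"
    using z(2) by (metis divide_self_if scaleR_scaleR scaleR_one times_divide_eq_left mult_1)
  moreover have "(1 / A z) *\<^sub>R (\<Sum>j<e. B j z *\<^sub>R grad (\<Psi> j) z) \<in> span ((\<lambda>j. grad (\<Psi> j) z) ` {..<e})"
    by (intro span_scale span_sum) (auto intro: span_base)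
  ultimately show ?thesis by simp
qed

lemma real_polynomial_function_det:
  assumes "\<And>i j. real_polynomial_function (\<lambda>x. M x $ i $ j)"
  shows "real_polynomial_function (\<lambda>x. det (M x))"
  unfolding det_def
  by (intro real_polynomial_function_sum real_polynomial_function_prod real_polynomial_function.intros(4)
      real_polynomial_function.intros(2) finite_permutations assms) auto

text \<open>Completing to a square matrix turns independence into a nonzero determinant, hence into
  a polynomial condition once the rows are gradients.\<close>

lemma extend_independent_to_matrix:
  fixes S :: "(real^'n::finite) set"
  assumes "independent S"
  obtains \<beta> where "inj \<beta>" "S \<subseteq> range \<beta>" "det (\<chi> i. \<beta> i) \<noteq> 0"
proof -
  obtain B where B: "S \<subseteq> B" "independent B" "UNIV \<subseteq> span B"
    using maximal_independent_subset_extend[of S UNIV] assms by auto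
  have "card B = CARD('n)"
    using basis_card_eq_dim[of B "UNIV :: (real^'n) set"] B by simp
  moreover have "finite B" using B(2) independent_imp_finite by blast
  ultimately obtain \<beta> :: "'n \<Rightarrow> real^'n" where \<beta>: "bij_betw \<beta> UNIV B"
    using finite_same_card_bij[of "UNIV :: 'n set" B] by auto
  have "rows (\<chi> i. \<beta> i) = B"
    using \<beta> by (auto simp: rows_def row_def bij_betw_def image_iff)
  then have "span (rows (\<chi> i. \<beta> i)) = UNIV" using B(3) by auto
  then have "det (\<chi> i. \<beta> i) \<noteq> 0"
    using matrix_left_invertible_span_rows[of "\<chi> i. \<beta> i"] invertible_left_inverse[of "\<chi> i. \<beta> i"]
      invertible_det_nz by blast
  with \<beta> B(1) show ?thesis by (intro that[of \<beta>]) (auto simp: bij_betw_def)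
qed

lemma det_nonzero_independent:
  fixes f :: "'n::finite \<Rightarrow> real^'n"
  assumes "det (\<chi> i. f i) \<noteq> 0"
  shows "inj f" "independent (range f)"
proof -
  have row: "row i (\<chi> i. f i) = f i" for i by (simp add: row_def vec_eq_iff)
  show "inj f"
    using det_identical_rows[of _ _ "\<chi> i. f i"] assms unfolding row inj_def by blast
  have "rows (\<chi> i. f i) = range f" by (auto simp: rows_def row)
  then show "independent (range f)"
    using det_dependent_rows[of "\<chi> i. f i"] assms unfolding dependent_vec_eq by auto
qed

lemma nonvanishing_poly_prod:
  assumes "irreducible_variety C" "finite I" "\<And>i. i \<in> I \<Longrightarrow> nonvanishing_poly C (A i)"
  shows "nonvanishing_poly C (\<lambda>x. \<Prod>i\<in>I. A i x)"
  using assms(2,3)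
  by (induction I rule: finite_induct)
    (simp_all add: nonvanishing_poly_1 nonvanishing_poly_mult assms(1))

text \<open>The orthogonal complement of the Zariski tangent space of \<open>C\<close> at
  \<open>z\<close>.\<close>

definition normal_vectors :: "(real^'n::finite) set \<Rightarrow> real^'n \<Rightarrow> (real^'n) set" where
  "normal_vectors C z = {grad q z | q. real_polynomial_function q \<and> vanishes_on q C}"

text \<open>The rows added to complete the matrix are realized by the linear functions
  \<open>\<beta> i \<bullet> x\<close>, so that all rows are gradients of polynomials. The functions
  \<open>Q\<close> are at the same time the future local coordinates.\<close>

lemma extend_normal_vectors:
  fixes C :: "(real^'n::finite) set"
  assumes S: "S \<subseteq> normal_vectors C z" "independent S"
  obtains K Q where "\<And>i. real_polynomial_function (Q i)" "\<And>i. i \<in> K \<Longrightarrow> vanishes_on (Q i) C"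
    "det (\<chi> i. grad (Q i) z) \<noteq> 0" "card K = card S"
proof -
  obtain \<beta> where \<beta>: "inj \<beta>" "S \<subseteq> range \<beta>" "det (\<chi> i. \<beta> i) \<noteq> 0"
    using extend_independent_to_matrix[OF S(2)] .
  define K where "K = {i. \<beta> i \<in> S}"
  have "\<exists>q. real_polynomial_function q \<and> grad q z = \<beta> i \<and> (i \<in> K \<longrightarrow> vanishes_on q C)" for i
  proof (cases "i \<in> K")
    case True
    then have "\<beta> i \<in> normal_vectors C z" using S(1) by (auto simp: K_def)
    then obtain q where "\<beta> i = grad q z" "real_polynomial_function q" "vanishes_on q C"
      unfolding normal_vectors_def by blast
    then show ?thesis by metis
  next
    case False
    then show ?thesis
      by (intro exI[of _ "\<lambda>x. \<beta> i \<bullet> x"] conjI grad_inner real_polynomial_function.intros(1)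
          bounded_linear_inner_right) auto
  qed
  then obtain Q where Q: "\<And>i. real_polynomial_function (Q i)" "\<And>i. grad (Q i) z = \<beta> i"
    "\<And>i. i \<in> K \<Longrightarrow> vanishes_on (Q i) C" by metis
  have "\<beta> ` K = S" using \<beta>(2) by (auto simp: K_def)
  then have "card K = card S" using \<beta>(1) by (metis card_image inj_on_subset subset_UNIV)
  moreover have "det (\<chi> i. grad (Q i) z) \<noteq> 0" using \<beta>(3) by (simp add: Q(2))
  ultimately show ?thesis by (intro that[of Q K] Q)
qed

text \<open>Linear independence of gradients at \<open>z\<close> persists at a generic point of \<open>C\<close>, where all of them
  are combinations of the gradients of the \<open>\<Psi>\<close>.\<close>

theorem independent_normal_vectors:
  fixes C :: "(real^'n::finite) set"
  assumes C: "irreducible_variety C" and d: "variety_dim C = enat d"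
    and z: "z \<in> C" and S: "S \<subseteq> normal_vectors C z" "independent S"
  shows "card S + d \<le> CARD('n)"
proof -
  obtain e \<Psi> where e: "e \<le> CARD('n)" "variety_dim C \<le> enat (CARD('n) - e)"
    and \<Psi>: "\<And>j. j < e \<Longrightarrow> real_polynomial_function (\<Psi> j) \<and> vanishes_on (\<Psi> j) C"
    and gen: "\<And>q. real_polynomial_function q \<Longrightarrow> vanishes_on q C \<Longrightarrow> locally_generated C e \<Psi> q"
    using variety_dim_le[OF C] by blast
  obtain K Q where Q: "\<And>i. real_polynomial_function (Q i)" "\<And>i. i \<in> K \<Longrightarrow> vanishes_on (Q i) C"
    and det: "det (\<chi> i. grad (Q i) z) \<noteq> 0" and K: "card K = card S"
    using extend_normal_vectors[OF S] by metis
  define \<delta> where "\<delta> x = det (\<chi> i. grad (Q i) x)" for x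
  have \<delta>poly: "real_polynomial_function \<delta>"
    unfolding \<delta>_def by (rule real_polynomial_function_det) (simp add: real_polynomial_function_grad Q(1))
  have "\<delta> z \<noteq> 0" using det by (simp add: \<delta>_def)
  then have \<delta>: "nonvanishing_poly C \<delta>" using \<delta>poly z by (auto simp: nonvanishing_poly_def vanishes_on_def)
  define rel where "rel i A B \<longleftrightarrow> nonvanishing_poly C A \<and> (\<forall>j. real_polynomial_function (B j)) \<and>
      (\<forall>x. A x * Q i x = (\<Sum>j<e. B j x * \<Psi> j x))" for i A B
  have "\<exists>A B. rel i A B" if "i \<in> K" for i
    using gen[OF Q(1) Q(2)[OF that]] unfolding locally_generated_def rel_def .
  then obtain A B where "\<And>i. i \<in> K \<Longrightarrow> rel i (A i) (B i)" by metis
  then have A: "\<And>i. i \<in> K \<Longrightarrow> nonvanishing_poly C (A i)"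
    and B: "\<And>i j. i \<in> K \<Longrightarrow> real_polynomial_function (B i j)"
    and AB: "\<And>i x. i \<in> K \<Longrightarrow> A i x * Q i x = (\<Sum>j<e. B i j x * \<Psi> j x)"
    unfolding rel_def by blast+
  \<comment> \<open>By irreducibility one point \<open>w\<close> of \<open>C\<close> avoids the
    zeros of the determinant and of all the denominators \<open>A i\<close> simultaneously.\<close>
  have "nonvanishing_poly C (\<lambda>x. \<delta> x * (\<Prod>i\<in>K. A i x))"
    by (intro nonvanishing_poly_mult nonvanishing_poly_prod C \<delta> A) simp
  then obtain w where w: "w \<in> C" "\<delta> w * (\<Prod>i\<in>K. A i w) \<noteq> 0"
    by (auto simp: nonvanishing_poly_def vanishes_on_def)
  then have \<delta>w: "\<delta> w \<noteq> 0" and Aw: "\<And>i. i \<in> K \<Longrightarrow> A i w \<noteq> 0" by auto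
  note rows = det_nonzero_independent[OF \<delta>w[unfolded \<delta>_def]]
  have "independent ((\<lambda>i. grad (Q i) w) ` K)"
    by (rule independent_mono[OF rows(2)]) blast
  moreover have "(\<lambda>i. grad (Q i) w) ` K \<subseteq> span ((\<lambda>j. grad (\<Psi> j) w) ` {..<e})"
  proof
    fix u assume "u \<in> (\<lambda>i. grad (Q i) w) ` K"
    then obtain i where i: "i \<in> K" "u = grad (Q i) w" by blast
    have "grad (Q i) w \<in> span ((\<lambda>j. grad (\<Psi> j) w) ` {..<e})"
    proof (rule grad_locally_generated[where C = C and A = "A i" and B = "B i"])
      show "real_polynomial_function (A i)" using A[OF i(1)] by (simp add: nonvanishing_poly_def)
    qed (use Q i \<Psi> B AB w Aw in auto)
    then show "u \<in> span ((\<lambda>j. grad (\<Psi> j) w) ` {..<e})" using i by simp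
  qed
  ultimately have "card ((\<lambda>i. grad (Q i) w) ` K) \<le> card ((\<lambda>j. grad (\<Psi> j) w) ` {..<e})"
    using independent_span_bound[of "(\<lambda>j. grad (\<Psi> j) w) ` {..<e}"] by blast
  also have "\<dots> \<le> e" using card_image_le[of "{..<e}" "\<lambda>j. grad (\<Psi> j) w"] by simp
  also have "card ((\<lambda>i. grad (Q i) w) ` K) = card K"
    using rows(1) by (intro card_image) (auto intro: inj_on_subset)
  also note K
  finally show ?thesis using e d by simp
qed

text \<open>Gronwall's argument: the sum of squares \<open>F\<close> satisfies
  \<open>F' \<le> c * F\<close> and starts at zero, so \<open>F t * exp (- c * t)\<close> cannot
  increase.\<close>

lemma linear_ode_zero:
  fixes f :: "'m::finite \<Rightarrow> real \<Rightarrow> real"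
  assumes der: "\<And>t j. t \<in> {0..1} \<Longrightarrow> (f j has_real_derivative (\<Sum>i\<in>UNIV. a j i t * f i t)) (at t)"
    and cont: "\<And>j i. continuous_on {0..1} (a j i)" and init: "\<And>j. f j 0 = 0"
  shows "f j 1 = 0"
proof -
  have "\<exists>B. \<forall>t\<in>{0..1}. \<bar>a j i t\<bar> \<le> B" for j i
    using compact_imp_bounded[OF compact_continuous_image[OF cont[of j i] compact_Icc]]
    unfolding bounded_iff by auto
  then obtain B where B: "\<And>j i t. t \<in> {0..1} \<Longrightarrow> \<bar>a j i t\<bar> \<le> B j i" by metis
  define L where "L = Max (range (\<lambda>(j, i). B j i))"
  have L: "\<bar>a j i t\<bar> \<le> L" if "t \<in> {0..1}" for j i t
  proof -
    have "B j i \<le> L" unfolding L_def by (rule Max_ge) (auto intro: rev_image_eqI[of "(j, i)"])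
    with B[OF that, of j i] show ?thesis by linarith
  qed
  define F where "F t = (\<Sum>j\<in>UNIV. (f j t)\<^sup>2)" for t
  \<comment> \<open>Each product of \<open>f j\<close> and \<open>f i\<close> is bounded by
    \<open>L\<close> times the sum of the two squares, and every square then occurs
    \<open>2 * CARD('m)\<close> times in the double sum.\<close>
  define c where "c = 2 * L * real CARD('m)"
  define F' where "F' t = (\<Sum>j\<in>UNIV. 2 * f j t * (\<Sum>i\<in>UNIV. a j i t * f i t))" for t
  have dF: "(F has_real_derivative F' t) (at t)" if "t \<in> {0..1}" for t
    unfolding F_def F'_def
    by (rule DERIV_sum) (auto intro!: derivative_eq_intros der[OF that])
  have bound: "F' t \<le> c * F t" if t: "t \<in> {0..1}" for t
  proof -
    have "2 * f j t * (a j i t * f i t) \<le> L * (f j t)\<^sup>2 + L * (f i t)\<^sup>2" for j i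
    proof -
      have "2 * f j t * (a j i t * f i t) \<le> \<bar>a j i t\<bar> * (2 * \<bar>f j t\<bar> * \<bar>f i t\<bar>)"
        by (rule order_trans[OF abs_ge_self]) (simp add: abs_mult mult_ac)
      also have "\<dots> \<le> L * (2 * \<bar>f j t\<bar> * \<bar>f i t\<bar>)" by (intro mult_right_mono L[OF t]) simp
      also have "\<dots> \<le> L * ((f j t)\<^sup>2 + (f i t)\<^sup>2)"
      proof (rule mult_left_mono)
        show "2 * \<bar>f j t\<bar> * \<bar>f i t\<bar> \<le> (f j t)\<^sup>2 + (f i t)\<^sup>2"
          using sum_squares_bound[of "\<bar>f j t\<bar>" "\<bar>f i t\<bar>"] by simp
        show "0 \<le> L" using L[OF t, of j i] by linarith
      qed
      finally show ?thesis by (simp add: distrib_left)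
    qed
    then have "F' t \<le> (\<Sum>j\<in>(UNIV::'m set). \<Sum>i\<in>(UNIV::'m set). L * (f j t)\<^sup>2 + L * (f i t)\<^sup>2)"
      unfolding F'_def sum_distrib_left by (intro sum_mono)
    also have "\<dots> = c * F t"
      by (simp add: sum.distrib sum_distrib_left[symmetric] c_def F_def)
    finally show ?thesis .
  qed
  define H where "H t = F t * exp (- c * t)" for t
  have "H 1 \<le> H 0"
  proof (rule DERIV_nonpos_imp_nonincreasing[where f = H and a = 0 and b = 1])
    fix t :: real assume "0 \<le> t" "t \<le> 1"
    then have t: "t \<in> {0..1}" by simp
    have "(H has_real_derivative (F' t - c * F t) * exp (- c * t)) (at t)"
      unfolding H_def by (auto intro!: derivative_eq_intros dF[OF t] simp: algebra_simps)
    moreover have "(F' t - c * F t) * exp (- c * t) \<le> 0"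
      using bound[OF t] by (intro mult_nonpos_nonneg) auto
    ultimately show "\<exists>y. DERIV H t :> y \<and> y \<le> 0" by blast
  qed simp
  then have "F 1 \<le> 0" by (simp add: H_def F_def init mult_le_0_iff)
  moreover have "0 \<le> F 1" unfolding F_def by (intro sum_nonneg) simp
  ultimately have "F 1 = 0" by (rule antisym)
  then show ?thesis by (simp add: F_def sum_nonneg_eq_0_iff)
qed

section \<open>Uniform second order estimates for polynomials\<close>

definition second_order_bound :: "real^'n::finite \<Rightarrow> real \<Rightarrow> (real^'n \<Rightarrow> real) \<Rightarrow> real \<Rightarrow> bool" where
  "second_order_bound y r f c \<longleftrightarrow> 0 \<le> c \<and> (\<forall>a\<in>cball y r. \<forall>b\<in>cball y r. \<bar>f a\<bar> \<le> c \<and>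
    \<bar>f b - f a\<bar> \<le> c * norm (b - a) \<and> \<bar>f b - f a - grad f a \<bullet> (b - a)\<bar> \<le> c * (norm (b - a))\<^sup>2)"

text \<open>An induction on the construction of the polynomial. The three estimates are proved
  together because the second order error of a product involves the size and the increments of its
  factors.\<close>

lemma polynomial_second_order:
  fixes f :: "real^'n::finite \<Rightarrow> real"
  assumes "real_polynomial_function f"
  shows "\<exists>c. second_order_bound y r f c"
  using assms
proof induction
  case (linear f)
  then obtain k where k: "k > 0" "\<And>x. \<bar>f x\<bar> \<le> norm x * k"
    using bounded_linear.pos_bounded by (metis real_norm_def)
  have diff: "f b - f a = f (b - a)" for a b using linear by (simp add: linear_simps)
  have grad: "grad f a \<bullet> v = f v" for a v
  proof -
    have "(f has_derivative (\<lambda>v. grad f a \<bullet> v)) (at a)"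
      by (intro has_derivative_polynomial real_polynomial_function.intros(1) linear)
    moreover have "(f has_derivative f) (at a)" by (rule bounded_linear_imp_has_derivative[OF linear])
    ultimately have "(\<lambda>v. grad f a \<bullet> v) = f" by (rule has_derivative_unique)
    then show ?thesis by (rule fun_cong)
  qed
  define c where "c = k * (1 + norm y + \<bar>r\<bar>)"
  have kc: "k \<le> c" "c \<ge> 0" using k by (simp_all add: c_def algebra_simps)
  have "\<bar>f a\<bar> \<le> c" if "a \<in> cball y r" for a
  proof -
    have "norm a \<le> norm y + \<bar>r\<bar>" using that norm_triangle_ineq4[of y "y - a"] by (simp add: dist_norm)
    then have "norm a * k \<le> (1 + norm y + \<bar>r\<bar>) * k" using k by (intro mult_right_mono) auto
    with k(2)[of a] show ?thesis by (simp add: c_def mult.commute)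
  qed
  moreover have "\<bar>f b - f a\<bar> \<le> c * norm (b - a)" for a b
  proof -
    have "\<bar>f b - f a\<bar> \<le> k * norm (b - a)" using k(2)[of "b - a"] by (simp only: diff mult.commute)
    also have "\<dots> \<le> c * norm (b - a)" by (intro mult_right_mono kc) simp
    finally show ?thesis .
  qed
  ultimately show ?case using kc(2) by (intro exI[of _ c]) (simp add: second_order_bound_def grad diff)
next
  case (const k)
  show ?case by (intro exI[of _ "\<bar>k\<bar>"]) (simp add: second_order_bound_def grad_const)
next
  case (add f g)
  then obtain c d where bounds: "second_order_bound y r f c" "second_order_bound y r g d" by blast
  then have c: "c \<ge> 0" "\<And>a b. a \<in> cball y r \<Longrightarrow> b \<in> cball y r \<Longrightarrow> \<bar>f a\<bar> \<le> c \<and> \<bar>f b - f a\<bar> \<le> c * norm (b - a) \<and>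
      \<bar>f b - f a - grad f a \<bullet> (b - a)\<bar> \<le> c * (norm (b - a))\<^sup>2"
    and d: "d \<ge> 0" "\<And>a b. a \<in> cball y r \<Longrightarrow> b \<in> cball y r \<Longrightarrow> \<bar>g a\<bar> \<le> d \<and> \<bar>g b - g a\<bar> \<le> d * norm (b - a) \<and>
      \<bar>g b - g a - grad g a \<bullet> (b - a)\<bar> \<le> d * (norm (b - a))\<^sup>2"
    by (simp_all only: second_order_bound_def)
  show ?case
    unfolding second_order_bound_def
  proof (intro exI[of _ "c + d"] conjI ballI)
    fix a b assume ab: "a \<in> cball y r" "b \<in> cball y r"
    note ineq = c(2)[OF ab] d(2)[OF ab]
    show "\<bar>f a + g a\<bar> \<le> c + d" using ineq by linarith
    show "\<bar>f b + g b - (f a + g a)\<bar> \<le> (c + d) * norm (b - a)"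
      unfolding distrib_right using ineq by linarith
    show "\<bar>f b + g b - (f a + g a) - grad (\<lambda>x. f x + g x) a \<bullet> (b - a)\<bar> \<le> (c + d) * (norm (b - a))\<^sup>2"
      unfolding distrib_right grad_add[OF add.hyps] inner_add_left using ineq by linarith
  qed (use c d in simp)
next
  case (mult f g)
  then obtain c d where bounds: "second_order_bound y r f c" "second_order_bound y r g d" by blast
  then have c: "c \<ge> 0" "\<And>a b. a \<in> cball y r \<Longrightarrow> b \<in> cball y r \<Longrightarrow> \<bar>f a\<bar> \<le> c \<and> \<bar>f b - f a\<bar> \<le> c * norm (b - a) \<and>
      \<bar>f b - f a - grad f a \<bullet> (b - a)\<bar> \<le> c * (norm (b - a))\<^sup>2"
    and d: "d \<ge> 0" "\<And>a b. a \<in> cball y r \<Longrightarrow> b \<in> cball y r \<Longrightarrow> \<bar>g a\<bar> \<le> d \<and> \<bar>g b - g a\<bar> \<le> d * norm (b - a) \<and>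
      \<bar>g b - g a - grad g a \<bullet> (b - a)\<bar> \<le> d * (norm (b - a))\<^sup>2"
    by (simp_all only: second_order_bound_def)
  show ?case
    unfolding second_order_bound_def
  proof (intro exI[of _ "3 * (c * d)"] conjI ballI)
    show "0 \<le> 3 * (c * d)" using c(1) d(1) by simp
    fix a b assume ab: "a \<in> cball y r" "b \<in> cball y r"
    define N where "N = norm (b - a)"
    have N: "N \<ge> 0" by (simp add: N_def)
    have f: "\<bar>f a\<bar> \<le> c" "\<bar>f b\<bar> \<le> c" "\<bar>f b - f a\<bar> \<le> c * N" "\<bar>f b - f a - grad f a \<bullet> (b - a)\<bar> \<le> c * N\<^sup>2"
      using c(2)[OF ab] c(2)[OF ab(2) ab(1)] by (simp_all add: N_def)
    have g: "\<bar>g a\<bar> \<le> d" "\<bar>g b\<bar> \<le> d" "\<bar>g b - g a\<bar> \<le> d * N" "\<bar>g b - g a - grad g a \<bullet> (b - a)\<bar> \<le> d * N\<^sup>2"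
      using d(2)[OF ab] d(2)[OF ab(2) ab(1)] by (simp_all add: N_def)
    have prod: "\<bar>u * v\<bar> \<le> s * t" if "\<bar>u\<bar> \<le> s" "\<bar>v\<bar> \<le> t" for u v s t :: real
      unfolding abs_mult using that by (intro mult_mono) auto
    have cd: "0 \<le> c * d" "0 \<le> c * d * N" using c(1) d(1) N by simp_all
    show "\<bar>f a * g a\<bar> \<le> 3 * (c * d)" using prod[OF f(1) g(1)] cd by linarith
    have "f b * g b - f a * g a = f b * (g b - g a) + g a * (f b - f a)" by (simp add: algebra_simps)
    moreover have "\<bar>f b * (g b - g a)\<bar> \<le> c * d * N" "\<bar>g a * (f b - f a)\<bar> \<le> c * d * N"
      using prod[OF f(2) g(3)] prod[OF g(1) f(3)] by (simp_all add: mult_ac)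
    ultimately have "\<bar>f b * g b - f a * g a\<bar> \<le> 3 * (c * d * N)" using cd by linarith
    then show "\<bar>f b * g b - f a * g a\<bar> \<le> 3 * (c * d) * norm (b - a)" by (simp add: N_def mult.assoc)
    \<comment> \<open>The error of the product consists of the two errors of the factors and the
      product of the increments; these three terms explain the constant
      \<open>3 * (c * d)\<close>.\<close>
    have "f b * g b - f a * g a - (f a *\<^sub>R grad g a + g a *\<^sub>R grad f a) \<bullet> (b - a) =
        f a * (g b - g a - grad g a \<bullet> (b - a)) + g a * (f b - f a - grad f a \<bullet> (b - a)) + (f b - f a) * (g b - g a)"
      by (simp add: algebra_simps inner_add_left)
    moreover have "\<bar>f a * (g b - g a - grad g a \<bullet> (b - a))\<bar> \<le> c * d * N\<^sup>2"
      "\<bar>g a * (f b - f a - grad f a \<bullet> (b - a))\<bar> \<le> c * d * N\<^sup>2" "\<bar>(f b - f a) * (g b - g a)\<bar> \<le> c * d * N\<^sup>2"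
      using prod[OF f(1) g(4)] prod[OF g(1) f(4)] prod[OF f(3) g(3)] by (simp_all add: mult_ac power2_eq_square)
    ultimately have "\<bar>f b * g b - f a * g a - (f a *\<^sub>R grad g a + g a *\<^sub>R grad f a) \<bullet> (b - a)\<bar> \<le> 3 * (c * d * N\<^sup>2)"
      by linarith
    then show "\<bar>f b * g b - f a * g a - grad (\<lambda>x. f x * g x) a \<bullet> (b - a)\<bar> \<le> 3 * (c * d) * (norm (b - a))\<^sup>2"
      unfolding grad_mult[OF mult.hyps] by (simp add: N_def mult.assoc)
  qed
qed

section \<open>Local charts at smooth points\<close>

lemma generator_vanishes_on:
  fixes p :: "'m::finite \<Rightarrow> 'a::euclidean_space \<Rightarrow> real"
  assumes "generates_vanishing_ideal p C" shows "vanishes_on (p j) C"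
proof -
  have "p j \<in> {q. \<exists>r. (\<forall>i. real_polynomial_function (r i)) \<and> q = (\<lambda>x. \<Sum>i\<in>UNIV. r i x * p i x)}"
  proof (intro CollectI exI conjI allI)
    show "real_polynomial_function (\<lambda>x::'a. if i = j then 1 else 0 :: real)" for i
      by (rule real_polynomial_function.intros(2))
    show "p j = (\<lambda>x. \<Sum>i\<in>UNIV. (if i = j then 1 else 0) * p i x)"
    proof
      fix x
      have "(\<Sum>i\<in>UNIV. (if i = j then 1 else 0) * p i x) = (\<Sum>i\<in>UNIV. if i = j then p i x else 0)"
        by (intro sum.cong) auto
      then show "p j x = (\<Sum>i\<in>UNIV. (if i = j then 1 else 0) * p i x)" by simp
    qed
  qed
  then show ?thesis using assms unfolding generates_vanishing_ideal_def vanishes_on_def by blast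
qed

text \<open>Near \<open>y\<close> the functions \<open>Q i\<close> form a chart in which \<open>C\<close> is the coordinate subspace where the
  coordinates in \<open>K\<close> vanish.\<close>

locale local_equations =
  fixes C :: "(real^'n::finite) set" and y :: "real^'n" and K :: "'n set" and Q :: "'n \<Rightarrow> real^'n \<Rightarrow> real"
    and p :: "'m::finite \<Rightarrow> real^'n \<Rightarrow> real"
  assumes variety: "real_variety C" and generators: "generates_vanishing_ideal p C"
    and y: "y \<in> C"
    and Q: "\<And>i. real_polynomial_function (Q i)"
    and van: "\<And>i. i \<in> K \<Longrightarrow> vanishes_on (Q i) C"
    and det_y: "det (\<chi> i. grad (Q i) y) \<noteq> 0"
    and tangent: "\<And>z q. z \<in> C \<Longrightarrow> det (\<chi> i. grad (Q i) z) \<noteq> 0 \<Longrightarrow> real_polynomial_function q \<Longrightarrow>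
      vanishes_on q C \<Longrightarrow> grad q z \<in> span ((\<lambda>i. grad (Q i) z) ` K)"
begin

definition "\<Phi> x = (\<chi> i. Q i x)"

definition "M x = (\<chi> i. grad (Q i) x)"

lemma M_component: "(M x *v v) $ i = grad (Q i) x \<bullet> v"
  by (simp add: M_def matrix_vector_mul_component)

lemma \<Phi>_derivative: "(\<Phi> has_derivative (*v) (M x)) (at x)"
  unfolding has_derivative_componentwise_within[of \<Phi>]
  by (auto simp: Basis_vec_def inner_axis M_component \<Phi>_def intro: has_derivative_polynomial Q)

lemma polynomial_det_M: "real_polynomial_function (\<lambda>x. det (M x))"
  by (rule real_polynomial_function_det) (simp add: M_def real_polynomial_function_grad Q)

lemma M_injective: "det (M x) \<noteq> 0 \<Longrightarrow> M x *v u = M x *v v \<Longrightarrow> u = v"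
  using cramer[of "M x" u "M x *v v"] cramer[of "M x" v "M x *v v"] by simp

text \<open>The inverse function theorem for \<open>\<Phi>\<close>, whose derivative is given by
  \<open>M\<close>. The image is cut down to a ball because segments between its points must stay
  inside the chart.\<close>

lemma chart:
  obtains g g' r where "r > 0"
    "open (g ` ball (\<Phi> y) r)" "y \<in> g ` ball (\<Phi> y) r"
    "\<And>x. x \<in> g ` ball (\<Phi> y) r \<Longrightarrow> \<Phi> x \<in> ball (\<Phi> y) r \<and> g (\<Phi> x) = x"
    "\<And>w. w \<in> ball (\<Phi> y) r \<Longrightarrow> \<Phi> (g w) = w \<and> det (M (g w)) \<noteq> 0"
    "\<And>w. w \<in> ball (\<Phi> y) r \<Longrightarrow> (g has_derivative g' w) (at w)"
    "\<And>w v. w \<in> ball (\<Phi> y) r \<Longrightarrow> M (g w) *v g' w v = v"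
proof -
  define U where "U = {x. det (M x) \<noteq> 0}"
  define f' where "f' x = Blinfun ((*v) (M x))" for x
  have f': "blinfun_apply (f' x) = (*v) (M x)" for x
    unfolding f'_def by (rule bounded_linear_Blinfun_apply) simp
  have "open U"
    unfolding U_def
    by (intro open_Collect_neq continuous_at_imp_continuous_on ballI continuous_const
        continuous_real_polymonial_function polynomial_det_M)
  moreover have "(\<Phi> has_derivative blinfun_apply (f' x)) (at x)" for x
    unfolding f' by (rule \<Phi>_derivative)
  moreover have "continuous_on U f'"
  proof (intro continuous_at_imp_continuous_on ballI continuous_blinfun_componentwiseI1)
    fix x and i :: "real^'n" assume "i \<in> Basis"
    show "isCont (\<lambda>x. blinfun_apply (f' x) i) x"
    proof -
      have "real_polynomial_function (\<lambda>x. grad (Q k) x \<bullet> i)" for k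
        unfolding inner_vec_def
        by (intro real_polynomial_function_sum finite)
          (simp, intro real_polynomial_function.intros(2,4) real_polynomial_function_grad Q)
      then have "((\<lambda>x. grad (Q k) x \<bullet> i) \<longlongrightarrow> grad (Q k) x \<bullet> i) (at x)" for k
        using continuous_real_polymonial_function[of "\<lambda>x. grad (Q k) x \<bullet> i" x] by (simp add: isCont_def)
      then have "((\<lambda>x. \<chi> k. grad (Q k) x \<bullet> i) \<longlongrightarrow> (\<chi> k. grad (Q k) x \<bullet> i)) (at x)"
        by (rule tendsto_vec_lambda)
      moreover have "M x *v i = (\<chi> k. grad (Q k) x \<bullet> i)" for x by (simp add: vec_eq_iff M_component)
      ultimately show ?thesis by (simp only: isCont_def f')
    qed
  qed
  moreover have "y \<in> U" using det_y by (simp add: U_def M_def)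
  moreover obtain B where "B ** M y = mat 1"
    using det_y invertible_det_nz[of "M y"] by (auto simp: M_def invertible_def)
  then have "Blinfun ((*v) B) o\<^sub>L f' y = id_blinfun"
    by (intro blinfun_eqI) (simp add: bounded_linear_Blinfun_apply f' matrix_vector_mul_assoc)
  ultimately have "\<exists>U' V g g'. open U' \<and> U' \<subseteq> U \<and> y \<in> U' \<and> open V \<and> \<Phi> y \<in> V \<and> homeomorphism U' V \<Phi> g \<and>
    (\<forall>w\<in>V. (g has_derivative (g' w)) (at w)) \<and> (\<forall>w\<in>V. g' w = inv (blinfun_apply (f' (g w)))) \<and>
    (\<forall>w\<in>V. bij (blinfun_apply (f' (g w))))"
    by (rule inverse_function_theorem) (intro exI conjI ballI; assumption | simp)
  then obtain U' V g g' where IFT: "open U'" "U' \<subseteq> U" "y \<in> U'" "open V" "\<Phi> y \<in> V" "homeomorphism U' V \<Phi> g"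
    "\<And>w. w \<in> V \<Longrightarrow> (g has_derivative (g' w)) (at w)"
    "\<And>w. w \<in> V \<Longrightarrow> g' w = inv (blinfun_apply (f' (g w)))"
    "\<And>w. w \<in> V \<Longrightarrow> bij (blinfun_apply (f' (g w)))"
    by (elim exE conjE) (rule that, assumption+, (erule (1) bspec)+)
  obtain r where r: "r > 0" "ball (\<Phi> y) r \<subseteq> V" using IFT(4,5) open_contains_ball by blast
  have hom: "\<And>x. x \<in> U' \<Longrightarrow> \<Phi> x \<in> V \<and> g (\<Phi> x) = x" "\<And>w. w \<in> V \<Longrightarrow> g w \<in> U' \<and> \<Phi> (g w) = w"
    using IFT(6) unfolding homeomorphism_def by blast+
  have img: "g ` ball (\<Phi> y) r = U' \<inter> \<Phi> -` ball (\<Phi> y) r"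
    using hom r(2) by (auto simp del: mem_ball intro: rev_image_eqI) 
  have "continuous_on U' \<Phi>"
    by (intro continuous_at_imp_continuous_on ballI has_derivative_continuous[OF \<Phi>_derivative])
  then have "open (U' \<inter> \<Phi> -` ball (\<Phi> y) r)"
    using IFT(1) by (intro continuous_open_preimage) auto
  with r IFT hom show ?thesis
  proof (intro that[of r g g'])
    show "M (g w) *v g' w v = v" if "w \<in> ball (\<Phi> y) r" for w v
    proof -
      have "w \<in> V" using that r(2) by blast
      then have "g' w = inv ((*v) (M (g w)))" "surj ((*v) (M (g w)))"
        using IFT(8)[of w] IFT(9)[of w] by (auto simp: f' bij_def)
      then show ?thesis by (simp add: surj_f_inv_f)
    qed
    show "\<Phi> (g w) = w \<and> det (M (g w)) \<noteq> 0" if "w \<in> ball (\<Phi> y) r" for w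
    proof -
      have "w \<in> V" using that r(2) by blast
      then have "g w \<in> U" "\<Phi> (g w) = w" using hom(2)[of w] IFT(2) by blast+
      then show ?thesis by (simp add: U_def)
    qed
    show "(g has_derivative g' w) (at w)" if "w \<in> ball (\<Phi> y) r" for w
      using that r(2) IFT(7) by blast
    show "y \<in> g ` ball (\<Phi> y) r" unfolding img using IFT(3) r(1) by simp
    show "\<Phi> x \<in> ball (\<Phi> y) r \<and> g (\<Phi> x) = x" if "x \<in> g ` ball (\<Phi> y) r" for x
      using that hom(1)[of x] unfolding img by blast
    show "open (g ` ball (\<Phi> y) r)" if "open (U' \<inter> \<Phi> -` ball (\<Phi> y) r)" using that unfolding img .
  qed
qed

lemma vanishing_ideal: "{q. real_polynomial_function q \<and> (\<forall>x\<in>C. q x = 0)} =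
    {q. \<exists>r. (\<forall>i. real_polynomial_function (r i)) \<and> q = (\<lambda>x. \<Sum>i\<in>UNIV. r i x * p i x)}"
  using generators by (simp add: generates_vanishing_ideal_def)

lemma generator_polynomial: "real_polynomial_function (p j)"
  using generators by (simp add: generates_vanishing_ideal_def)

lemma generator_vanishes: "vanishes_on (p j) C"
  by (rule generator_vanishes_on[OF generators])

text \<open>The polynomial vector field \<open>det M \<cdot> M\<inverse> v\<close> maps the vanishing ideal of \<open>C\<close> into itself after
  multiplication by one more factor \<open>det M\<close>, so its flow preserves \<open>C\<close>.\<close>

lemma derivation_in_ideal:
  assumes v: "\<And>i. i \<in> K \<Longrightarrow> v $ i = 0"
  obtains a where "\<And>j i. real_polynomial_function (a j i)"
    "\<And>x u j. M x *v u = v \<Longrightarrow> (det (M x))\<^sup>2 * (grad (p j) x \<bullet> u) = (\<Sum>i\<in>UNIV. a j i x * p i x)"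
proof -
  \<comment> \<open>The numerators of Cramer's rule: a polynomial vector field equal to
    \<open>det (M x)\<close> times the solution of \<open>M x *v u = v\<close> wherever the
    determinant is nonzero.\<close>
  define X where "X x = (\<chi> k. det (\<chi> i j. if j = k then v $ i else M x $ i $ j))" for x
  have X_poly: "real_polynomial_function (\<lambda>x. X x $ k)" for k
    unfolding X_def vec_lambda_beta
  proof (rule real_polynomial_function_det)
    fix i j
    show "real_polynomial_function (\<lambda>x. (\<chi> i j. if j = k then v $ i else M x $ i $ j) $ i $ j)"
      by (cases "j = k") (simp_all add: M_def real_polynomial_function_grad Q real_polynomial_function.intros(2))
  qed
  have X_det: "det (M x) *\<^sub>R u = X x" if "M x *v u = v" "det (M x) \<noteq> 0" for x u
    using that cramer[of "M x" u v] by (simp add: X_def vec_eq_iff)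
  \<comment> \<open>The additional factor \<open>det (M x)\<close> makes \<open>D j\<close> vanish
    also at those points of \<open>C\<close> where the determinant is zero and
    \<open>tangent\<close> says nothing. Elsewhere on \<open>C\<close>, \<open>grad (p j)\<close> is
    a combination of the gradients indexed by \<open>K\<close>, all orthogonal to the solution
    \<open>u\<close>.\<close>
  define D where "D j x = det (M x) * (grad (p j) x \<bullet> X x)" for j x
  have "real_polynomial_function (D j)" for j
    unfolding D_def inner_vec_def
    by (intro real_polynomial_function.intros(4) polynomial_det_M real_polynomial_function_sum finite)
      (simp, intro real_polynomial_function.intros(4) real_polynomial_function_grad generator_polynomial X_poly)
  moreover have "D j z = 0" if z: "z \<in> C" for j z
  proof (cases "det (M z) = 0")
    case False
    then obtain u where u: "M z *v u = v" using cramer[OF False, of _ v] by blast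
    have "x \<bullet> u = 0" if "x \<in> span ((\<lambda>i. grad (Q i) z) ` K)" for x
      using that
    proof (induction rule: span_induct_alt)
      case (step c x y)
      then obtain i where "i \<in> K" "x = grad (Q i) z" by blast
      then have "x \<bullet> u = 0" using v M_component[of z u i] u by simp
      with step show ?case by (simp add: inner_add_left)
    qed simp
    then have "grad (p j) z \<bullet> u = 0"
      using tangent[OF z _ generator_polynomial generator_vanishes] False unfolding M_def by blast
    then have "grad (p j) z \<bullet> X z = 0" using X_det[OF u False] by (metis inner_scaleR_right mult_zero_right)
    then show ?thesis by (simp add: D_def)
  qed (simp add: D_def)
  ultimately have "D j \<in> {q. \<exists>r. (\<forall>i. real_polynomial_function (r i)) \<and> q = (\<lambda>x. \<Sum>i\<in>UNIV. r i x * p i x)}" for j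
    unfolding vanishing_ideal[symmetric] by blast
  then have "\<exists>r. (\<forall>i. real_polynomial_function (r i)) \<and> D j = (\<lambda>x. \<Sum>i\<in>UNIV. r i x * p i x)" for j by blast
  then obtain a where a: "\<And>j i. real_polynomial_function (a j i)" "\<And>j. D j = (\<lambda>x. \<Sum>i\<in>UNIV. a j i x * p i x)" by metis
  show ?thesis
  proof (rule that[of a])
    fix x u j assume u: "M x *v u = v"
    show "(det (M x))\<^sup>2 * (grad (p j) x \<bullet> u) = (\<Sum>i\<in>UNIV. a j i x * p i x)"
    proof -
      have "(det (M x))\<^sup>2 * (grad (p j) x \<bullet> u) = D j x"
      proof (cases "det (M x) = 0")
        case False
        then show ?thesis unfolding D_def X_det[OF u False, symmetric] by (simp add: power2_eq_square)
      qed (simp add: D_def)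
      then show ?thesis by (simp only: a(2))
    qed
  qed (rule a(1))
qed

end

context local_equations
begin

text \<open>Any polynomial from a system defining \<open>C\<close> lies in the vanishing ideal and
  is therefore a combination of the generators.\<close>

lemma variety_eq: "C = {x. \<forall>j. p j x = 0}"
proof (intro equalityI subsetI)
  fix x assume x: "x \<in> {x. \<forall>j. p j x = 0}"
  obtain P where P: "\<And>q. q \<in> P \<Longrightarrow> real_polynomial_function q" "C = {x. \<forall>q\<in>P. q x = 0}"
    using variety unfolding real_variety_def by blast
  have "q x = 0" if q: "q \<in> P" for q
  proof -
    have "q \<in> {q. real_polynomial_function q \<and> (\<forall>x\<in>C. q x = 0)}" using P q by blast
    then obtain r where "q = (\<lambda>x. \<Sum>i\<in>UNIV. r i x * p i x)" unfolding vanishing_ideal by blast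
    then show ?thesis using x by simp
  qed
  then show "x \<in> C" using P(2) by blast
next
  fix x assume x: "x \<in> C"
  then show "x \<in> {x. \<forall>j. p j x = 0}" using generator_vanishes by (auto simp: vanishes_on_def)
qed

lemma closed_C: "closed C"
  unfolding variety_eq
  by (intro closed_Collect_all closed_Collect_eq continuous_at_imp_continuous_on ballI continuous_const
      continuous_real_polymonial_function generator_polynomial)

definition is_chart :: "(real^'n \<Rightarrow> real^'n) \<Rightarrow> (real^'n \<Rightarrow> real^'n \<Rightarrow> real^'n) \<Rightarrow> real \<Rightarrow> bool" where
  "is_chart g g' r \<longleftrightarrow> r > 0 \<and> open (g ` ball (\<Phi> y) r) \<and> y \<in> g ` ball (\<Phi> y) r \<and>
    (\<forall>x\<in>g ` ball (\<Phi> y) r. \<Phi> x \<in> ball (\<Phi> y) r \<and> g (\<Phi> x) = x) \<and>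
    (\<forall>w\<in>ball (\<Phi> y) r. \<Phi> (g w) = w \<and> det (M (g w)) \<noteq> 0 \<and> (g has_derivative g' w) (at w) \<and>
      (\<forall>v. M (g w) *v g' w v = v))"

lemma is_chartD:
  assumes "is_chart g g' r" "w \<in> ball (\<Phi> y) r"
  shows "\<Phi> (g w) = w" "det (M (g w)) \<noteq> 0" "(g has_derivative g' w) (at w)" "M (g w) *v g' w v = v"
  using assms unfolding is_chart_def by blast+

lemma \<Phi>_K: "x \<in> C \<Longrightarrow> i \<in> K \<Longrightarrow> \<Phi> x $ i = 0"
  using van by (simp add: \<Phi>_def vanishes_on_def)

lemma chart_curve:
  assumes g: "is_chart g g' r" and t: "a + t *\<^sub>R v \<in> ball (\<Phi> y) r"
  shows "((\<lambda>t. g (a + t *\<^sub>R v)) has_derivative (\<lambda>h. h *\<^sub>R g' (a + t *\<^sub>R v) v)) (at t)"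
proof -
  note dg = is_chartD(3)[OF g t]
  have "((\<lambda>t. a + t *\<^sub>R v) has_derivative (\<lambda>h. h *\<^sub>R v)) (at t)"
    by (auto intro!: derivative_eq_intros)
  from diff_chain_at[OF this dg]
  show ?thesis using linear_scale[OF has_derivative_linear[OF dg]] by (simp add: o_def)
qed

text \<open>Along the curve that the chart assigns to the segment from \<open>\<Phi> y\<close> to
  \<open>w\<close>, the values of the generators solve a homogeneous linear differential system, by
  \<open>derivation_in_ideal\<close>. They vanish at the start, hence also at the end.\<close>

lemma chart_in_variety:
  assumes g: "is_chart g g' r" and w: "w \<in> ball (\<Phi> y) r" "\<And>i. i \<in> K \<Longrightarrow> w $ i = 0"
  shows "g w \<in> C"
proof -
  define v where "v = w - \<Phi> y"
  have "v $ i = 0" if "i \<in> K" for i using w(2)[OF that] \<Phi>_K[OF y that] by (simp add: v_def)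
  then obtain a where a: "\<And>j i. real_polynomial_function (a j i)"
    "\<And>x u j. M x *v u = v \<Longrightarrow> (det (M x))\<^sup>2 * (grad (p j) x \<bullet> u) = (\<Sum>i\<in>UNIV. a j i x * p i x)"
    using derivation_in_ideal by blast
  have ball: "\<Phi> y + t *\<^sub>R v \<in> ball (\<Phi> y) r" if "t \<in> {0..1}" for t
  proof -
    have "dist (\<Phi> y) (\<Phi> y + t *\<^sub>R v) = t * norm v" using that by (simp add: dist_norm)
    also have "\<dots> \<le> 1 * norm v" using that by (intro mult_right_mono) auto
    also have "\<dots> < r" using w(1) by (simp add: v_def dist_norm norm_minus_commute)
    finally show ?thesis by simp
  qed
  define \<gamma> where "\<gamma> t = g (\<Phi> y + t *\<^sub>R v)" for t
  define b where "b j i t = a j i (\<gamma> t) / (det (M (\<gamma> t)))\<^sup>2" for j i t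
  have d\<gamma>: "(\<gamma> has_derivative (\<lambda>h. h *\<^sub>R g' (\<Phi> y + t *\<^sub>R v) v)) (at t)" if "t \<in> {0..1}" for t
    unfolding \<gamma>_def by (rule chart_curve[OF g ball[OF that]])
  have det: "det (M (\<gamma> t)) \<noteq> 0" if "t \<in> {0..1}" for t
    unfolding \<gamma>_def by (rule is_chartD(2)[OF g ball[OF that]])
  have "p j (\<gamma> 1) = 0" for j
  proof (rule linear_ode_zero[where f = "\<lambda>j t. p j (\<gamma> t)" and a = b])
    fix t :: real and j assume t: "t \<in> {0..1}"
    let ?u = "g' (\<Phi> y + t *\<^sub>R v) v"
    have u: "M (\<gamma> t) *v ?u = v" unfolding \<gamma>_def by (rule is_chartD(4)[OF g ball[OF t]])
    have "((\<lambda>t. p j (\<gamma> t)) has_derivative (\<lambda>h. grad (p j) (\<gamma> t) \<bullet> (h *\<^sub>R ?u))) (at t)"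
      using diff_chain_at[OF d\<gamma>[OF t] has_derivative_polynomial[OF generator_polynomial]] by (simp add: o_def)
    then have "((\<lambda>t. p j (\<gamma> t)) has_real_derivative grad (p j) (\<gamma> t) \<bullet> ?u) (at t)"
      unfolding has_field_derivative_def by (simp add: mult_commute_abs)
    moreover have "grad (p j) (\<gamma> t) \<bullet> ?u = (\<Sum>i\<in>UNIV. b j i t * p i (\<gamma> t))"
      using a(2)[OF u, of j] det[OF t]
      by (simp add: b_def sum_divide_distrib[symmetric] eq_divide_eq mult.commute)
    ultimately show "((\<lambda>t. p j (\<gamma> t)) has_real_derivative (\<Sum>i\<in>UNIV. b j i t * p i (\<gamma> t))) (at t)" by simp
  next
    fix j i
    have cont: "continuous_on {0..1} (\<lambda>t. f (\<gamma> t))" if "real_polynomial_function f" for f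
    proof (intro continuous_at_imp_continuous_on ballI)
      fix t :: real assume t: "t \<in> {0..1}"
      show "isCont (\<lambda>t. f (\<gamma> t)) t"
        by (rule isCont_o2[OF has_derivative_continuous[OF d\<gamma>[OF t]] continuous_real_polymonial_function[OF that]])
    qed
    show "continuous_on {0..1} (b j i)"
      unfolding b_def
      by (intro continuous_on_divide continuous_on_power cont a(1) polynomial_det_M ballI) (simp add: det)
  next
    have "g (\<Phi> y) = y" using g unfolding is_chart_def by blast
    then show "p j (\<gamma> 0) = 0" for j using y variety_eq by (auto simp: \<gamma>_def)
  qed
  then have "\<gamma> 1 \<in> C" by (subst variety_eq) simp
  then show ?thesis by (simp add: \<gamma>_def v_def)
qed

text \<open>The chart maps a segment in direction \<open>w\<close> to a curve in \<open>C\<close>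
  through \<open>z\<close> with velocity \<open>g' (\<Phi> z) w\<close>; the squared distance to
  \<open>x\<close> along it has a local minimum at \<open>z\<close>.\<close>

lemma best_approximation_normal:
  assumes g: "is_chart g g' r" and z: "z \<in> g ` ball (\<Phi> y) r" and best: "best_approximation C x z"
    and w: "\<And>i. i \<in> K \<Longrightarrow> w $ i = 0"
  shows "(x - z) \<bullet> g' (\<Phi> z) w = 0"
proof -
  have zC: "z \<in> C" using best by (simp add: best_approximation_def)
  have z': "\<Phi> z \<in> ball (\<Phi> y) r" "g (\<Phi> z) = z" using g z unfolding is_chart_def by blast+
  define \<gamma> where "\<gamma> t = g (\<Phi> z + t *\<^sub>R w)" for t
  obtain e where e: "e > 0" "ball (\<Phi> z) e \<subseteq> ball (\<Phi> y) r"
    using z'(1) open_ball open_contains_ball by blast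
  have d\<gamma>: "(\<gamma> has_derivative (\<lambda>h. h *\<^sub>R g' (\<Phi> z) w)) (at 0)"
    using chart_curve[OF g, of "\<Phi> z" 0 w] z'(1) unfolding \<gamma>_def by simp
  have dx: "((\<lambda>t. x - \<gamma> t) has_derivative (\<lambda>h. - (h *\<^sub>R g' (\<Phi> z) w))) (at 0)"
    using has_derivative_diff[OF has_derivative_const[of x] d\<gamma>] by simp
  have "((\<lambda>t. (x - \<gamma> t) \<bullet> (x - \<gamma> t)) has_derivative
      (\<lambda>h. (x - \<gamma> 0) \<bullet> (- (h *\<^sub>R g' (\<Phi> z) w)) + (- (h *\<^sub>R g' (\<Phi> z) w)) \<bullet> (x - \<gamma> 0))) (at 0)"
    by (rule has_derivative_inner[OF dx dx])
  moreover have "(\<lambda>h. (x - \<gamma> 0) \<bullet> (- (h *\<^sub>R g' (\<Phi> z) w)) + (- (h *\<^sub>R g' (\<Phi> z) w)) \<bullet> (x - \<gamma> 0)) =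
      (*) (- 2 * ((x - z) \<bullet> g' (\<Phi> z) w))"
    by (rule ext) (simp add: \<gamma>_def z'(2) inner_commute)
  ultimately have "((\<lambda>t. (x - \<gamma> t) \<bullet> (x - \<gamma> t)) has_real_derivative (- 2 * ((x - z) \<bullet> g' (\<Phi> z) w))) (at 0)"
    by (simp add: has_field_derivative_def)
  \<comment> \<open>Adding \<open>1\<close> covers the case \<open>w = 0\<close>.\<close>
  moreover have "0 < e / (norm w + 1)" using e(1) by (simp add: add_nonneg_pos)
  moreover have "\<forall>t. \<bar>0 - t\<bar> < e / (norm w + 1) \<longrightarrow> (x - \<gamma> 0) \<bullet> (x - \<gamma> 0) \<le> (x - \<gamma> t) \<bullet> (x - \<gamma> t)"
  proof (intro allI impI)
    fix t :: real assume t: "\<bar>0 - t\<bar> < e / (norm w + 1)"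
    have "norm w + 1 > 0" by (simp add: add_nonneg_pos)
    with t have "\<bar>t\<bar> * (norm w + 1) < e" by (simp add: pos_less_divide_eq)
    then have "\<bar>t\<bar> * norm w < e" by (simp add: distrib_left)
    then have "\<Phi> z + t *\<^sub>R w \<in> ball (\<Phi> y) r" using e(2) by (auto simp: dist_norm subset_iff)
    moreover have "(\<Phi> z + t *\<^sub>R w) $ i = 0" if "i \<in> K" for i using w[OF that] \<Phi>_K[OF zC that] by simp
    ultimately have "\<gamma> t \<in> C" unfolding \<gamma>_def by (rule chart_in_variety[OF g])
    then have "norm (x - z) \<le> norm (x - \<gamma> t)" using best by (simp add: best_approximation_def)
    then show "(x - \<gamma> 0) \<bullet> (x - \<gamma> 0) \<le> (x - \<gamma> t) \<bullet> (x - \<gamma> t)"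
      by (simp add: norm_le \<gamma>_def z'(2))
  qed
  ultimately have "- 2 * ((x - z) \<bullet> g' (\<Phi> z) w) = 0" by (rule DERIV_local_min)
  then show ?thesis by simp
qed

text \<open>Injectivity of \<open>M y\<close> gives a lower bound at \<open>y\<close>; by continuity
  of the gradients, moving to a nearby \<open>z\<close> costs at most half of it.\<close>

lemma M_bounded_below:
  obtains B e where "B > 0" "e > 0" "\<And>z h. z \<in> ball y e \<Longrightarrow> B * norm h \<le> norm (M z *v h)"
proof -
  have "inj ((*v) (M y))" using M_injective[of y] det_y unfolding M_def inj_def by blast
  then obtain B where B: "B > 0" "\<And>h. B * norm h \<le> norm (M y *v h)"
    using linear_inj_bounded_below_pos[OF matrix_vector_mul_linear] by blast
  define s where "s z = (\<Sum>i\<in>UNIV. norm (grad (Q i) z - grad (Q i) y))" for z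
  have "isCont (grad (Q i)) y" for i
  proof -
    have "((\<lambda>x. grad (Q i) x $ k) \<longlongrightarrow> grad (Q i) y $ k) (at y)" for k
      using continuous_real_polymonial_function[OF real_polynomial_function_grad[OF Q], of y i k] by (simp add: isCont_def)
    then show ?thesis unfolding isCont_def by (rule vec_tendstoI)
  qed
  then have "isCont s y" unfolding s_def by (intro continuous_intros)
  then obtain e where e: "e > 0" "\<And>z. dist z y < e \<Longrightarrow> dist (s z) (s y) < B / 2"
    unfolding continuous_at_eps_delta using B(1) half_gt_zero by metis
  have "B / 2 * norm h \<le> norm (M z *v h)" if "z \<in> ball y e" for z h
  proof -
    have "norm (M z *v h - M y *v h) \<le> (\<Sum>i\<in>UNIV. \<bar>(M z *v h - M y *v h) $ i\<bar>)" by (rule norm_le_l1_cart)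
    also have "\<dots> \<le> (\<Sum>i\<in>UNIV. norm (grad (Q i) z - grad (Q i) y) * norm h)"
      by (rule sum_mono) (simp only: vector_minus_component M_component inner_diff_left[symmetric] Cauchy_Schwarz_ineq2)
    also have "\<dots> = s z * norm h" by (simp add: s_def sum_distrib_right)
    also have "\<dots> \<le> B / 2 * norm h"
    proof (rule mult_right_mono)
      have "s y = 0" by (simp add: s_def)
      then show "s z \<le> B / 2" using e(2)[of z] that by (simp add: dist_commute dist_real_def)
    qed simp
    finally have "norm (M z *v h - M y *v h) \<le> B / 2 * norm h" .
    moreover have "norm (M y *v h) \<le> norm (M z *v h) + norm (M z *v h - M y *v h)"
      using norm_triangle_ineq4[of "M z *v h" "M z *v h - M y *v h"] by simp
    ultimately show ?thesis using B(2)[of h] by linarith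
  qed
  with B(1) e(1) show ?thesis by (intro that[of "B / 2" e]) auto
qed

lemma \<Phi>_second_order:
  obtains c where "c \<ge> 0" "\<And>a b. a \<in> cball y 1 \<Longrightarrow> b \<in> cball y 1 \<Longrightarrow>
    norm (\<Phi> b - \<Phi> a - M a *v (b - a)) \<le> c * (norm (b - a))\<^sup>2"
proof -
  have "\<exists>c. second_order_bound y 1 (Q i) c" for i by (rule polynomial_second_order[OF Q])
  then obtain c where c: "\<And>i. second_order_bound y 1 (Q i) (c i)" by metis
  show ?thesis
  proof (rule that[of "\<Sum>i\<in>UNIV. c i"])
    show "0 \<le> (\<Sum>i\<in>UNIV. c i)" using c by (intro sum_nonneg) (simp add: second_order_bound_def)
    fix a b assume ab: "a \<in> cball y 1" "b \<in> cball y 1"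
    have "norm (\<Phi> b - \<Phi> a - M a *v (b - a)) \<le> (\<Sum>i\<in>UNIV. \<bar>(\<Phi> b - \<Phi> a - M a *v (b - a)) $ i\<bar>)"
      by (rule norm_le_l1_cart)
    also have "\<dots> \<le> (\<Sum>i\<in>UNIV. c i * (norm (b - a))\<^sup>2)"
    proof (rule sum_mono)
      fix i
      have "\<bar>Q i b - Q i a - grad (Q i) a \<bullet> (b - a)\<bar> \<le> c i * (norm (b - a))\<^sup>2"
        using c[of i] ab unfolding second_order_bound_def by blast
      then show "\<bar>(\<Phi> b - \<Phi> a - M a *v (b - a)) $ i\<bar> \<le> c i * (norm (b - a))\<^sup>2"
        by (simp add: M_component \<Phi>_def)
    qed
    finally show "norm (\<Phi> b - \<Phi> a - M a *v (b - a)) \<le> (\<Sum>i\<in>UNIV. c i) * (norm (b - a))\<^sup>2"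
      by (simp add: sum_distrib_right)
  qed
qed

text \<open>If \<open>z\<close> and \<open>z'\<close> are both nearest to \<open>x\<close>, then \<open>\<bar>z' - z\<bar>\<^sup>2 = 2 (x - z) \<bullet> (z' - z)\<close>. As \<open>x - z\<close> is normal to
  \<open>C\<close> at \<open>z\<close>, the right-hand side is at most a small multiple of \<open>\<bar>z' - z\<bar>\<^sup>2\<close>.\<close>

theorem unique_best_approximation_near:
  "\<exists>e>0. \<forall>x\<in>ball y e. \<exists>!z. best_approximation C x z"
proof -
  obtain g g' r where g: "is_chart g g' r"
    using chart unfolding is_chart_def by metis
  obtain e1 where e1: "e1 > 0" "ball y e1 \<subseteq> g ` ball (\<Phi> y) r"
    using g open_contains_ball unfolding is_chart_def by metis
  obtain B e2 where B: "B > 0" "e2 > 0" "\<And>z h. z \<in> ball y e2 \<Longrightarrow> B * norm h \<le> norm (M z *v h)"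
    using M_bounded_below by metis
  obtain c where c: "c \<ge> 0" "\<And>a b. a \<in> cball y 1 \<Longrightarrow> b \<in> cball y 1 \<Longrightarrow>
      norm (\<Phi> b - \<Phi> a - M a *v (b - a)) \<le> c * (norm (b - a))\<^sup>2"
    using \<Phi>_second_order by metis
  \<comment> \<open>A point nearest to some \<open>x\<close> in \<open>ball y e\<close> has distance
    less than \<open>2 * e\<close> from \<open>y\<close>; the first three bounds thus keep it in the
    chart, in the ball where \<open>M\<close> is bounded below and in the unit ball. The last one
    gives \<open>4 * e * c < B\<close>, which contradicts the final estimate.\<close>
  define e where "e = min (min (e1 / 2) (e2 / 2)) (min (1 / 2) (B / (4 * (c + 1))))"
  have e: "e > 0" "2 * e \<le> e1" "2 * e \<le> e2" "2 * e \<le> 1" "4 * e * c < B"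
  proof -
    show "e > 0" using e1 B c by (simp add: e_def)
    have "e \<le> B / (4 * (c + 1))" by (simp add: e_def)
    then have "4 * e * (c + 1) \<le> B" using c(1) by (simp add: pos_le_divide_eq mult_ac)
    then show "4 * e * c < B" using \<open>e > 0\<close> by (simp add: algebra_simps)
  qed (simp_all add: e_def)
  have unique: "z = z'" if x: "x \<in> ball y e" and z: "best_approximation C x z" and z': "best_approximation C x z'" for x z z'
  proof (rule ccontr)
    assume "z \<noteq> z'"
    define N where "N = norm (z' - z)"
    have N: "N > 0" using \<open>z \<noteq> z'\<close> by (simp add: N_def)
    have near: "norm (x - a) < e" "a \<in> ball y (2 * e)" "a \<in> C" if "best_approximation C x a" for a
    proof -
      have "norm (x - a) \<le> norm (x - y)" "a \<in> C" using that y by (auto simp: best_approximation_def)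
      then show "norm (x - a) < e" "a \<in> C" using x by (auto simp: dist_norm norm_minus_commute)
      then show "a \<in> ball y (2 * e)" using x norm_triangle_ineq[of "y - x" "x - a"] by (simp add: dist_norm)
    qed
    have zW: "z \<in> g ` ball (\<Phi> y) r" using near(2)[OF z] e(2) e1(2) by auto
    then have gz: "\<Phi> z \<in> ball (\<Phi> y) r" "g (\<Phi> z) = z" using g unfolding is_chart_def by blast+
    define w where "w = \<Phi> z' - \<Phi> z"
    \<comment> \<open>The tangent vector at \<open>z\<close> with the same image under
      \<open>M z\<close> as the displacement \<open>\<Phi> z' - \<Phi> z\<close>; it differs from
      \<open>z' - z\<close> by a term quadratic in \<open>N\<close>.\<close>
    define u where "u = g' (\<Phi> z) w"
    have Mu: "M z *v u = w" using is_chartD(4)[OF g gz(1), of w] by (simp add: u_def gz(2))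
    have wK: "w $ i = 0" if "i \<in> K" for i
      using \<Phi>_K[OF near(3)[OF z] that] \<Phi>_K[OF near(3)[OF z'] that] by (simp add: w_def)
    have orth: "(x - z) \<bullet> u = 0" unfolding u_def by (rule best_approximation_normal[OF g zW z wK])
    have "B * norm (z' - z - u) \<le> norm (M z *v (z' - z - u))"
      using near(2)[OF z] e(3) by (intro B(3)) simp
    also have "\<dots> = norm (\<Phi> z' - \<Phi> z - M z *v (z' - z))"
      by (simp add: matrix_vector_mult_diff_distrib Mu w_def norm_minus_commute)
    also have "\<dots> \<le> c * N\<^sup>2"
      unfolding N_def using near(2)[OF z] near(2)[OF z'] e(4) by (intro c(2)) auto
    finally have small: "B * norm (z' - z - u) \<le> c * N\<^sup>2" .
    have "(x - z') \<bullet> (x - z') = (x - z) \<bullet> (x - z) - 2 * ((x - z) \<bullet> (z' - z)) + (z' - z) \<bullet> (z' - z)"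
      by (simp add: algebra_simps inner_commute)
    moreover have "(x - z') \<bullet> (x - z') = (x - z) \<bullet> (x - z)"
    proof -
      have "norm (x - z') = norm (x - z)" using z z' unfolding best_approximation_def by (meson antisym)
      then show ?thesis by (simp add: norm_eq)
    qed
    ultimately have "N\<^sup>2 = 2 * ((x - z) \<bullet> (z' - z))" by (simp add: N_def power2_norm_eq_inner)
    also have "\<dots> = 2 * ((x - z) \<bullet> (z' - z - u))" using orth by (simp add: inner_diff_right)
    also have "\<dots> \<le> 2 * (norm (x - z) * norm (z' - z - u))"
      using norm_cauchy_schwarz[of "x - z" "z' - z - u"] by simp
    also have "\<dots> \<le> 2 * (e * norm (z' - z - u))"
      using near(1)[OF z] by (intro mult_left_mono mult_right_mono) auto
    finally have "B * N\<^sup>2 \<le> B * (2 * (e * norm (z' - z - u)))"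
      using B(1) by (intro mult_left_mono) auto
    also have "\<dots> = 2 * e * (B * norm (z' - z - u))" by simp
    also have "\<dots> \<le> 2 * e * (c * N\<^sup>2)" using small e(1) by (intro mult_left_mono) auto
    also have "\<dots> \<le> 4 * e * c * N\<^sup>2"
    proof -
      have "0 \<le> e * (c * N\<^sup>2)" using e(1) c(1) by simp
      moreover have "2 * e * (c * N\<^sup>2) = 2 * (e * (c * N\<^sup>2))" "4 * e * c * N\<^sup>2 = 4 * (e * (c * N\<^sup>2))"
        by simp_all
      ultimately show ?thesis by linarith
    qed
    also have "\<dots> < B * N\<^sup>2" using e(5) N by (intro mult_strict_right_mono) auto
    finally show False by simp
  qed
  have "\<exists>z. best_approximation C x z" for x
  proof -
    have "C \<noteq> {}" using y by blast
    then obtain z where "z \<in> C" "\<And>a. a \<in> C \<Longrightarrow> dist x z \<le> dist x a"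
      using distance_attains_inf[OF closed_C, of x] by metis
    then show ?thesis unfolding best_approximation_def dist_norm by blast
  qed
  with unique e(1) show ?thesis by (intro exI[of _ e]) blast
qed

end

section \<open>Smooth points and the action of the group\<close>

lemma jacobian_row:
  fixes p :: "'m::finite \<Rightarrow> real^'n::finite \<Rightarrow> real"
  assumes "\<And>i. real_polynomial_function (p i)"
  shows "row i (jacobian (\<lambda>x. \<chi> i. p i x) (at y)) = grad (p i) y"
proof -
  have "((\<lambda>x. \<chi> i. p i x) has_derivative (\<lambda>v. \<chi> i. grad (p i) y \<bullet> v)) (at y)"
    unfolding has_derivative_componentwise_within[of "\<lambda>x. \<chi> i. p i x"]
    by (auto simp: Basis_vec_def inner_axis intro: has_derivative_polynomial assms)
  then have "frechet_derivative (\<lambda>x. \<chi> i. p i x) (at y) = (\<lambda>v. \<chi> i. grad (p i) y \<bullet> v)"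
    using frechet_derivative_at by metis
  then show ?thesis by (simp add: jacobian_def matrix_def row_def vec_eq_iff inner_axis)
qed

text \<open>The rank at \<open>y\<close> provides \<open>n - d\<close> independent gradients, which
  remain independent wherever the determinant is nonzero. At such a point of \<open>C\<close> a
  normal vector outside their span would be one too many for
  \<open>independent_normal_vectors\<close>.\<close>

lemma smooth_point_local_equations:
  fixes p :: "'m::finite \<Rightarrow> real^'n::finite \<Rightarrow> real"
  assumes C: "irreducible_variety C" and gen: "generates_vanishing_ideal p C"
    and d: "variety_dim C = enat d" "d \<le> CARD('n)" and smooth: "smooth_point p C y"
  shows "\<exists>K Q. local_equations C y K Q p"
proof -
  have p: "real_polynomial_function (p i)" for i using gen by (simp add: generates_vanishing_ideal_def)
  have variety: "real_variety C" using C by (simp add: irreducible_variety_def)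
  have p_van: "vanishes_on (p i) C" for i by (rule generator_vanishes_on[OF gen])
  have y: "y \<in> C" using smooth by (simp add: smooth_point_def)
  define J where "J = (jacobian (\<lambda>x. \<chi> i. p i x) (at y) :: real^'n^'m)"
  have rows: "rows J = range (\<lambda>i. grad (p i) y)" by (auto simp: rows_def J_def jacobian_row[OF p])
  have rank: "dim (rows J) = CARD('n) - d"
    using smooth by (simp add: smooth_point_def J_def[symmetric] d(1) row_rank_def)
  obtain S where S: "S \<subseteq> rows J" "independent S" "card S = CARD('n) - d"
    using basis_exists[of "rows J"] rank by metis
  have "S \<subseteq> normal_vectors C y"
    using S(1) p p_van unfolding rows normal_vectors_def by blast
  then obtain K Q where Q: "\<And>i. real_polynomial_function (Q i)" "\<And>i. i \<in> K \<Longrightarrow> vanishes_on (Q i) C"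
    and det_y: "det (\<chi> i. grad (Q i) y) \<noteq> 0" and K: "card K = card S"
    using extend_normal_vectors[OF _ S(2)] by metis
  have "local_equations C y K Q p"
  proof
    show "det (\<chi> i. grad (Q i) y) \<noteq> 0" by (rule det_y)
    fix z q
    assume z: "z \<in> C" and det: "det (\<chi> i. grad (Q i) z) \<noteq> 0"
      and q: "real_polynomial_function q" "vanishes_on q C"
    let ?T = "(\<lambda>i. grad (Q i) z) ` K"
    note rows = det_nonzero_independent[OF det]
    have T: "independent ?T" by (rule independent_mono[OF rows(2)]) blast
    have "card ?T = CARD('n) - d"
      using card_image[of "\<lambda>i. grad (Q i) z" K] inj_on_subset[OF rows(1)] K S(3) by simp
    have normal: "insert (grad q z) ?T \<subseteq> normal_vectors C z"
      using q Q by (auto simp: normal_vectors_def)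
    show "grad q z \<in> span ?T"
    proof (rule ccontr)
      assume out: "grad q z \<notin> span ?T"
      then have "independent (insert (grad q z) ?T)" using T by (simp add: independent_insertI)
      then have "card (insert (grad q z) ?T) + d \<le> CARD('n)"
        by (rule independent_normal_vectors[OF C d(1) z normal])
      moreover have "grad q z \<notin> ?T" using out span_base[of "grad q z" ?T] by metis
      ultimately show False using \<open>card ?T = CARD('n) - d\<close> d(2) by simp
    qed
  qed (use variety gen y Q in auto)
  then show ?thesis by blast
qed

lemma best_approximation_invariant:
  fixes A :: "real^'n^'n"
  assumes A: "orthogonal_matrix A" "(\<lambda>x. A *v x) ` C = C" "A *v x = x"
    and y: "best_approximation C x y"
  shows "best_approximation C x (A *v y)"
proof -
  have "orthogonal_transformation ((*v) A)"
    using A(1) by (simp add: orthogonal_transformation_matrix)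
  then have "norm (A *v (x - y)) = norm (x - y)" by (rule orthogonal_transformation_norm)
  then have "norm (x - A *v y) = norm (x - y)"
    by (simp only: matrix_vector_mult_diff_distrib A(3))
  moreover have "A *v y \<in> C" using A(2) y unfolding best_approximation_def by blast
  ultimately show ?thesis using y by (simp add: best_approximation_def)
qed

theorem proposition6p3:
  fixes C :: "(real^'n) set"
    and p :: "'m::finite \<Rightarrow> real^'n \<Rightarrow> real"
    and G :: "(real^'n^'n) set"
    and U :: "(complex^'n) set"
    and UR :: "(real^'n) set"
    and d l :: nat
  assumes "irreducible_variety C"
    and "generates_vanishing_ideal p C"
    and "variety_dim C = enat d" and "d \<in> {1..CARD('n) - 1}"
    and "orthogonal_group G" and "finite G" and "card G > 1"
    and "U = fixed_points (map_matrix complex_of_real ` G)"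
    and "UR = fixed_points G"
    and "vec.dim U = l" and "dim UR = l" and "l \<in> {1..CARD('n) - 1}"
    and "\<And>A. A \<in> G \<Longrightarrow> (\<lambda>x. A *v x) ` C = C"
    and "UR \<inter> C \<subset> UR" and "UR \<inter> C \<subset> C"
  shows "\<exists>N. semialgebraic N \<and> open N \<and>
    {y \<in> C \<inter> UR. smooth_point p C y} \<subseteq> N \<and>
    (\<forall>x\<in>N. \<exists>!y. best_approximation C x y) \<and>
    (\<forall>x\<in>N \<inter> UR. \<forall>y. best_approximation C x y \<longrightarrow> y \<in> C \<inter> UR)"
proof -
  \<comment> \<open>The required set is the interior of \<open>E\<close>: it is open and
    semialgebraic, and the ball found around each smooth point lies in \<open>E\<close>.\<close>
  define E where "E = {x. \<exists>!y. best_approximation C x y}"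
  have unique: "\<exists>!y. best_approximation C x y" if "x \<in> interior E" for x
    using interior_subset that unfolding E_def by blast
  have "real_variety C" using assms(1) by (simp add: irreducible_variety_def)
  then have "semialgebraic (interior E)"
    unfolding E_def by (intro semialgebraic_interior semialgebraic_unique_best_approximation)
  moreover have "y \<in> interior E" if "smooth_point p C y" for y
  proof -
    have "d \<le> CARD('n)" using assms(4) unfolding atLeastAtMost_iff by linarith
    then obtain K Q where chart: "local_equations C y K Q p"
      using smooth_point_local_equations[OF assms(1-3) _ \<open>smooth_point p C y\<close>] by blast
    obtain e where "e > 0" "\<forall>x\<in>ball y e. \<exists>!z. best_approximation C x z"
      using local_equations.unique_best_approximation_near[OF chart] by blast
    then have "e > 0" "ball y e \<subseteq> E" unfolding E_def by blast+
    then show ?thesis unfolding mem_interior by blast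
  qed
  moreover have "y \<in> C \<inter> UR"
    if x: "x \<in> interior E" "x \<in> UR" and y: "best_approximation C x y" for x y
  proof -
    \<comment> \<open>As an isometry that preserves \<open>C\<close> and fixes \<open>x\<close>,
      \<open>A\<close> maps nearest points of \<open>x\<close> to nearest points; there is only
      one.\<close>
    have "A *v y = y" if A: "A \<in> G" for A
    proof -
      have "orthogonal_matrix A" "A *v x = x"
        using A assms(5) x(2) unfolding assms(9) orthogonal_group_def fixed_points_def by blast+
      then have "best_approximation C x (A *v y)"
        by (intro best_approximation_invariant assms(13)[OF A] y)
      then show ?thesis using unique[OF x(1)] y by blast
    qed
    then show ?thesis using y by (simp add: assms(9) fixed_points_def best_approximation_def)
  qed
  ultimately show ?thesis using unique by (intro exI[of _ "interior E"]) auto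
qed

end
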